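(* Let $Y$ be any of the spaces $\mathcal{LM}$, $\mathcal L L^1$, $\mathcal{LM}_d$, $\mathcal{LM}_s$, $\mathcal R_0$, $\mathcal J_0$. Then the closure of $Y$ in $\mathcal B$ with respect to the $\mathcal B$-norm coincides with the closure of $Y$ in $\mathcal B$ with respect to the sup norm $\|\cdot\|_\infty$. Moreover, if $Y$ is any of $\mathcal LL^1$, $\mathcal R_0$, $\mathcal J_0$, then the closure of $Y$ in $\mathcal B$ (for the $\mathcal B$-norm) is $\mathcal B\cap C_0(\overline{\mathbb C}_+)$.
   Context: $\mathbb C_+=\{z:\Re z>0\}$. $\mathcal B$ is the space of holomorphic $f$ on $\mathbb C_+$ with $\|f\|_{\mathcal B_0}:=\int_0^\infty\sup_{\beta\in\mathbb R}|f'(\alpha+i\beta)|\,d\alpha<\infty$; such $f$ are bounded and extend continuously to $\overline{\mathbb C}_+$; norm $\|f\|_{\mathcal B}=\|f\|_\infty+\|f\|_{\mathcal B_0}$. For a set $\mathcal N$ of bounded Borel measures on $\mathbb R_+=[0,\infty)$, $\mathcal{LN}=\{\mathcal L\mu:\mu\in\mathcal N\}$ with $\mathcal L\mu(z)=\int e^{-zt}d\mu(t)$; $M=M(\mathbb R_+)$ is all bounded Borel measures, $L^1$ the absolutely continuous ones, $M_d$ the discrete ones, $M_s$ the singular non-atomic ones. It is known that $\mathcal{LM}\subset\mathcal B$. $\mathcal R_0$ is the space of rational functions vanishing at infinity with no poles in $\overline{\mathbb C}_+$; $\mathcal J_0$ is the space of entire functions of exponential type belonging to $H^\infty(\mathbb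 C_+)\cap C_0(\overline{\mathbb C}_+)$. $C_0(\overline{\mathbb C}_+)$ denotes continuous functions on $\overline{\mathbb C}_+$ tending to $0$ as $|z|\to\infty$. *)

theory Defs
  imports "HOL-Analysis.Analysis" "HOL-Computational_Algebra.Polynomial"
begin

definition Cplus :: "complex set" where
  "Cplus = {z. Re z > 0}"

definition Cplus_cl :: "complex set" where
  "Cplus_cl = {z. Re z \<ge> 0}"

text \<open>Functions are represented as maps complex to complex; only their values on
  the open half-plane matter.  Sup norm over the open half-plane (ennreal valued).\<close>
definition sup_norm :: "(complex \<Rightarrow> complex) \<Rightarrow> ennreal" where
  "sup_norm f = (SUP z\<in>Cplus. ennreal (cmod (f z)))"

definition B0_norm :: "(complex \<Rightarrow> complex) \<Rightarrow> ennreal" where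
  "B0_norm f = (\<integral>\<^sup>+ \<alpha>. indicator {0<..} \<alpha> *
       (SUP \<beta>::real. ennreal (cmod (deriv f (Complex \<alpha> \<beta>)))) \<partial>lborel)"

definition B_space :: "(complex \<Rightarrow> complex) set" where
  "B_space = {f. f holomorphic_on Cplus \<and> B0_norm f < \<infinity>}"

definition B_norm :: "(complex \<Rightarrow> complex) \<Rightarrow> ennreal" where
  "B_norm f = sup_norm f + B0_norm f"

definition C0_cl :: "(complex \<Rightarrow> complex) \<Rightarrow> bool" where
  "C0_cl f \<longleftrightarrow> (\<exists>g. continuous_on Cplus_cl g \<and> (\<forall>z\<in>Cplus. g z = f z) \<and>
       (g \<longlongrightarrow> 0) (inf at_infinity (principal Cplus_cl)))"

definition closure_B :: "(complex \<Rightarrow> complex) set \<Rightarrow> (complex \<Rightarrow> complex) set" where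
  "closure_B Y = {g \<in> B_space. \<forall>\<epsilon>>0. \<exists>h\<in>Y. B_norm (\<lambda>z. g z - h z) < ennreal \<epsilon>}"

definition closure_sup :: "(complex \<Rightarrow> complex) set \<Rightarrow> (complex \<Rightarrow> complex) set" where
  "closure_sup Y = {g \<in> B_space. \<forall>\<epsilon>>0. \<exists>h\<in>Y. sup_norm (\<lambda>z. g z - h z) < ennreal \<epsilon>}"

text \<open>Finite positive Borel measures on the real line concentrated on [0,\<infinity>).
  Bounded complex Borel measures on R_+ are exactly the combinations
  M1 - M2 + i (M3 - M4) of such measures (Jordan decomposition); a complex measure
  is absolutely continuous / discrete / singular non-atomic iff its Jordan parts are.\<close>
definition pos_meas_Rplus :: "real measure \<Rightarrow> bool" where
  "pos_meas_Rplus M \<longleftrightarrow> sets M = sets borel \<and> finite_measure M \<and> emeasure M {..<0} = 0"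

definition laplace_pos :: "real measure \<Rightarrow> complex \<Rightarrow> complex" where
  "laplace_pos M z = (LINT t|M. exp (- (z * complex_of_real t)))"

definition laplace_class :: "(real measure \<Rightarrow> bool) \<Rightarrow> (complex \<Rightarrow> complex) set" where
  "laplace_class P = {(\<lambda>z. laplace_pos M1 z - laplace_pos M2 z
        + \<i> * (laplace_pos M3 z - laplace_pos M4 z)) | M1 M2 M3 M4.
     (\<forall>M\<in>{M1, M2, M3, M4}. pos_meas_Rplus M \<and> P M)}"

definition LM :: "(complex \<Rightarrow> complex) set" where
  "LM = laplace_class (\<lambda>M. True)"

definition LL1 :: "(complex \<Rightarrow> complex) set" where
  "LL1 = laplace_class (\<lambda>M. absolutely_continuous lborel M)"

definition LMd :: "(complex \<Rightarrow> complex) set" where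
  "LMd = laplace_class (\<lambda>M. \<exists>A. countable A \<and> emeasure M (UNIV - A) = 0)"

definition LMs :: "(complex \<Rightarrow> complex) set" where
  "LMs = laplace_class (\<lambda>M. (\<exists>N\<in>sets borel. emeasure lborel N = 0 \<and> emeasure M (UNIV - N) = 0)
                            \<and> (\<forall>x. emeasure M {x} = 0))"

definition R0 :: "(complex \<Rightarrow> complex) set" where
  "R0 = {(\<lambda>z. poly p z / poly q z) | p q. degree p < degree q \<and>
                                        (\<forall>z\<in>Cplus_cl. poly q z \<noteq> 0)}"

definition J0 :: "(complex \<Rightarrow> complex) set" where
  "J0 = {f. f holomorphic_on UNIV \<and> (\<exists>A B. \<forall>z. cmod (f z) \<le> A * exp (B * cmod z)) \<and>
            bounded (f ` Cplus) \<and> C0_cl f}"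

end

theory Submission
  imports Defs "HOL-Complex_Analysis.Complex_Analysis"
begin

text \<open>
  Let \<open>T f = f(\<cdot> + \<delta>) - f(\<cdot> + n)\<close>. By Cauchy's estimates \<open>|(T f)'(z)| \<le> 8 n \<parallel>f\<parallel>\<^sub>\<infinity> / (Re z + \<delta>)\<^sup>2\<close>,
  so \<open>T\<close> is bounded from the sup norm to the norm of \<open>\<B>\<close>. Every \<open>g \<in> \<B>\<close> has a limit \<open>c\<close> at infinity
  along the real direction and \<open>T g + c \<rightarrow> g\<close> in \<open>\<B>\<close> as \<open>\<delta> \<rightarrow> 0\<close>, \<open>n \<rightarrow> \<infinity>\<close>. Each of the six spaces
  is stable under \<open>h \<mapsto> T h + h(\<infinity>)\<close>, so a sup norm approximation \<open>h\<close> of \<open>g\<close> can be replaced by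
  the approximation \<open>T h + h(\<infinity>)\<close> in \<open>\<B>\<close>.

  For the second part, the Cayley transform carries holomorphic functions in \<open>C\<^sub>0\<close> to the disc algebra,
  where polynomials are dense; they become polynomials in \<open>1 / (1 + z)\<close> without constant term. These are
  rational and are Laplace transforms of \<open>L\<^sup>1\<close> functions, and cutting off \<open>e\<^sup>-\<^sup>t\<close> makes them entire of
  exponential type. Conversely, uniform limits of functions vanishing at infinity vanish at
  infinity; for \<open>\<L>L\<^sup>1\<close> this uses the Riemann-Lebesgue lemma.
\<close>

section \<open>The norms\<close>

text \<open>The obstacle is that the sup norm does not control \<open>B0_norm\<close>: Cauchy's
  inequality bounds \<open>deriv f z\<close> only by a multiple of \<open>1 / Re z\<close>, whose
  integral diverges logarithmically both at 0 and at infinity. Translating by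
  \<open>\<delta>\<close> repairs the first divergence, subtracting the translate by
  \<open>n\<close> the second. Translations are the right smoothing because every one of the six
  spaces tolerates them. On a measure the operation is multiplication by a weight between 0 and 1,
  so null sets, and with them the type of the measure, survive; a translate to the right of a
  rational function acquires no pole in the closed half-plane, and a translate of an entire function
  keeps its exponential type. A difference of translates forgets the value at infinity, which for a
  measure is its atom at 0; hence the correction by \<open>h(\<infinity>)\<close>, which is 0 for
  \<open>LL1\<close>, \<open>R0\<close> and \<open>J0\<close>. The two assertions meet in the sup
  norm closure: once the closures agree, only the sup norm closure of \<open>LL1\<close>,
  \<open>R0\<close> and \<open>J0\<close> has to be identified, so the polynomial approximation is
  purely uniform and involves no derivatives.\<close>

definition vert_sup :: "(complex \<Rightarrow> complex) \<Rightarrow> real \<Rightarrow> ennreal" where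
  "vert_sup f \<alpha> = indicator {0<..} \<alpha> * (SUP \<beta>::real. ennreal (cmod (deriv f (Complex \<alpha> \<beta>))))"

lemma B0_norm_eq: "B0_norm f = (\<integral>\<^sup>+ \<alpha>. vert_sup f \<alpha> \<partial>lborel)"
  by (simp add: B0_norm_def vert_sup_def)

lemma open_Cplus: "open Cplus"
  unfolding Cplus_def by (rule open_halfspace_Re_gt)

lemma deriv_le_vert_sup:
  assumes "z \<in> Cplus"
  shows "ennreal (cmod (deriv f z)) \<le> vert_sup f (Re z)"
proof -
  have "ennreal (cmod (deriv f (Complex (Re z) (Im z)))) \<le> (SUP \<beta>. ennreal (cmod (deriv f (Complex (Re z) \<beta>))))"
    by (rule SUP_upper) simp
  then show ?thesis using assms by (simp add: vert_sup_def Cplus_def)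
qed

lemma vert_sup_le:
  assumes "\<And>z. Re z = \<alpha> \<Longrightarrow> \<alpha> > 0 \<Longrightarrow> ennreal (cmod (deriv f z)) \<le> B"
  shows "vert_sup f \<alpha> \<le> B"
  using assms by (auto simp: vert_sup_def indicator_def intro!: SUP_least)

text \<open>Because \<open>Cplus\<close> is open, agreement there is agreement near each point and
  hence of derivatives. This lets approximants be specified on \<open>Cplus\<close> only.\<close>

lemma vert_sup_cong:
  assumes "\<And>z. z \<in> Cplus \<Longrightarrow> f z = g z"
  shows "vert_sup f \<alpha> = vert_sup g \<alpha>"
proof -
  have "deriv f z = deriv g z" if "z \<in> Cplus" for z
    using that assms open_Cplus
    by (intro deriv_cong_ev eventually_nhds_in_open[THEN eventually_mono]) auto
  then show ?thesis
    by (auto simp: vert_sup_def indicator_def Cplus_def)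
qed

lemma sup_norm_cong:
  assumes "\<And>z. z \<in> Cplus \<Longrightarrow> f z = g z"
  shows "sup_norm f = sup_norm g"
  using assms by (auto simp: sup_norm_def intro!: SUP_cong)

lemma B_norm_cong:
  assumes "\<And>z. z \<in> Cplus \<Longrightarrow> f z = g z"
  shows "B_norm f = B_norm g"
  using sup_norm_cong[OF assms] vert_sup_cong[OF assms] by (simp add: B_norm_def B0_norm_eq)

text \<open>An uncountable supremum is measurable here because its superlevel sets are projections
  to the real axis of open sets of the plane, and \<open>Re\<close> is an open map.\<close>

lemma measurable_vert_sup:
  assumes "f holomorphic_on Cplus"
  shows "vert_sup f \<in> borel_measurable lborel"
proof -
  have "{\<alpha>. a < vert_sup f \<alpha>} \<in> sets borel" for a :: ennreal
  proof -
    have hd: "deriv f holomorphic_on Cplus"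
      using assms open_Cplus by (rule holomorphic_deriv)
    have c: "continuous_on Cplus (\<lambda>z. ennreal (cmod (deriv f z)))"
      by (intro continuous_on_ennreal continuous_on_norm holomorphic_on_imp_continuous_on hd)
    have "open {z \<in> Cplus. a < ennreal (cmod (deriv f z))}"
      using continuous_on_open_vimage[OF open_Cplus, THEN iffD1, OF c, rule_format, of "{a<..}"]
      by (simp add: vimage_def Int_def conj_commute)
    then have "open (Re ` {z \<in> Cplus. a < ennreal (cmod (deriv f z))})"
      by (rule open_surjective_linear_image)
        (auto simp: surj_def bounded_linear.linear[OF bounded_linear_Re] intro: exI[of _ "complex_of_real _"])
    \<comment> \<open>For \<alpha> \<le> 0 the left-hand value is 0, which never exceeds an
      \<open>ennreal\<close>, so only positive abscissae occur on either side.\<close>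
    moreover have "{\<alpha>. a < vert_sup f \<alpha>} = Re ` {z \<in> Cplus. a < ennreal (cmod (deriv f z))}"
    proof (intro set_eqI iffI)
      fix \<alpha> assume "\<alpha> \<in> {\<alpha>. a < vert_sup f \<alpha>}"
      then have p: "\<alpha> > 0" and "a < (SUP \<beta>. ennreal (cmod (deriv f (Complex \<alpha> \<beta>))))"
        by (cases "\<alpha> > 0"; simp add: vert_sup_def)+
      then obtain \<beta> where "a < ennreal (cmod (deriv f (Complex \<alpha> \<beta>)))"
        by (auto simp: less_SUP_iff)
      with p show "\<alpha> \<in> Re ` {z \<in> Cplus. a < ennreal (cmod (deriv f z))}"
        by (intro image_eqI[of _ _ "Complex \<alpha> \<beta>"]) (auto simp: Cplus_def)
    next
      fix \<alpha> assume "\<alpha> \<in> Re ` {z \<in> Cplus. a < ennreal (cmod (deriv f z))}"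
      then show "\<alpha> \<in> {\<alpha>. a < vert_sup f \<alpha>}"
        using deriv_le_vert_sup less_le_trans by fastforce
    qed
    ultimately show ?thesis by simp
  qed
  then show ?thesis by (intro borel_measurableI_greater) simp
qed

lemma sup_norm_triangle: "sup_norm (\<lambda>z. f z + g z) \<le> sup_norm f + sup_norm g"
  unfolding sup_norm_def
proof (rule SUP_least)
  fix z assume z: "z \<in> Cplus"
  have "ennreal (cmod (f z + g z)) \<le> ennreal (cmod (f z)) + ennreal (cmod (g z))"
    by (simp add: norm_triangle_ineq flip: ennreal_plus)
  also have "\<dots> \<le> (SUP z\<in>Cplus. ennreal (cmod (f z))) + (SUP z\<in>Cplus. ennreal (cmod (g z)))"
    using z by (intro add_mono SUP_upper)
  finally show "ennreal (cmod (f z + g z)) \<le> \<dots>" .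
qed

text \<open>Holomorphy enters twice: for the additivity of \<open>deriv\<close>, and for the
  measurability that splitting the integral requires.\<close>

lemma B0_norm_triangle:
  assumes "f holomorphic_on Cplus" "g holomorphic_on Cplus"
  shows "B0_norm (\<lambda>z. f z + g z) \<le> B0_norm f + B0_norm g"
proof -
  have "vert_sup (\<lambda>z. f z + g z) \<alpha> \<le> vert_sup f \<alpha> + vert_sup g \<alpha>" for \<alpha>
  proof (rule vert_sup_le)
    fix z assume z: "Re z = \<alpha>" "\<alpha> > 0"
    then have zC: "z \<in> Cplus" by (simp add: Cplus_def)
    have "deriv (\<lambda>z. f z + g z) z = deriv f z + deriv g z"
      using assms zC open_Cplus by (intro deriv_add holomorphic_on_imp_differentiable_at)
    then have "ennreal (cmod (deriv (\<lambda>z. f z + g z) z)) \<le> ennreal (cmod (deriv f z)) + ennreal (cmod (deriv g z))"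
      by (simp add: norm_triangle_ineq flip: ennreal_plus)
    also have "\<dots> \<le> vert_sup f \<alpha> + vert_sup g \<alpha>"
      using zC z deriv_le_vert_sup by (intro add_mono) force+
    finally show "ennreal (cmod (deriv (\<lambda>z. f z + g z) z)) \<le> \<dots>" .
  qed
  then have "B0_norm (\<lambda>z. f z + g z) \<le> (\<integral>\<^sup>+ \<alpha>. vert_sup f \<alpha> + vert_sup g \<alpha> \<partial>lborel)"
    unfolding B0_norm_eq by (intro nn_integral_mono)
  also have "\<dots> = B0_norm f + B0_norm g"
    unfolding B0_norm_eq using assms by (intro nn_integral_add measurable_vert_sup)
  finally show ?thesis .
qed

lemma B_norm_triangle:
  assumes "f holomorphic_on Cplus" "g holomorphic_on Cplus"
  shows "B_norm (\<lambda>z. f z + g z) \<le> B_norm f + B_norm g"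
  using add_mono[OF sup_norm_triangle[of f g] B0_norm_triangle[OF assms]]
  by (simp add: B_norm_def ac_simps)

lemma sup_norm_le_B_norm: "sup_norm f \<le> B_norm f"
  by (simp add: B_norm_def)

lemma B_norm_const: "B_norm (\<lambda>z. c) = ennreal (cmod c)"
proof -
  have "Cplus \<noteq> {}" by (auto simp: Cplus_def intro: exI[of _ 1])
  then show ?thesis
    by (simp add: B_norm_def sup_norm_def B0_norm_def bot_ennreal zero_ennreal_def[symmetric])
qed

lemma sup_norm_le:
  assumes "\<And>z. z \<in> Cplus \<Longrightarrow> ennreal (cmod (f z)) \<le> B"
  shows "sup_norm f \<le> B"
  using assms by (auto simp: sup_norm_def intro: SUP_least)

lemma norm_le_sup_norm:
  assumes "z \<in> Cplus"
  shows "ennreal (cmod (f z)) \<le> sup_norm f"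
  using assms by (auto simp: sup_norm_def intro: SUP_upper)

text \<open>Cauchy's inequality on the disc of radius \<open>Re z / 2\<close>: half the distance to
  the boundary keeps the closed disc inside \<open>Cplus\<close> and produces the factor
  \<open>2 ^ k\<close>.\<close>

lemma deriv_bound_Cplus:
  assumes f: "f holomorphic_on Cplus" and G: "\<And>z. z \<in> Cplus \<Longrightarrow> cmod (f z) \<le> G"
    and z: "z \<in> Cplus"
  shows "cmod ((deriv ^^ k) f z) \<le> fact k * G * 2 ^ k / Re z ^ k"
proof -
  have r: "Re z > 0" using z by (simp add: Cplus_def)
  have sub: "cball z (Re z / 2) \<subseteq> Cplus"
  proof
    fix w assume "w \<in> cball z (Re z / 2)"
    then have "\<bar>Re (z - w)\<bar> \<le> Re z / 2"
      using abs_Re_le_cmod[of "z - w"] by (simp add: dist_norm)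
    then have "Re w > 0" using r by (simp add: abs_if split: if_splits)
    then show "w \<in> Cplus" by (simp add: Cplus_def)
  qed
  have "cmod ((deriv ^^ k) f z) \<le> fact k * G / (Re z / 2) ^ k"
  proof (rule Cauchy_inequality)
    show "f holomorphic_on ball z (Re z / 2)"
      using f sub ball_subset_cball by (blast intro: holomorphic_on_subset)
    show "continuous_on (cball z (Re z / 2)) f"
      using f sub by (blast intro: holomorphic_on_imp_continuous_on holomorphic_on_subset)
    show "cmod (f x) \<le> G" if "cmod (z - x) = Re z / 2" for x
      using that sub by (intro G) (auto simp: dist_norm subset_iff)
  qed (use r in auto)
  then show ?thesis by (simp add: power_divide)
qed

text \<open>Mean value inequality for \<open>deriv f\<close> on the convex half-plane to the right
  of \<open>Re z + a\<close>. The constant 8 is \<open>fact 2 * 2 ^ 2\<close> from Cauchy's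
  inequality for the second derivative.\<close>

lemma deriv_shift_diff_bound:
  assumes f: "f holomorphic_on Cplus" and G: "\<And>z. z \<in> Cplus \<Longrightarrow> cmod (f z) \<le> G"
    and z: "Re z > 0" and ab: "a \<ge> 0" "a \<le> b"
  shows "cmod (deriv f (z + of_real b) - deriv f (z + of_real a)) \<le> 8 * G / (Re z + a)\<^sup>2 * (b - a)"
proof -
  let ?S = "{w. Re w \<ge> Re z + a}"
  have G0: "G \<ge> 0" using order_trans[OF norm_ge_zero G[of z]] z by (simp add: Cplus_def)
  have sub: "?S \<subseteq> Cplus" using z ab by (auto simp: Cplus_def)
  have "cmod (deriv f (z + of_real b) - deriv f (z + of_real a))
      \<le> (8 * G / (Re z + a)\<^sup>2) * cmod ((z + of_real b) - (z + of_real a))"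
  proof (rule field_differentiable_bound)
    show "convex ?S" by (rule convex_halfspace_Re_ge)
    show "(deriv f has_field_derivative deriv (deriv f) w) (at w within ?S)" if "w \<in> ?S" for w
      using that sub open_Cplus holomorphic_deriv[OF f open_Cplus]
      by (meson DERIV_deriv_iff_field_differentiable has_field_derivative_at_within
          holomorphic_on_imp_differentiable_at subset_iff)
    show "cmod (deriv (deriv f) w) \<le> 8 * G / (Re z + a)\<^sup>2" if w: "w \<in> ?S" for w
    proof -
      have "cmod (deriv (deriv f) w) \<le> 8 * G / (Re w)\<^sup>2"
        using deriv_bound_Cplus[OF f G, of w 2] w sub by (auto simp: numeral_2_eq_2)
      also have "\<dots> \<le> 8 * G / (Re z + a)\<^sup>2"
        using w z ab G0 by (intro divide_left_mono mult_pos_pos power_mono) auto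
      finally show ?thesis .
    qed
  qed (use ab in auto)
  moreover have "cmod ((z + of_real b) - (z + of_real a)) = b - a"
    using ab by (simp flip: of_real_diff)
  ultimately show ?thesis by simp
qed

text \<open>Fundamental theorem of calculus along a horizontal segment. It converts the integral
  norm into pointwise bounds that are uniform in \<open>Im z\<close>.\<close>

lemma horizontal_diff_le:
  assumes f: "f holomorphic_on Cplus" and z: "Re z > 0" and s: "s \<ge> 0"
  shows "ennreal (cmod (f (z + of_real s) - f z))
    \<le> (\<integral>\<^sup>+ \<alpha>. vert_sup f \<alpha> * indicator {Re z..Re z + s} \<alpha> \<partial>lborel)"
proof -
  define \<gamma> where "\<gamma> \<alpha> = Complex \<alpha> (Im z)" for \<alpha> :: real
  have \<gamma>: "\<gamma> \<alpha> = of_real \<alpha> + \<i> * Im z" for \<alpha> by (simp add: \<gamma>_def Complex_eq)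
  have vd: "((\<lambda>\<alpha>. f (\<gamma> \<alpha>)) has_vector_derivative deriv f (\<gamma> \<alpha>)) (at \<alpha> within {Re z..Re z + s})"
    if "\<alpha> \<in> {Re z..Re z + s}" for \<alpha>
  proof -
    have "\<gamma> \<alpha> \<in> Cplus" using that z by (simp add: \<gamma>_def Cplus_def)
    then have "(f has_field_derivative deriv f (\<gamma> \<alpha>)) (at (\<gamma> \<alpha>))"
      using f open_Cplus by (simp add: holomorphic_derivI)
    moreover have "(\<gamma> has_vector_derivative 1) (at \<alpha> within {Re z..Re z + s})"
      unfolding \<gamma>[abs_def] by (auto intro!: derivative_eq_intros)
    ultimately show ?thesis
      using field_vector_diff_chain_within[of \<gamma> 1 \<alpha> _ f "deriv f (\<gamma> \<alpha>)"]
      by (simp add: o_def has_field_derivative_at_within)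
  qed
  have cont: "continuous_on {Re z..Re z + s} (\<lambda>\<alpha>. deriv f (\<gamma> \<alpha>))"
  proof (rule continuous_on_compose2[of Cplus "deriv f"])
    show "continuous_on Cplus (deriv f)"
      using f open_Cplus by (intro holomorphic_on_imp_continuous_on holomorphic_deriv)
    show "continuous_on {Re z..Re z + s} \<gamma>" unfolding \<gamma>[abs_def] by (intro continuous_intros)
    show "\<gamma> ` {Re z..Re z + s} \<subseteq> Cplus" using z by (auto simp: \<gamma>_def Cplus_def)
  qed
  have hb: "has_bochner_integral lborel (\<lambda>\<alpha>. indicator {Re z..Re z + s} \<alpha> *\<^sub>R deriv f (\<gamma> \<alpha>))
      (f (\<gamma> (Re z + s)) - f (\<gamma> (Re z)))"
    using has_bochner_integral_FTC_Icc[of "Re z" "Re z + s" "\<lambda>\<alpha>. f (\<gamma> \<alpha>)" "\<lambda>\<alpha>. deriv f (\<gamma> \<alpha>)"] s vd cont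
    by simp
  have e: "f (z + of_real s) - f z = (LINT \<alpha>|lborel. indicator {Re z..Re z + s} \<alpha> *\<^sub>R deriv f (\<gamma> \<alpha>))"
    using has_bochner_integral_integral_eq[OF hb] by (simp add: \<gamma>_def complex_eq_iff) (metis Complex_eq complex_surj complex_of_real_def complex_add add.right_neutral)
  have "ennreal (cmod (f (z + of_real s) - f z))
     \<le> (\<integral>\<^sup>+ \<alpha>. ennreal (cmod (indicator {Re z..Re z + s} \<alpha> *\<^sub>R deriv f (\<gamma> \<alpha>))) \<partial>lborel)"
    unfolding e by (rule integral_norm_bound_ennreal) (rule integrable.intros[OF hb])
  also have "\<dots> \<le> (\<integral>\<^sup>+ \<alpha>. vert_sup f \<alpha> * indicator {Re z..Re z + s} \<alpha> \<partial>lborel)"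
  proof (rule nn_integral_mono)
    fix \<alpha>
    show "ennreal (cmod (indicator {Re z..Re z + s} \<alpha> *\<^sub>R deriv f (\<gamma> \<alpha>))) \<le> vert_sup f \<alpha> * indicator {Re z..Re z + s} \<alpha>"
      using deriv_le_vert_sup[of "\<gamma> \<alpha>" f] z by (auto simp: indicator_def \<gamma>_def Cplus_def)
  qed
  finally show ?thesis .
qed

section \<open>Approximation in the space B\<close>

text \<open>Otherwise the integrand would exceed \<open>e\<close> on a whole half-line and its
  integral could not be finite.\<close>

lemma vert_sup_small:
  assumes "f \<in> B_space" and e: "e > 0"
  obtains x where "x \<ge> a" "vert_sup f x \<le> ennreal e"
proof (cases "\<exists>x\<ge>max a 1. vert_sup f x \<le> ennreal e")
  case True
  then show ?thesis using that by fastforce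
next
  case False
  then have big: "vert_sup f x > ennreal e" if "x \<ge> max a 1" for x
    using that by (meson not_le)
  obtain N where N: "B0_norm f = ennreal N" "N \<ge> 0"
    using assms by (cases "B0_norm f") (auto simp: B_space_def)
  \<comment> \<open>The length for which the constant \<open>e\<close> integrates to
    \<open>N + 1\<close>, more than the total \<open>N\<close>.\<close>
  define L where "L = (N + 1) / e"
  have "(\<integral>\<^sup>+x. ennreal e * indicator {max a 1..max a 1 + L} x \<partial>lborel) \<le> B0_norm f"
    unfolding B0_norm_eq using big by (intro nn_integral_mono) (auto simp: indicator_def intro: less_imp_le)
  moreover have "(\<integral>\<^sup>+x. ennreal e * indicator {max a 1..max a 1 + L} x \<partial>lborel) = ennreal (N + 1)"
    using e N by (simp add: nn_integral_cmult_indicator L_def flip: ennreal_mult)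
  ultimately show ?thesis using N by simp
qed

lemma vertical_diff_le:
  assumes f: "f holomorphic_on Cplus" and x: "x > 0" and e: "vert_sup f x \<le> ennreal e" "e \<ge> 0"
  shows "cmod (f (Complex x b) - f (Complex x b')) \<le> e * \<bar>b - b'\<bar>"
proof -
  let ?S = "{w. Re w = x}"
  have sub: "?S \<subseteq> Cplus" using x by (auto simp: Cplus_def)
  have "cmod (f (Complex x b) - f (Complex x b')) \<le> e * cmod (Complex x b - Complex x b')"
  proof (rule field_differentiable_bound)
    show "convex ?S" by (auto simp: convex_def simp flip: distrib_right)
    show "(f has_field_derivative deriv f w) (at w within ?S)" if "w \<in> ?S" for w
      by (rule holomorphic_derivI[OF f open_Cplus]) (use that sub in auto)
    show "cmod (deriv f w) \<le> e" if "w \<in> ?S" for w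
    proof -
      have "ennreal (cmod (deriv f w)) \<le> ennreal e"
        using deriv_le_vert_sup[of w f] that sub e(1) by (auto intro: order_trans)
      then show ?thesis using e by simp
    qed
  qed auto
  also have "Complex x b - Complex x b' = \<i> * of_real (b - b')" by (simp add: complex_eq_iff)
  finally show ?thesis by (simp add: norm_mult del: of_real_diff)
qed

text \<open>Only a sequence of vertical lines on which \<open>f'\<close> is small is needed, so the maximum principle
  is avoided.\<close>

lemma B_space_limit:
  assumes "f \<in> B_space"
  obtains c where "\<And>z. z \<in> Cplus \<Longrightarrow>
    ennreal (cmod (f z - c)) \<le> (\<integral>\<^sup>+ \<alpha>. vert_sup f \<alpha> * indicator {Re z..} \<alpha> \<partial>lborel)"
proof -
  have f: "f holomorphic_on Cplus" and fin: "B0_norm f < \<infinity>" using assms by (auto simp: B_space_def)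
  have "\<exists>x. x \<ge> real k + 1 \<and> vert_sup f x \<le> ennreal (1 / (real k + 1))" for k
    by (rule vert_sup_small[OF assms, of "1 / (real k + 1)" "real k + 1"]) auto
  then obtain x where x: "\<And>k. x k \<ge> real k + 1" "\<And>k. vert_sup f (x k) \<le> ennreal (1 / (real k + 1))"
    by metis
  have hor: "ennreal (cmod (f (Complex (x k) (Im z)) - f z)) \<le> (\<integral>\<^sup>+ \<alpha>. vert_sup f \<alpha> * indicator {Re z..} \<alpha> \<partial>lborel)"
    if z: "z \<in> Cplus" "Re z \<le> x k" for z k
  proof -
    have "Complex (x k) (Im z) = z + of_real (x k - Re z)" by (simp add: complex_eq_iff)
    then have "ennreal (cmod (f (Complex (x k) (Im z)) - f z)) \<le>
       (\<integral>\<^sup>+ \<alpha>. vert_sup f \<alpha> * indicator {Re z..Re z + (x k - Re z)} \<alpha> \<partial>lborel)"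
      using horizontal_diff_le[OF f, of z "x k - Re z"] z by (simp add: Cplus_def)
    also have "\<dots> \<le> (\<integral>\<^sup>+ \<alpha>. vert_sup f \<alpha> * indicator {Re z..} \<alpha> \<partial>lborel)"
      by (intro nn_integral_mono) (auto simp: indicator_def)
    finally show ?thesis .
  qed
  have le_B0: "(\<integral>\<^sup>+ \<alpha>. vert_sup f \<alpha> * indicator {a..} \<alpha> \<partial>lborel) \<le> B0_norm f" for a
    unfolding B0_norm_eq by (intro nn_integral_mono) (auto simp: indicator_def)
  obtain N where N: "B0_norm f = ennreal N" "N \<ge> 0" using fin by (cases "B0_norm f") auto
  have "cmod (f (Complex (x k) 0) - f 1) \<le> N" for k
    using order_trans[OF hor[of 1 k] le_B0] x(1)[of k] N by (simp add: Cplus_def)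
  then have "cmod (f (Complex (x k) 0)) \<le> N + cmod (f 1)" for k
    using norm_triangle_sub[of "f (Complex (x k) 0)" "f 1"] by (smt (verit, best))
  then have "bounded (range (\<lambda>k. f (Complex (x k) 0)))" by (auto intro!: boundedI)
  \<comment> \<open>Compactness supplies \<open>c\<close> on the real axis only; the abscissae
    \<open>x k\<close> were chosen so that the same \<open>c\<close> serves every height.\<close>
  then obtain c r where r: "strict_mono r" and c: "(\<lambda>k. f (Complex (x (r k)) 0)) \<longlonglongrightarrow> c"
    using bounded_imp_convergent_subsequence[of "\<lambda>k. f (Complex (x k) 0)"] by (auto simp: o_def)
  show ?thesis
  proof (rule that[of c])
    fix z assume z: "z \<in> Cplus"
    let ?u = "\<lambda>k. f (Complex (x (r k)) (Im z))"
    have rk: "r k \<ge> k" for k using r by (rule seq_suble)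
    have "(\<lambda>k. \<bar>Im z\<bar> * (1 / (real k + 1))) \<longlonglongrightarrow> \<bar>Im z\<bar> * 0"
      using LIMSEQ_Suc[OF lim_1_over_n] by (intro tendsto_intros) (simp add: add.commute)
    then have l: "(\<lambda>k. \<bar>Im z\<bar> * (1 / (real k + 1))) \<longlonglongrightarrow> 0" by simp
    \<comment> \<open>On the line of abscissa \<open>x (r k)\<close>, moving from height 0 to height
      \<open>Im z\<close> changes \<open>f\<close> by at most
      \<open>\<bar>Im z\<bar> / (k + 1)\<close>.\<close>
    have "(\<lambda>k. ?u k - f (Complex (x (r k)) 0)) \<longlonglongrightarrow> 0"
    proof (rule Lim_null_comparison[OF _ l], intro always_eventually allI)
      fix k
      have "cmod (?u k - f (Complex (x (r k)) 0)) \<le> 1 / (real (r k) + 1) * \<bar>Im z - 0\<bar>"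
        using x(1)[of "r k"] by (intro vertical_diff_le f x) auto
      also have "\<dots> \<le> 1 / (real k + 1) * \<bar>Im z - 0\<bar>"
        using rk[of k] by (intro mult_right_mono divide_left_mono) auto
      finally show "cmod (?u k - f (Complex (x (r k)) 0)) \<le> \<bar>Im z\<bar> * (1 / (real k + 1))" by (simp add: mult.commute)
    qed
    from tendsto_add[OF this c] have "?u \<longlonglongrightarrow> c" by simp
    then have "(\<lambda>k. ennreal (cmod (?u k - f z))) \<longlonglongrightarrow> ennreal (cmod (c - f z))"
      by (intro tendsto_intros)
    moreover have "eventually (\<lambda>k. ennreal (cmod (?u k - f z)) \<le> (\<integral>\<^sup>+ \<alpha>. vert_sup f \<alpha> * indicator {Re z..} \<alpha> \<partial>lborel)) sequentially"
      using eventually_ge_at_top[of "nat \<lceil>Re z\<rceil>"]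
    proof eventually_elim
      case (elim k)
      then have "Re z \<le> real k" by linarith
      then have "Re z \<le> x (r k)" using x(1)[of "r k"] rk[of k] by linarith
      then show ?case by (intro hor z)
    qed
    ultimately have "ennreal (cmod (c - f z)) \<le> (\<integral>\<^sup>+ \<alpha>. vert_sup f \<alpha> * indicator {Re z..} \<alpha> \<partial>lborel)"
      by (intro tendsto_upperbound) auto
    then show "ennreal (cmod (f z - c)) \<le> (\<integral>\<^sup>+ \<alpha>. vert_sup f \<alpha> * indicator {Re z..} \<alpha> \<partial>lborel)"
      by (simp add: norm_minus_commute)
  qed
qed

text \<open>The distance to the limit at infinity is at most the full integral
  \<open>B0_norm f\<close>, so that limit anchors the bound.\<close>

lemma B_space_bounded:
  assumes "f \<in> B_space"
  obtains G where "G \<ge> 0" "\<And>z. z \<in> Cplus \<Longrightarrow> cmod (f z) \<le> G"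
proof -
  obtain c where c: "\<And>z. z \<in> Cplus \<Longrightarrow>
    ennreal (cmod (f z - c)) \<le> (\<integral>\<^sup>+ \<alpha>. vert_sup f \<alpha> * indicator {Re z..} \<alpha> \<partial>lborel)"
    using B_space_limit[OF assms] by blast
  obtain N where N: "B0_norm f = ennreal N" "N \<ge> 0"
    using assms by (cases "B0_norm f") (auto simp: B_space_def)
  have "cmod (f z) \<le> N + cmod c" if "z \<in> Cplus" for z
  proof -
    have "(\<integral>\<^sup>+ \<alpha>. vert_sup f \<alpha> * indicator {Re z..} \<alpha> \<partial>lborel) \<le> B0_norm f"
      unfolding B0_norm_eq by (intro nn_integral_mono) (auto simp: indicator_def)
    then have "cmod (f z - c) \<le> N" using order_trans[OF c[OF that]] N by fastforce
    then show ?thesis using norm_triangle_sub[of "f z" c] by linarith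
  qed
  then show ?thesis using that[of "N + cmod c"] N by simp
qed

text \<open>Dominated convergence: each positive abscissa eventually leaves both ends. The left end
  is \<open>2 / k\<close> rather than \<open>1 / k\<close> so that a point below
  \<open>1 / k\<close> stays in it after a further shift by less than \<open>1 / k\<close>.\<close>

lemma vert_sup_ends_small:
  assumes f: "f \<in> B_space" and e: "e > 0"
  obtains k :: nat where "k > 0"
    "(\<integral>\<^sup>+ \<alpha>. vert_sup f \<alpha> * indicator ({0<..<2 / real k} \<union> {real k..}) \<alpha> \<partial>lborel) < ennreal e"
proof -
  have [measurable]: "vert_sup f \<in> borel_measurable lborel" 
    using f by (intro measurable_vert_sup) (simp add: B_space_def)
  let ?u = "\<lambda>k::nat. \<integral>\<^sup>+ \<alpha>. vert_sup f \<alpha> * indicator ({0<..<2 / real k} \<union> {real k..}) \<alpha> \<partial>lborel"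
  have "?u \<longlonglongrightarrow> (\<integral>\<^sup>+ \<alpha>. 0 \<partial>(lborel :: real measure))"
  proof (rule nn_integral_dominated_convergence[where w = "vert_sup f"])
    show "(\<integral>\<^sup>+ \<alpha>. vert_sup f \<alpha> \<partial>lborel) < \<infinity>" using f by (simp add: B_space_def B0_norm_eq)
    show "AE \<alpha> in lborel. (\<lambda>k. vert_sup f \<alpha> * indicator ({0<..<2 / real k} \<union> {real k..}) \<alpha>) \<longlonglongrightarrow> 0"
    proof (rule always_eventually, rule allI, rule tendsto_eventually)
      fix \<alpha>
      show "eventually (\<lambda>k. vert_sup f \<alpha> * indicator ({0<..<2 / real k} \<union> {real k..}) \<alpha> = 0) sequentially"
      proof (cases "\<alpha> > 0")
        case True
        have "eventually (\<lambda>k. real k > max \<alpha> (2 / \<alpha>)) sequentially"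
          using filterlim_real_sequentially unfolding filterlim_at_top_dense by blast
        then show ?thesis
        proof eventually_elim
          case (elim k)
          then have "2 / real k < \<alpha>" using True
            by (cases "k = 0") (auto simp: field_simps)
          then show ?case using elim by (simp add: indicator_def)
        qed
      qed (simp add: vert_sup_def)
    qed
  qed (auto simp: indicator_def)
  then have "eventually (\<lambda>k. ?u k < ennreal e) sequentially"
    by (rule order_tendstoD(2)) (use e in simp)
  then have "eventually (\<lambda>k. ?u k < ennreal e \<and> k > 0) sequentially"
    using eventually_gt_at_top[of 0] by eventually_elim auto
  then show ?thesis using that by (auto dest: eventually_happens)
qed

section \<open>Translations and their effect on the norm of the space B\<close>

lemma nn_integral_lborel_shift:
  fixes u :: "real \<Rightarrow> ennreal"
  assumes "u \<in> borel_measurable lborel"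
  shows "(\<integral>\<^sup>+ x. u (x + a) \<partial>lborel) = (\<integral>\<^sup>+ x. u x \<partial>lborel)"
  using nn_integral_real_affine[of u 1 a] assms by (simp add: add.commute)

lemma holomorphic_shift:
  assumes f: "f holomorphic_on Cplus" and a: "a \<ge> 0"
  shows "(\<lambda>z. f (z + of_real a)) holomorphic_on Cplus"
proof -
  have "(f \<circ> (\<lambda>z. z + of_real a)) holomorphic_on Cplus"
    using a by (intro holomorphic_on_compose_gen[OF _ f] holomorphic_intros) (auto simp: Cplus_def)
  then show ?thesis by (simp add: o_def)
qed

lemma deriv_shift_Cplus:
  assumes f: "f holomorphic_on Cplus" and a: "a \<ge> 0" and z: "z \<in> Cplus"
  shows "((\<lambda>z. f (z + of_real a)) has_field_derivative deriv f (z + of_real a)) (at z)"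
proof -
  have "z + of_real a \<in> Cplus" using a z by (simp add: Cplus_def)
  then have "(f has_field_derivative deriv f (z + of_real a)) (at (z + of_real a))"
    using f open_Cplus by (simp add: holomorphic_derivI)
  then show ?thesis by (simp add: DERIV_shift)
qed

text \<open>The half-line of abscissae is cut into a middle strip and two ends. In the ends the
  integral of \<open>vert_sup g\<close> is already small, for \<open>g\<close> and for its
  translate; in the middle, Cauchy's estimates make the change proportional to
  \<open>\<delta>\<close>.\<close>

lemma shift_approx:
  assumes g: "g \<in> B_space" and e: "e > 0"
  obtains \<delta> where "0 < \<delta>" "\<delta> < 1" "B_norm (\<lambda>z. g z - g (z + of_real \<delta>)) \<le> ennreal e"
proof -
  have gh: "g holomorphic_on Cplus" using g by (simp add: B_space_def)
  have [measurable]: "vert_sup g \<in> borel_measurable lborel" using gh by (rule measurable_vert_sup)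
  obtain G where G: "G \<ge> 0" "\<And>z. z \<in> Cplus \<Longrightarrow> cmod (g z) \<le> G" using B_space_bounded[OF g] by blast
  obtain k :: nat where k: "k > 0"
    "(\<integral>\<^sup>+ \<alpha>. vert_sup g \<alpha> * indicator ({0<..<2 / real k} \<union> {real k..}) \<alpha> \<partial>lborel) < ennreal (e / 8)"
    using vert_sup_ends_small[OF g, of "e / 8"] e by auto
  define \<phi> where "\<phi> \<alpha> = vert_sup g \<alpha> * indicator ({0<..<2 / real k} \<union> {real k..}) \<alpha>" for \<alpha>
  have [measurable]: "\<phi> \<in> borel_measurable lborel" unfolding \<phi>_def by measurable
  have \<phi>: "(\<integral>\<^sup>+ \<alpha>. \<phi> \<alpha> \<partial>lborel) \<le> ennreal (e / 8)" using k by (simp add: \<phi>_def)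
  \<comment> \<open>For abscissae at least \<open>1 / k\<close> the second derivative is at most
    \<open>8 * G * k ^ 2\<close>, integrated over a strip of width at most \<open>k\<close>; the
    first derivative is at most \<open>2 * G * k\<close>, which serves the sup norm. The summand 1
    makes \<open>K\<close> positive.\<close>
  define K where "K = 8 * G * real k ^ 3 + 2 * G * real k + 1"
  have K: "K > 0" using G by (simp add: K_def add_nonneg_pos)
  \<comment> \<open>The first term keeps \<open>\<delta>\<close> below \<open>1 / k\<close>, the
    second gives \<open>\<delta> * K \<le> e / 8\<close>.\<close>
  define \<delta> where "\<delta> = min (1 / (2 * real k)) (e / 8 / K)"
  have \<delta>: "0 < \<delta>" "\<delta> < 1" "\<delta> < 1 / real k" using k e K by (auto simp: \<delta>_def min_less_iff_disj field_simps)
  have "\<delta> * K \<le> e / 8" using K by (simp add: \<delta>_def min_def field_simps)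
  then have "\<delta> * (8 * G * real k ^ 3) + \<delta> * (2 * G * real k) \<le> e / 8" using \<delta> by (simp add: K_def algebra_simps)
  then have \<delta>K: "8 * G * real k ^ 3 * \<delta> \<le> e / 8" "2 * G * real k * \<delta> \<le> e / 8" 
    using \<delta> G by (smt (verit, ccfv_threshold) mult.commute mult_nonneg_nonneg of_nat_0_le_iff zero_le_power)+
  have k1: "real k \<ge> 1" using k by simp
  have sup: "sup_norm (\<lambda>z. g z - g (z + of_real \<delta>)) \<le> ennreal (e / 8)"
  proof (rule sup_norm_le)
    fix z assume z: "z \<in> Cplus"
    show "ennreal (cmod (g z - g (z + of_real \<delta>))) \<le> ennreal (e / 8)"
    proof (cases "Re z < 1 / real k")
      case True
      have "2 / real k = 1 / real k + 1 / real k" by simp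
      then have r: "Re z + \<delta> < 2 / real k" using True \<delta> by linarith
      have "ennreal (cmod (g (z + of_real \<delta>) - g z)) \<le> (\<integral>\<^sup>+ \<alpha>. vert_sup g \<alpha> * indicator {Re z..Re z + \<delta>} \<alpha> \<partial>lborel)"
        using z \<delta> by (intro horizontal_diff_le gh) (auto simp: Cplus_def)
      also have "\<dots> \<le> (\<integral>\<^sup>+ \<alpha>. \<phi> \<alpha> \<partial>lborel)"
        using r z by (intro nn_integral_mono) (auto simp: indicator_def \<phi>_def Cplus_def)
      finally show ?thesis using \<phi> by (subst norm_minus_commute) (rule order_trans)
    next
      case False
      let ?S = "{w. Re w \<ge> 1 / real k}"
      have sub: "w \<in> Cplus" if "w \<in> ?S" for w
        using that k by (auto simp: Cplus_def intro: less_le_trans[of 0 "1 / real k"])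
      have "cmod (g z - g (z + of_real \<delta>)) \<le> 2 * G * real k * cmod (z - (z + of_real \<delta>))"
      proof (rule field_differentiable_bound)
        show "convex ?S" by (rule convex_halfspace_Re_ge)
        show "(g has_field_derivative deriv g w) (at w within ?S)" if "w \<in> ?S" for w
          by (rule holomorphic_derivI[OF gh open_Cplus sub[OF that]])
        show "cmod (deriv g w) \<le> 2 * G * real k" if w: "w \<in> ?S" for w
        proof -
          have "cmod (deriv g w) \<le> 2 * G / Re w"
            using deriv_bound_Cplus[OF gh G(2) sub[OF w], of 1] by (simp add: mult.commute)
          also have "\<dots> \<le> 2 * G / (1 / real k)"
            using w k G sub[OF w] by (intro divide_left_mono mult_pos_pos) (auto simp: Cplus_def)
          finally show ?thesis by simp
        qed
      qed (use False \<delta> in auto)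
      also have "\<dots> \<le> e / 8" using \<delta>K \<delta> by simp
      finally show ?thesis by (rule ennreal_leI)
    qed
  qed
  \<comment> \<open>The last summand covers the middle strip. Elsewhere both \<open>\<alpha>\<close>
    and \<open>\<alpha> + \<delta>\<close> lie in the ends, where the two derivatives are estimated
    separately.\<close>
  have "vert_sup (\<lambda>z. g z - g (z + of_real \<delta>)) \<alpha>
    \<le> \<phi> \<alpha> + \<phi> (\<alpha> + \<delta>) + ennreal (8 * G * real k ^ 2 * \<delta>) * indicator {1 / real k..real k} \<alpha>" (is "_ \<le> ?R") for \<alpha>
  proof (rule vert_sup_le)
    fix z assume z: "Re z = \<alpha>" "\<alpha> > 0"
    then have zC: "z \<in> Cplus" "z + of_real \<delta> \<in> Cplus" using \<delta> by (auto simp: Cplus_def)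
    have d: "deriv (\<lambda>z. g z - g (z + of_real \<delta>)) z = deriv g z - deriv g (z + of_real \<delta>)"
      using zC gh open_Cplus \<delta>
      by (intro DERIV_imp_deriv DERIV_diff deriv_shift_Cplus holomorphic_derivI[of g Cplus]) auto
    show "ennreal (cmod (deriv (\<lambda>z. g z - g (z + of_real \<delta>)) z)) \<le> ?R"
    proof (cases "1 / real k \<le> \<alpha> \<and> \<alpha> \<le> real k")
      case True
      have "cmod (deriv g (z + of_real \<delta>) - deriv g (z + of_real 0)) \<le> 8 * G / (Re z + 0)\<^sup>2 * (\<delta> - 0)"
        using z \<delta> by (intro deriv_shift_diff_bound gh G) auto
      also have "\<dots> = 8 * G * (1 / \<alpha>)\<^sup>2 * \<delta>" using z by (simp add: power_divide)
      also have "\<dots> \<le> 8 * G * (real k)\<^sup>2 * \<delta>"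
        using True z \<delta> G k by (intro mult_right_mono mult_left_mono power_mono) (auto simp: field_simps)
      finally have "ennreal (cmod (deriv g z - deriv g (z + of_real \<delta>))) \<le> ennreal (8 * G * real k ^ 2 * \<delta>)"
        by (simp add: norm_minus_commute ennreal_leI)
      also have "\<dots> \<le> ?R" using True by simp
      finally show ?thesis by (simp add: d)
    next
      case False
      have "2 / real k = 1 / real k + 1 / real k" by simp
      then have in1: "\<alpha> \<in> {0<..<2 / real k} \<union> {real k..}" and in2: "\<alpha> + \<delta> \<in> {0<..<2 / real k} \<union> {real k..}"
        using False \<delta> z k by (auto simp: not_le)
      have "ennreal (cmod (deriv g z - deriv g (z + of_real \<delta>))) \<le> ennreal (cmod (deriv g z)) + ennreal (cmod (deriv g (z + of_real \<delta>)))"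
        by (simp add: norm_triangle_ineq4 flip: ennreal_plus)
      also have "\<dots> \<le> vert_sup g \<alpha> + vert_sup g (\<alpha> + \<delta>)"
        using deriv_le_vert_sup[OF zC(1), of g] deriv_le_vert_sup[OF zC(2), of g] z by (intro add_mono) auto
      also have "\<dots> = \<phi> \<alpha> + \<phi> (\<alpha> + \<delta>)" using in1 in2 by (simp add: \<phi>_def)
      also have "\<dots> \<le> ?R" by simp
      finally show ?thesis by (simp add: d)
    qed
  qed
  then have "B0_norm (\<lambda>z. g z - g (z + of_real \<delta>)) \<le> 
    (\<integral>\<^sup>+ \<alpha>. \<phi> \<alpha> + \<phi> (\<alpha> + \<delta>) + ennreal (8 * G * real k ^ 2 * \<delta>) * indicator {1 / real k..real k} \<alpha> \<partial>lborel)"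
    unfolding B0_norm_eq by (intro nn_integral_mono)
  also have "\<dots> = (\<integral>\<^sup>+ \<alpha>. \<phi> \<alpha> \<partial>lborel) + (\<integral>\<^sup>+ \<alpha>. \<phi> (\<alpha> + \<delta>) \<partial>lborel)
      + ennreal (8 * G * real k ^ 2 * \<delta>) * emeasure lborel {1 / real k..real k}"
    by (simp add: nn_integral_add nn_integral_cmult_indicator)
  also have "emeasure lborel {1 / real k..real k} = ennreal (real k - 1 / real k)"
    using k1 by (subst emeasure_lborel_Icc) (auto simp: field_simps intro: order_trans[of _ "real k * 1"])
  also have "(\<integral>\<^sup>+ \<alpha>. \<phi> (\<alpha> + \<delta>) \<partial>lborel) = (\<integral>\<^sup>+ \<alpha>. \<phi> \<alpha> \<partial>lborel)"
    by (rule nn_integral_lborel_shift) measurable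
  also have "ennreal (8 * G * real k ^ 2 * \<delta>) * ennreal (real k - 1 / real k) \<le> ennreal (e / 8)"
  proof -
    have "8 * G * real k ^ 2 * \<delta> * (real k - 1 / real k) \<le> 8 * G * real k ^ 2 * \<delta> * real k"
      using G \<delta> by (intro mult_left_mono) auto
    also have "\<dots> \<le> e / 8" using \<delta>K by (simp add: power3_eq_cube power2_eq_square mult_ac)
    finally show ?thesis using G \<delta> by (subst ennreal_mult'[symmetric]) (auto intro!: ennreal_leI)
  qed
  also have "(\<integral>\<^sup>+ \<alpha>. \<phi> \<alpha> \<partial>lborel) + (\<integral>\<^sup>+ \<alpha>. \<phi> \<alpha> \<partial>lborel) \<le> ennreal (e / 8) + ennreal (e / 8)"
    using \<phi> by (intro add_mono)
  finally have "B_norm (\<lambda>z. g z - g (z + of_real \<delta>)) \<le> ennreal (e / 8) + (ennreal (e / 8) + ennreal (e / 8) + ennreal (e / 8))"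
    unfolding B_norm_def using sup by (intro add_mono) (auto intro: order_trans add_mono)
  also have "\<dots> = ennreal (e / 2)" using e by (simp flip: ennreal_plus)
  also have "\<dots> \<le> ennreal e" using e by (intro ennreal_leI) auto
  finally show ?thesis using that \<delta> by blast
qed

text \<open>After translation by \<open>k\<close> only the part of \<open>vert_sup g\<close> beyond
  \<open>k\<close> is seen, and the same tail integral bounds \<open>g - c\<close> by the hypothesis
  on \<open>c\<close>. One small integral therefore controls both halves of the norm.\<close>

lemma far_shift_approx:
  assumes g: "g \<in> B_space" and e: "e > 0"
    and c: "\<And>z. z \<in> Cplus \<Longrightarrow>
      ennreal (cmod (g z - c)) \<le> (\<integral>\<^sup>+ \<alpha>. vert_sup g \<alpha> * indicator {Re z..} \<alpha> \<partial>lborel)"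
  obtains n :: nat where "n > 0" "B_norm (\<lambda>z. g (z + of_real (real n)) - c) \<le> ennreal e"
proof -
  have gh: "g holomorphic_on Cplus" using g by (simp add: B_space_def)
  have [measurable]: "vert_sup g \<in> borel_measurable lborel" using gh by (rule measurable_vert_sup)
  obtain k :: nat where k: "k > 0"
    "(\<integral>\<^sup>+ \<alpha>. vert_sup g \<alpha> * indicator ({0<..<2 / real k} \<union> {real k..}) \<alpha> \<partial>lborel) < ennreal (e / 2)"
    using vert_sup_ends_small[OF g, of "e / 2"] e by auto
  define \<phi> where "\<phi> \<alpha> = vert_sup g \<alpha> * indicator ({0<..<2 / real k} \<union> {real k..}) \<alpha>" for \<alpha>
  have [measurable]: "\<phi> \<in> borel_measurable lborel" unfolding \<phi>_def by measurable
  have \<phi>: "(\<integral>\<^sup>+ \<alpha>. \<phi> \<alpha> \<partial>lborel) \<le> ennreal (e / 2)" using k by (simp add: \<phi>_def)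
  have "sup_norm (\<lambda>z. g (z + of_real (real k)) - c) \<le> (\<integral>\<^sup>+ \<alpha>. \<phi> \<alpha> \<partial>lborel)"
  proof (rule sup_norm_le)
    fix z assume z: "z \<in> Cplus"
    have "ennreal (cmod (g (z + of_real (real k)) - c)) \<le>
        (\<integral>\<^sup>+ \<alpha>. vert_sup g \<alpha> * indicator {Re (z + of_real (real k))..} \<alpha> \<partial>lborel)"
      using z by (intro c) (simp add: Cplus_def)
    also have "\<dots> \<le> (\<integral>\<^sup>+ \<alpha>. \<phi> \<alpha> \<partial>lborel)"
      using z by (intro nn_integral_mono) (auto simp: indicator_def \<phi>_def Cplus_def)
    finally show "ennreal (cmod (g (z + of_real (real k)) - c)) \<le> \<dots>" .
  qed
  moreover have "vert_sup (\<lambda>z. g (z + of_real (real k)) - c) \<alpha> \<le> \<phi> (\<alpha> + real k)" for \<alpha>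
  proof (rule vert_sup_le)
    fix z assume z: "Re z = \<alpha>" "\<alpha> > 0"
    then have zC: "z \<in> Cplus" "z + of_real (real k) \<in> Cplus" by (auto simp: Cplus_def)
    have d: "deriv (\<lambda>z. g (z + of_real (real k)) - c) z = deriv g (z + of_real (real k)) - 0"
      using zC by (intro DERIV_imp_deriv DERIV_diff deriv_shift_Cplus gh) auto
    show "ennreal (cmod (deriv (\<lambda>z. g (z + of_real (real k)) - c) z)) \<le> \<phi> (\<alpha> + real k)"
      unfolding d using deriv_le_vert_sup[OF zC(2), of g] z by (simp add: \<phi>_def)
  qed
  then have "B0_norm (\<lambda>z. g (z + of_real (real k)) - c) \<le> (\<integral>\<^sup>+ \<alpha>. \<phi> (\<alpha> + real k) \<partial>lborel)"
    unfolding B0_norm_eq by (intro nn_integral_mono)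
  moreover have "(\<integral>\<^sup>+ \<alpha>. \<phi> (\<alpha> + real k) \<partial>lborel) = (\<integral>\<^sup>+ \<alpha>. \<phi> \<alpha> \<partial>lborel)"
    by (rule nn_integral_lborel_shift) measurable
  ultimately have "B_norm (\<lambda>z. g (z + of_real (real k)) - c) \<le> ennreal (e / 2) + ennreal (e / 2)"
    unfolding B_norm_def using \<phi> by (intro add_mono) (auto intro: order_trans)
  also have "\<dots> = ennreal e" using e by (simp flip: ennreal_plus)
  finally show ?thesis using that k by blast
qed

lemma nn_integral_inverse_square:
  assumes "\<delta> > 0"
  shows "(\<integral>\<^sup>+ \<alpha>. ennreal (1 / (\<alpha> + \<delta>)\<^sup>2) * indicator {0..} \<alpha> \<partial>lborel) = ennreal (1 / \<delta>)"
proof -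
  have "(\<integral>\<^sup>+ \<alpha>. ennreal (1 / (\<alpha> + \<delta>)\<^sup>2) * indicator {0..} \<alpha> \<partial>lborel) = ennreal (0 - (- 1 / (0 + \<delta>)))"
  proof (rule nn_integral_FTC_atLeast)
    show "((\<lambda>\<alpha>. - 1 / (\<alpha> + \<delta>)) has_real_derivative 1 / (x + \<delta>)\<^sup>2) (at x)" if "0 \<le> x" for x
      using that assms by (auto intro!: derivative_eq_intros simp: power2_eq_square)
    have "filterlim (\<lambda>x. x + \<delta>) at_infinity at_top"
      using filterlim_tendsto_add_at_top[OF tendsto_const[of \<delta>] filterlim_ident]
      by (intro filterlim_at_top_imp_at_infinity) (simp add: add.commute)
    then show "((\<lambda>\<alpha>. - 1 / (\<alpha> + \<delta>)) \<longlongrightarrow> 0) at_top"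
      by (intro tendsto_divide_0[OF tendsto_const])
  qed (use assms in auto)
  then show ?thesis by simp
qed

text \<open>Two cancelling shifts gain a second derivative, hence integrability at infinity; the first
  shift removes the singularity at 0.\<close>

lemma B_norm_shift_diff:
  assumes f: "f holomorphic_on Cplus" and G: "\<And>z. z \<in> Cplus \<Longrightarrow> cmod (f z) \<le> G"
    and d: "0 < \<delta>" "\<delta> \<le> n"
  shows "B_norm (\<lambda>z. f (z + of_real \<delta>) - f (z + of_real n)) \<le> ennreal ((2 + 8 * n / \<delta>) * G)"
proof -
  have "cmod (f 1) \<le> G" by (rule G) (simp add: Cplus_def)
  then have G0: "G \<ge> 0" by (rule order_trans[OF norm_ge_zero])
  have "sup_norm (\<lambda>z. f (z + of_real \<delta>) - f (z + of_real n)) \<le> ennreal (2 * G)"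
  proof (rule sup_norm_le, rule ennreal_leI)
    fix z assume z: "z \<in> Cplus"
    have "cmod (f (z + of_real \<delta>)) \<le> G" "cmod (f (z + of_real n)) \<le> G"
      using z d by (auto intro!: G simp: Cplus_def)
    then show "cmod (f (z + of_real \<delta>) - f (z + of_real n)) \<le> 2 * G"
      using norm_triangle_ineq4[of "f (z + of_real \<delta>)" "f (z + of_real n)"] by linarith
  qed
  moreover have "B0_norm (\<lambda>z. f (z + of_real \<delta>) - f (z + of_real n)) \<le> ennreal (8 * n / \<delta> * G)"
  proof -
    have "vert_sup (\<lambda>z. f (z + of_real \<delta>) - f (z + of_real n)) \<alpha>
        \<le> ennreal (8 * G * n) * (ennreal (1 / (\<alpha> + \<delta>)\<^sup>2) * indicator {0..} \<alpha>)" for \<alpha>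
    proof (rule vert_sup_le)
      fix z assume z: "Re z = \<alpha>" "\<alpha> > 0"
      then have zC: "z \<in> Cplus" by (simp add: Cplus_def)
      have d': "deriv (\<lambda>z. f (z + of_real \<delta>) - f (z + of_real n)) z = deriv f (z + of_real \<delta>) - deriv f (z + of_real n)"
        using zC d by (intro DERIV_imp_deriv DERIV_diff deriv_shift_Cplus f) auto
      have "cmod (deriv f (z + of_real n) - deriv f (z + of_real \<delta>)) \<le> 8 * G / (Re z + \<delta>)\<^sup>2 * (n - \<delta>)"
        using z d by (intro deriv_shift_diff_bound f G) auto
      also have "\<dots> \<le> 8 * G / (Re z + \<delta>)\<^sup>2 * n" using d G0 by (intro mult_left_mono) auto
      also have "\<dots> = (8 * G * n) * (1 / (\<alpha> + \<delta>)\<^sup>2)" using z by simp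
      finally have "ennreal (cmod (deriv f (z + of_real n) - deriv f (z + of_real \<delta>))) \<le> ennreal (8 * G * n * (1 / (\<alpha> + \<delta>)\<^sup>2))"
        by (rule ennreal_leI)
      also have "\<dots> = ennreal (8 * G * n) * (ennreal (1 / (\<alpha> + \<delta>)\<^sup>2) * indicator {0..} \<alpha>)"
        using G0 d z by (subst ennreal_mult') (auto simp: ennreal_mult')
      finally show "ennreal (cmod (deriv (\<lambda>z. f (z + of_real \<delta>) - f (z + of_real n)) z)) \<le> \<dots>"
        by (simp add: d' norm_minus_commute)
    qed
    then have "B0_norm (\<lambda>z. f (z + of_real \<delta>) - f (z + of_real n)) \<le>
      (\<integral>\<^sup>+ \<alpha>. ennreal (8 * G * n) * (ennreal (1 / (\<alpha> + \<delta>)\<^sup>2) * indicator {0..} \<alpha>) \<partial>lborel)"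
      unfolding B0_norm_eq by (intro nn_integral_mono)
    \<comment> \<open>The integral of \<open>1 / (\<alpha> + \<delta>)\<^sup>2\<close> is
      \<open>1 / \<delta>\<close>: this is the \<open>8 * n / \<delta>\<close> of the constant,
      while its 2 comes from the sup norm of two translates.\<close>
    also have "\<dots> = ennreal (8 * G * n) * ennreal (1 / \<delta>)"
      by (subst nn_integral_cmult) (use d in \<open>auto simp: nn_integral_inverse_square\<close>)
    also have "\<dots> = ennreal (8 * n / \<delta> * G)" using G0 d by (subst ennreal_mult'[symmetric]) (auto simp: mult_ac)
    finally show ?thesis .
  qed
  ultimately have "B_norm (\<lambda>z. f (z + of_real \<delta>) - f (z + of_real n)) \<le> ennreal (2 * G) + ennreal (8 * n / \<delta> * G)"
    unfolding B_norm_def by (rule add_mono)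
  also have "\<dots> = ennreal ((2 + 8 * n / \<delta>) * G)" using G0 d by (subst ennreal_plus[symmetric]) (auto simp: algebra_simps)
  finally show ?thesis .
qed

text \<open>The order of choices is essential: \<open>\<delta>\<close> and \<open>n\<close> depend
  on \<open>g\<close> and \<open>e\<close> alone, so the norm of the smoothing operator is fixed
  before the sup norm approximant \<open>h\<close> is picked to beat it.\<close>

lemma closure_B_eq_closure_sup:
  assumes hol: "\<And>h. h \<in> Y \<Longrightarrow> h holomorphic_on Cplus"
    and shift: "\<And>h \<delta> n. h \<in> Y \<Longrightarrow> 0 < \<delta> \<Longrightarrow> \<delta> < n \<Longrightarrow>
      \<exists>h'\<in>Y. \<exists>c. ((\<lambda>x. h (of_real x)) \<longlongrightarrow> c) at_top \<and>
        (\<forall>z\<in>Cplus. h' z = h (z + of_real \<delta>) - h (z + of_real n) + c)"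
  shows "closure_B Y = closure_sup Y"
proof (intro equalityI subsetI)
  fix g assume "g \<in> closure_B Y"
  then show "g \<in> closure_sup Y"
    unfolding closure_B_def closure_sup_def by (blast intro: le_less_trans[OF sup_norm_le_B_norm])
next
  fix g assume gc: "g \<in> closure_sup Y"
  then have g: "g \<in> B_space" and gh: "g holomorphic_on Cplus" by (auto simp: closure_sup_def B_space_def)
  obtain c where c: "\<And>z. z \<in> Cplus \<Longrightarrow>
      ennreal (cmod (g z - c)) \<le> (\<integral>\<^sup>+ \<alpha>. vert_sup g \<alpha> * indicator {Re z..} \<alpha> \<partial>lborel)"
    using B_space_limit[OF g] by blast
  have glim: "((\<lambda>x. g (of_real x)) \<longlongrightarrow> c) at_top"
  proof (rule tendstoI)
    fix e :: real assume e: "e > 0"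
    obtain n :: nat where n: "n > 0" "B_norm (\<lambda>z. g (z + of_real (real n)) - c) \<le> ennreal (e / 2)"
      using far_shift_approx[OF g _ c, of "e / 2"] e by auto
    show "eventually (\<lambda>x. dist (g (of_real x)) c < e) at_top"
      using eventually_gt_at_top[of "real n"]
    proof eventually_elim
      case (elim x)
      have "of_real (x - real n) \<in> Cplus" using elim by (simp add: Cplus_def)
      from norm_le_sup_norm[OF this, of "\<lambda>z. g (z + of_real (real n)) - c"]
      have "ennreal (cmod (g (of_real x) - c)) \<le> sup_norm (\<lambda>z. g (z + of_real (real n)) - c)"
        by simp
      also have "\<dots> \<le> ennreal (e / 2)" using sup_norm_le_B_norm n(2) by (rule order_trans)
      finally have "ennreal (cmod (g (of_real x) - c)) \<le> ennreal (e / 2)" .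
      then show ?case using e by (simp add: dist_norm)
    qed
  qed
  have "\<exists>h\<in>Y. B_norm (\<lambda>z. g z - h z) < ennreal e" if e: "e > 0" for e
  proof -
    obtain \<delta> where \<delta>: "0 < \<delta>" "\<delta> < 1" "B_norm (\<lambda>z. g z - g (z + of_real \<delta>)) \<le> ennreal (e / 8)"
      using shift_approx[OF g, of "e / 8"] e by auto
    obtain n :: nat where n: "n > 0" "B_norm (\<lambda>z. g (z + of_real (real n)) - c) \<le> ennreal (e / 8)"
      using far_shift_approx[OF g _ c, of "e / 8"] e by auto
    have dn: "\<delta> < real n" using \<delta> n by linarith
    \<comment> \<open>\<open>K\<close> dominates both the constant
      \<open>2 + 8 * n / \<delta>\<close> of \<open>B_norm_shift_diff\<close> and 1, so that with
      the accuracy \<open>e'\<close> both the smoothed error \<open>f3\<close> and the constant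
      error \<open>f4\<close> cost at most \<open>e / 8\<close>.\<close>
    define K where "K = 3 + 8 * real n / \<delta>"
    have K: "K \<ge> 3" using \<delta> by (simp add: K_def)
    define e' where "e' = e / 8 / K"
    have e': "e' > 0" "K * e' = e / 8" using e K by (auto simp: e'_def)
    obtain h where h: "h \<in> Y" "sup_norm (\<lambda>z. g z - h z) < ennreal e'"
      using gc e' by (auto simp: closure_sup_def)
    have bd: "cmod (g z - h z) \<le> e'" if "z \<in> Cplus" for z
      using le_less_trans[OF norm_le_sup_norm[OF that, of "\<lambda>z. g z - h z"] h(2)] e' by (simp add: ennreal_less_iff less_imp_le)
    obtain h' c' where h': "h' \<in> Y" "((\<lambda>x. h (of_real x)) \<longlongrightarrow> c') at_top"
       "\<And>z. z \<in> Cplus \<Longrightarrow> h' z = h (z + of_real \<delta>) - h (z + of_real (real n)) + c'"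
      using shift[OF h(1) \<delta>(1) dn] by auto
    have hh: "h holomorphic_on Cplus" using hol h by blast
    have "((\<lambda>x. cmod (g (of_real x) - h (of_real x))) \<longlongrightarrow> cmod (c - c')) at_top"
      by (intro tendsto_intros glim h')
    moreover have "eventually (\<lambda>x. cmod (g (of_real x) - h (of_real x)) \<le> e') at_top"
      using eventually_gt_at_top[of 0] by eventually_elim (auto intro!: bd simp: Cplus_def)
    ultimately have cc: "cmod (c - c') \<le> e'" by (intro tendsto_upperbound) auto
    \<comment> \<open>Telescoping of \<open>g - h'\<close>: the near shift of \<open>g\<close>, the
      far shift of \<open>g\<close>, the smoothing operator applied to \<open>g - h\<close>, and the
      difference of the limits at infinity.\<close>
    define f1 where "f1 z = g z - g (z + of_real \<delta>)" for z
    define f2 where "f2 z = g (z + of_real (real n)) - c" for z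
    define f3 where "f3 z = (g (z + of_real \<delta>) - h (z + of_real \<delta>)) - (g (z + of_real (real n)) - h (z + of_real (real n)))" for z
    define f4 where "f4 = (\<lambda>z::complex. c - c')"
    note hs = holomorphic_shift
    have H: "f1 holomorphic_on Cplus" "f2 holomorphic_on Cplus" "f3 holomorphic_on Cplus" "f4 holomorphic_on Cplus"
      using gh hh \<delta> unfolding f1_def f2_def f3_def f4_def by (intro holomorphic_intros hs; simp)+
    have "B_norm (\<lambda>z. g z - h' z) = B_norm (\<lambda>z. f1 z + (f2 z + (f3 z + f4 z)))"
      by (rule B_norm_cong) (simp add: h' f1_def f2_def f3_def f4_def)
    also have "\<dots> \<le> B_norm f1 + (B_norm f2 + (B_norm f3 + B_norm f4))"
      using H by (intro order_trans[OF B_norm_triangle] add_mono order_refl holomorphic_intros)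
    also have "\<dots> \<le> ennreal (e / 8) + (ennreal (e / 8) + (ennreal (e / 8) + ennreal (e / 8)))"
    proof (intro add_mono)
      show "B_norm f1 \<le> ennreal (e / 8)" using \<delta> by (simp add: f1_def[abs_def])
      show "B_norm f2 \<le> ennreal (e / 8)" using n by (simp add: f2_def[abs_def])
      have "B_norm f3 \<le> ennreal ((2 + 8 * real n / \<delta>) * e')"
        unfolding f3_def[abs_def]
        using B_norm_shift_diff[of "\<lambda>z. g z - h z" e' \<delta> "real n"] gh hh bd \<delta> dn by (auto intro: holomorphic_intros)
      also have "\<dots> \<le> ennreal (K * e')" using e' by (intro ennreal_leI mult_right_mono) (auto simp: K_def)
      finally show "B_norm f3 \<le> ennreal (e / 8)" by (simp add: e')
      have "e' \<le> K * e'" using K e' by simp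
      then show "B_norm f4 \<le> ennreal (e / 8)" using cc e' by (simp add: f4_def B_norm_const ennreal_leI)
    qed
    also have "\<dots> = ennreal (e / 2)" using e by (simp flip: ennreal_plus)
    also have "\<dots> < ennreal e" using e by (intro ennreal_lessI) auto
    finally show ?thesis using h' by blast
  qed
  then show "g \<in> closure_B Y" using g by (simp add: closure_B_def)
qed

section \<open>Laplace transforms of measures\<close>

lemma norm_integral_le_AE:
  fixes f :: "'a \<Rightarrow> 'b::{banach, second_countable_topology}"
  assumes "integrable M f" "integrable M g" "AE x in M. norm (f x) \<le> g x"
  shows "norm (LINT x|M. f x) \<le> (LINT x|M. g x)"
  using assms by (intro order_trans[OF integral_norm_bound integral_mono_AE]) auto

lemma pos_meas_AE_nonneg:
  assumes "pos_meas_Rplus M"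
  shows "AE t in M. t \<ge> 0"
proof (rule AE_I)
  show "{t \<in> space M. \<not> t \<ge> 0} \<subseteq> {..<0}" by auto
  show "emeasure M {..<0} = 0" "{..<0} \<in> sets M" using assms by (auto simp: pos_meas_Rplus_def)
qed

lemma borel_measurable_exp_kernel:
  assumes "sets M = sets borel"
  shows "(\<lambda>t. exp (- (z * complex_of_real t))) \<in> borel_measurable M"
  unfolding measurable_cong_sets[OF assms refl] by measurable

lemma norm_exp_kernel: "cmod (exp (- (z * complex_of_real t))) = exp (- (Re z * t))"
  by (simp add: norm_exp_eq_Re)

lemma exp_kernel_shift:
  "exp (- ((z + of_real a) * complex_of_real t)) = exp (- (z * complex_of_real t)) * of_real (exp (- (a * t)))"
  by (simp add: exp_of_real[symmetric] algebra_simps flip: exp_add)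

lemma integrable_exp_kernel:
  assumes M: "pos_meas_Rplus M" and z: "Re z \<ge> 0"
  shows "integrable M (\<lambda>t. exp (- (z * complex_of_real t)))"
proof -
  interpret finite_measure M using M by (simp add: pos_meas_Rplus_def)
  show ?thesis
    using M pos_meas_AE_nonneg[OF M] z
    by (intro integrable_const_bound[of _ 1] borel_measurable_exp_kernel)
      (auto simp: pos_meas_Rplus_def norm_exp_kernel elim!: eventually_mono)
qed

text \<open>Square the inequality \<open>y \<le> exp y\<close> at \<open>y = x * t / 4\<close>. This
  absorbs the factor \<open>t\<^sup>2\<close> of a second-order remainder into half of the
  exponential decay.\<close>

lemma square_times_exp_le:
  fixes x t :: real
  assumes "x > 0" "t \<ge> 0"
  shows "t\<^sup>2 * exp (- (x * t / 2)) \<le> 16 / x\<^sup>2"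
proof -
  have "x * t / 4 \<le> exp (x * t / 4)" using exp_ge_add_one_self[of "x * t / 4"] by linarith
  then have "(x * t / 4)\<^sup>2 \<le> (exp (x * t / 4))\<^sup>2" using assms by (intro power_mono) auto
  also have "\<dots> = exp (x * t / 2)" by (simp flip: exp_double)
  finally have "x\<^sup>2 * t\<^sup>2 \<le> 16 * exp (x * t / 2)" by (simp add: power_mult_distrib power_divide)
  then show ?thesis using assms by (simp add: exp_minus field_simps)
qed

text \<open>Differentiation under the integral by direct estimate: the difference quotient misses
  the candidate by the integral of a second-order Taylor remainder divided by \<open>w\<close>,
  which is at most a constant times \<open>cmod w\<close>.\<close>

lemma laplace_pos_has_field_derivative:
  assumes M: "pos_meas_Rplus M" and z: "z \<in> Cplus"
  shows "(laplace_pos M has_field_derivative (LINT t|M. - (of_real t * exp (- (z * of_real t))))) (at z)"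
proof -
  interpret finite_measure M using M by (simp add: pos_meas_Rplus_def)
  have sM: "sets M = sets borel" using M by (simp add: pos_meas_Rplus_def)
  note [measurable_cong] = sM
  define x where "x = Re z"
  have x: "x > 0" using z by (simp add: x_def Cplus_def)
  let ?E = "\<lambda>z t. exp (- (z * complex_of_real t))"
  let ?D = "LINT t|M. - (of_real t * ?E z t)"
  have intD: "integrable M (\<lambda>t. - (of_real t * ?E z t))"
  proof (rule integrable_const_bound[of _ "1 / x"])
    show "AE t in M. cmod (- (of_real t * ?E z t)) \<le> 1 / x"
      using pos_meas_AE_nonneg[OF M]
    proof eventually_elim
      case (elim t)
      have "x * t \<le> exp (x * t)" using exp_ge_add_one_self[of "x * t"] by linarith
      then have "t * exp (- (x * t)) \<le> 1 / x" using x by (simp add: exp_minus field_simps)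
      moreover have "cmod (- (of_real t * ?E z t)) = t * exp (- (x * t))"
        using elim by (simp only: norm_minus_cancel norm_mult norm_exp_kernel x_def norm_of_real abs_of_nonneg)
      ultimately show ?case by simp
    qed
  qed measurable
  define C where "C = 16 / x\<^sup>2 * measure M (space M)"
  have bound: "cmod ((laplace_pos M (z + w) - laplace_pos M z) / w - ?D) \<le> C * cmod w"
    if w: "w \<noteq> 0" "cmod w < x / 2" for w
  proof -
    let ?R = "\<lambda>t. ?E (z + w) t - ?E z t - w * - (of_real t * ?E z t)"
    have "\<bar>Re w\<bar> < x / 2" using w abs_Re_le_cmod[of w] by linarith
    then have zw: "Re (z + w) \<ge> 0" using x by (simp add: x_def abs_if split: if_splits)
    have i1: "integrable M (?E (z + w))" "integrable M (?E z)"
      using integrable_exp_kernel[OF M] zw x by (auto simp: x_def)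
    have iR: "integrable M ?R" using i1 intD by (intro Bochner_Integration.integrable_diff integrable_mult_right)
    have eq: "laplace_pos M (z + w) - laplace_pos M z - w * ?D = (LINT t|M. ?R t)"
      unfolding laplace_pos_def
      by (simp only: Bochner_Integration.integral_diff i1 intD Bochner_Integration.integrable_diff
          integrable_mult_right integral_mult_right_zero)
    have "cmod (LINT t|M. ?R t) \<le> (LINT t|M. 16 / x\<^sup>2 * (cmod w)\<^sup>2)"
    proof (rule norm_integral_le_AE[OF iR])
      show "AE t in M. cmod (?R t) \<le> 16 / x\<^sup>2 * (cmod w)\<^sup>2"
        using pos_meas_AE_nonneg[OF M]
      proof eventually_elim
        case (elim t)
        \<comment> \<open>The second factor is the remainder of \<open>exp\<close> after its linear
          Taylor term, hence quadratic in \<open>w * t\<close>.\<close>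
        have "?R t = ?E z t * (exp (- (w * of_real t)) - (\<Sum>i\<le>1. (- (w * of_real t)) ^ i / fact i))"
          by (simp add: algebra_simps flip: exp_add)
        then have "cmod (?R t) = exp (- (x * t)) * cmod (exp (- (w * of_real t)) - (\<Sum>i\<le>1. (- (w * of_real t)) ^ i / fact i))"
          by (simp only: norm_mult norm_exp_kernel x_def)
        also have "\<dots> \<le> exp (- (x * t)) * (exp (cmod (- (w * of_real t))) * cmod (- (w * of_real t)) ^ Suc 1 / fact 1)"
          by (intro mult_left_mono Taylor_exp_field) auto
        also have "\<dots> = (exp (- (x * t)) * exp (cmod w * t)) * t\<^sup>2 * (cmod w)\<^sup>2"
          using elim by (simp add: norm_mult power2_eq_square mult_ac)
        \<comment> \<open>The restriction \<open>cmod w < x / 2\<close> spends half of the decay;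
          the other half is left for \<open>t\<^sup>2\<close>.\<close>
        also have "exp (- (x * t)) * exp (cmod w * t) \<le> exp (- (x * t / 2))"
        proof -
          have "cmod w * t \<le> x / 2 * t" using w elim by (intro mult_right_mono) auto
          then show ?thesis by (simp flip: exp_add)
        qed
        also have "exp (- (x * t / 2)) * t\<^sup>2 * (cmod w)\<^sup>2 \<le> 16 / x\<^sup>2 * (cmod w)\<^sup>2"
          using square_times_exp_le[OF x elim] by (intro mult_right_mono) (auto simp: mult.commute)
        finally show ?case by (simp add: mult_right_mono)
      qed
    qed auto
    also have "\<dots> = C * cmod w * cmod w" by (simp add: C_def power2_eq_square)
    finally have "cmod (laplace_pos M (z + w) - laplace_pos M z - w * ?D) \<le> C * cmod w * cmod w" by (simp only: eq)
    moreover have "(laplace_pos M (z + w) - laplace_pos M z) / w - ?D = (laplace_pos M (z + w) - laplace_pos M z - w * ?D) / w"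
      using w by (simp add: field_simps)
    ultimately show ?thesis using w by (simp add: norm_divide divide_le_eq)
  qed
  have "((\<lambda>w. (laplace_pos M (z + w) - laplace_pos M z) / w - ?D) \<longlongrightarrow> 0) (at 0)"
  proof (rule Lim_null_comparison)
    have "eventually (\<lambda>w. cmod w < x / 2) (at 0)"
      using x by (auto simp: eventually_at intro!: exI[of _ "x / 2"])
    then show "eventually (\<lambda>w. cmod ((laplace_pos M (z + w) - laplace_pos M z) / w - ?D) \<le> C * cmod w) (at 0)"
      using eventually_neq_at_within[of 0] by eventually_elim (rule bound)
    show "((\<lambda>w. C * cmod w) \<longlongrightarrow> 0) (at 0)" by (auto intro!: tendsto_eq_intros)
  qed
  then show ?thesis unfolding DERIV_def using Lim_null by blast
qed

lemma laplace_pos_holomorphic: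
  assumes "pos_meas_Rplus M"
  shows "laplace_pos M holomorphic_on Cplus"
  using laplace_pos_has_field_derivative[OF assms] open_Cplus by (auto simp: holomorphic_on_open)

text \<open>Dominated convergence: on the half-line the kernel tends to the indicator of 0, so only
  an atom at 0 survives.\<close>

lemma laplace_pos_at_top:
  assumes M: "pos_meas_Rplus M"
  shows "((\<lambda>x. laplace_pos M (of_real x)) \<longlongrightarrow> of_real (measure M {0})) at_top"
proof -
  interpret finite_measure M using M by (simp add: pos_meas_Rplus_def)
  have sM: "sets M = sets borel" using M by (simp add: pos_meas_Rplus_def)
  note [measurable_cong] = sM
  have sp: "space M = UNIV" using sets_eq_imp_space_eq[OF sM] by simp
  have "((\<lambda>x. LINT t|M. exp (- (complex_of_real x * of_real t))) \<longlongrightarrow> (LINT t|M. complex_of_real (indicator {0} t))) at_top"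
  proof (rule integral_dominated_convergence_at_top[where w = "\<lambda>t. 1"])
    show "AE t in M. ((\<lambda>x. exp (- (complex_of_real x * of_real t))) \<longlongrightarrow> of_real (indicator {0} t)) at_top"
      using pos_meas_AE_nonneg[OF M]
    proof eventually_elim
      case (elim t)
      show ?case
      proof (cases "t = 0")
        case False
        with elim have t: "t > 0" by simp
        have "filterlim (\<lambda>x. t * x) at_top at_top"
          by (rule filterlim_tendsto_pos_mult_at_top[OF tendsto_const t filterlim_ident])
        then have "((\<lambda>x. exp (- (t * x))) \<longlongrightarrow> 0) at_top"
          by (intro filterlim_compose[OF exp_at_bot] filterlim_compose[OF filterlim_uminus_at_bot_at_top])
        then have "((\<lambda>x. exp (- (complex_of_real x * of_real t))) \<longlongrightarrow> 0) at_top"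
          by (subst tendsto_norm_zero_iff[symmetric]) (simp add: norm_exp_kernel mult.commute)
        then show ?thesis using False by simp
      qed simp
    qed
    show "eventually (\<lambda>x. AE t in M. cmod (exp (- (complex_of_real x * of_real t))) \<le> 1) at_top"
      using eventually_ge_at_top[of 0]
    proof eventually_elim
      case (elim x)
      show ?case using pos_meas_AE_nonneg[OF M] by eventually_elim (use elim in \<open>simp add: norm_exp_kernel\<close>)
    qed
  qed auto
  moreover have "(LINT t|M. complex_of_real (indicator {0} t)) = of_real (measure M {0})"
    by (simp add: integral_complex_of_real sp)
  ultimately show ?thesis unfolding laplace_pos_def by simp
qed

text \<open>On measures, the map \<open>f \<mapsto> f(\<cdot> + \<delta>) - f(\<cdot> + n) + f(\<infinity>)\<close> is multiplication by this weight;
  the value 1 at 0 accounts for the limit at infinity.\<close>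

definition shift_weight :: "real \<Rightarrow> real \<Rightarrow> real \<Rightarrow> real" where
  "shift_weight \<delta> n t = (if t = 0 then 1 else if t < 0 then 0 else exp (- (\<delta> * t)) - exp (- (n * t)))"

lemma shift_weight_measurable [measurable]: "shift_weight \<delta> n \<in> borel_measurable borel"
  unfolding shift_weight_def[abs_def] by measurable

lemma shift_weight_bounds:
  assumes "0 < \<delta>" "\<delta> < n"
  shows "0 \<le> shift_weight \<delta> n t" "shift_weight \<delta> n t \<le> 1"
proof -
  have "exp (- (n * t)) \<le> exp (- (\<delta> * t))" "exp (- (\<delta> * t)) \<le> 1" if "t > 0"
    using that assms by auto
  moreover have "exp (- (n * t)) > 0" by simp
  ultimately show "0 \<le> shift_weight \<delta> n t" "shift_weight \<delta> n t \<le> 1"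
    unfolding shift_weight_def by (smt (verit))+
qed

text \<open>The sign of the weight keeps the measure positive and the bound 1 keeps it finite. The
  conclusion on null sets is how absolute continuity, discreteness and singularity pass to the new
  measure.\<close>

lemma shift_weight_density:
  assumes M: "pos_meas_Rplus M" and d: "0 < \<delta>" "\<delta> < n"
  defines "N \<equiv> density M (\<lambda>t. ennreal (shift_weight \<delta> n t))"
  shows "pos_meas_Rplus N"
    and "z \<in> Cplus \<Longrightarrow> laplace_pos N z = laplace_pos M (z + of_real \<delta>) - laplace_pos M (z + of_real n) + of_real (measure M {0})"
    and "A \<in> null_sets M \<Longrightarrow> A \<in> null_sets N"
proof -
  interpret finite_measure M using M by (simp add: pos_meas_Rplus_def)
  have sM: "sets M = sets borel" using M by (simp add: pos_meas_Rplus_def)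
  note [measurable_cong] = sM
  have sp: "space M = UNIV" using sets_eq_imp_space_eq[OF sM] by simp
  have w[measurable]: "shift_weight \<delta> n \<in> borel_measurable M" by measurable
  have null: "A \<in> null_sets N" if "A \<in> null_sets M" for A
    using absolutely_continuousI_density[of "\<lambda>t. ennreal (shift_weight \<delta> n t)" M] that
    by (auto simp: N_def absolutely_continuous_def)
  then show "A \<in> null_sets M \<Longrightarrow> A \<in> null_sets N" .
  have "emeasure N (space N) = (\<integral>\<^sup>+ t. ennreal (shift_weight \<delta> n t) \<partial>M)"
    unfolding N_def by (simp add: emeasure_density sp)
  also have "\<dots> \<le> (\<integral>\<^sup>+ t. 1 \<partial>M)"
    using shift_weight_bounds[OF d] by (intro nn_integral_mono) (simp add: ennreal_le_1)
  also have "\<dots> < \<infinity>" by (simp add: emeasure_finite less_top[symmetric])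
  finally have "finite_measure N" by (intro finite_measureI) auto
  moreover have "{..<0} \<in> null_sets M" using M by (auto simp: pos_meas_Rplus_def null_sets_def)
  then have "emeasure N {..<0} = 0" using null by auto
  ultimately show "pos_meas_Rplus N" by (simp add: pos_meas_Rplus_def N_def sM)
  assume z: "z \<in> Cplus"
  let ?E = "\<lambda>z t. exp (- (z * complex_of_real t))"
  have i: "integrable M (?E (z + of_real \<delta>))" "integrable M (?E (z + of_real n))"
    using z d by (auto intro!: integrable_exp_kernel[OF M] simp: Cplus_def)
  have i0: "integrable M (\<lambda>t. complex_of_real (indicator {0} t))" by (intro integrable_of_real) (simp add: integrable_indicator_iff emeasure_finite less_top[symmetric])
  have "laplace_pos N z = (LINT t|M. shift_weight \<delta> n t *\<^sub>R ?E z t)"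
    unfolding laplace_pos_def N_def
    using shift_weight_bounds[OF d] by (intro integral_density) auto
  \<comment> \<open>For positive \<open>t\<close>, multiplying the kernel by
    \<open>exp (- (a * t))\<close> translates \<open>z\<close> by \<open>a\<close>; at
    \<open>t = 0\<close> the two translated kernels cancel and the indicator remains.\<close>
  also have "\<dots> = (LINT t|M. ?E (z + of_real \<delta>) t - ?E (z + of_real n) t + of_real (indicator {0} t))"
  proof (rule integral_cong_AE)
    show "AE t in M. shift_weight \<delta> n t *\<^sub>R ?E z t = ?E (z + of_real \<delta>) t - ?E (z + of_real n) t + of_real (indicator {0} t)"
      using pos_meas_AE_nonneg[OF M]
    proof eventually_elim
      case (elim t)
      then show ?case
        unfolding exp_kernel_shift
        by (auto simp: shift_weight_def indicator_def scaleR_conv_of_real right_diff_distrib mult.commute)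
    qed
  qed measurable
  also have "\<dots> = laplace_pos M (z + of_real \<delta>) - laplace_pos M (z + of_real n) + (LINT t|M. complex_of_real (indicator {0} t))"
    unfolding laplace_pos_def using i i0 by (simp add: Bochner_Integration.integral_add Bochner_Integration.integral_diff)
  finally show "laplace_pos N z = laplace_pos M (z + of_real \<delta>) - laplace_pos M (z + of_real n) + of_real (measure M {0})"
    by (simp add: integral_complex_of_real sp)
qed

section \<open>The four spaces of Laplace transforms\<close>

lemma laplace_classI:
  assumes "\<And>M. M \<in> {M1, M2, M3, M4} \<Longrightarrow> pos_meas_Rplus M \<and> P M"
  shows "(\<lambda>z. laplace_pos M1 z - laplace_pos M2 z + \<i> * (laplace_pos M3 z - laplace_pos M4 z)) \<in> laplace_class P"
  unfolding laplace_class_def using assms by blast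

lemma laplace_classE:
  assumes "h \<in> laplace_class P"
  obtains M1 M2 M3 M4 where
    "h = (\<lambda>z. laplace_pos M1 z - laplace_pos M2 z + \<i> * (laplace_pos M3 z - laplace_pos M4 z))"
    "pos_meas_Rplus M1" "pos_meas_Rplus M2" "pos_meas_Rplus M3" "pos_meas_Rplus M4" "P M1" "P M2" "P M3" "P M4"
  using assms unfolding laplace_class_def by blast

lemma laplace_class_holomorphic:
  assumes "h \<in> laplace_class P"
  shows "h holomorphic_on Cplus"
  using assms
  by (elim laplace_classE) (auto intro!: holomorphic_intros laplace_pos_holomorphic)

text \<open>Each type of measure is expressed through null sets only, so one hypothesis, stability
  of \<open>P\<close> under enlarging the family of null sets, treats all four spaces at once. The
  limit at infinity of \<open>h\<close> is the corresponding combination of the atoms at 0.\<close>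

lemma laplace_class_closures:
  assumes P: "\<And>M N. pos_meas_Rplus M \<Longrightarrow> pos_meas_Rplus N \<Longrightarrow> null_sets M \<subseteq> null_sets N \<Longrightarrow> P M \<Longrightarrow> P N"
  shows "closure_B (laplace_class P) = closure_sup (laplace_class P)"
proof (rule closure_B_eq_closure_sup)
  show "h holomorphic_on Cplus" if "h \<in> laplace_class P" for h
    using that by (rule laplace_class_holomorphic)
next
  fix h \<delta> n assume h: "h \<in> laplace_class P" and d: "0 < \<delta>" "\<delta> < (n :: real)"
  obtain M1 M2 M3 M4 where 
    h: "h = (\<lambda>z. laplace_pos M1 z - laplace_pos M2 z + \<i> * (laplace_pos M3 z - laplace_pos M4 z))"
    and M: "pos_meas_Rplus M1" "pos_meas_Rplus M2" "pos_meas_Rplus M3" "pos_meas_Rplus M4"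
    and PM: "P M1" "P M2" "P M3" "P M4"
    using laplace_classE[OF h] .
  define N where "N M = density M (\<lambda>t. ennreal (shift_weight \<delta> n t))" for M :: "real measure"
  define c where "c = complex_of_real (measure M1 {0}) - of_real (measure M2 {0}) + \<i> * (of_real (measure M3 {0}) - of_real (measure M4 {0}))"
  have N: "pos_meas_Rplus (N M)" "P (N M)" if "pos_meas_Rplus M" "P M" for M
  proof -
    show "pos_meas_Rplus (N M)" unfolding N_def using that d by (intro shift_weight_density)
    moreover have "null_sets M \<subseteq> null_sets (N M)" unfolding N_def using that d shift_weight_density(3) by blast
    ultimately show "P (N M)" using P that by blast
  qed
  define h' where "h' z = laplace_pos (N M1) z - laplace_pos (N M2) z + \<i> * (laplace_pos (N M3) z - laplace_pos (N M4) z)" for z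
  have "h' \<in> laplace_class P" unfolding h'_def[abs_def] using M PM N by (intro laplace_classI) auto
  moreover have "((\<lambda>x. h (of_real x)) \<longlongrightarrow> c) at_top"
    unfolding h c_def using M by (intro tendsto_intros laplace_pos_at_top)
  moreover have "h' z = h (z + of_real \<delta>) - h (z + of_real n) + c" if "z \<in> Cplus" for z
    using M d that by (simp add: h'_def N_def shift_weight_density(2) h c_def algebra_simps)
  ultimately show "\<exists>h'\<in>laplace_class P. \<exists>c. ((\<lambda>x. h (of_real x)) \<longlongrightarrow> c) at_top \<and>
        (\<forall>z\<in>Cplus. h' z = h (z + of_real \<delta>) - h (z + of_real n) + c)" by blast
qed

lemma laplace_spaces_closures:
  "closure_B LM = closure_sup LM" "closure_B LL1 = closure_sup LL1"
  "closure_B LMd = closure_sup LMd" "closure_B LMs = closure_sup LMs"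
proof -
  show "closure_B LM = closure_sup LM" unfolding LM_def by (rule laplace_class_closures) simp
  show "closure_B LL1 = closure_sup LL1" unfolding LL1_def
    by (rule laplace_class_closures) (auto simp: absolutely_continuous_def)
  \<comment> \<open>Measurability of \<open>A\<close> matters: \<open>emeasure\<close> is 0 by
    convention on nonmeasurable sets, so a zero value alone does not make \<open>A\<close> a null
    set.\<close>
  have null: "emeasure N A = 0" if "pos_meas_Rplus M" "null_sets M \<subseteq> null_sets N" "A \<in> sets borel" "emeasure M A = 0" for M N A
    using that by (auto simp: pos_meas_Rplus_def null_sets_def)
  show "closure_B LMd = closure_sup LMd" unfolding LMd_def
  proof (rule laplace_class_closures, elim exE conjE)
    fix M N A assume *: "pos_meas_Rplus M" "null_sets M \<subseteq> null_sets N" "countable (A :: real set)" "emeasure M (UNIV - A) = 0"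
    have "UNIV - A \<in> sets borel" using sets.countable[of A borel] *(3) by auto
    with * null show "\<exists>A. countable A \<and> emeasure N (UNIV - A) = 0" by blast
  qed
  show "closure_B LMs = closure_sup LMs" unfolding LMs_def
  proof (rule laplace_class_closures, elim conjE bexE, intro conjI allI)
    fix M N A assume *: "pos_meas_Rplus M" "null_sets M \<subseteq> null_sets N" "(A :: real set) \<in> sets borel" "emeasure lborel A = 0" "emeasure M (UNIV - A) = 0"
      "\<forall>x. emeasure M {x} = 0"
    have "UNIV - A \<in> sets borel" using *(3) by auto
    with * null show "\<exists>A\<in>sets borel. emeasure lborel A = 0 \<and> emeasure N (UNIV - A) = 0" by blast
    show "emeasure N {x} = 0" for x using * null by simp
  qed
qed

section \<open>The Riemann-Lebesgue lemma\<close>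

text \<open>Approach to infinity is restricted to the open half-plane, where the values are
  significant; \<open>C0_cl_B_spaceI\<close> recovers the statement on the closed one.\<close>

abbreviation (input) at_inf_Cplus :: "complex filter" where
  "at_inf_Cplus \<equiv> inf at_infinity (principal Cplus)"

lemma eventually_at_inf_Cplus:
  "eventually P at_inf_Cplus \<longleftrightarrow> (\<exists>R. \<forall>z\<in>Cplus. cmod z \<ge> R \<longrightarrow> P z)"
  by (auto simp: eventually_inf_principal eventually_at_infinity)

text \<open>The indicator is built in so that \<open>u\<close> ranges over all integrable functions
  on the line, as induction over integrable functions produces them.\<close>

definition laplace_fun :: "(real \<Rightarrow> complex) \<Rightarrow> complex \<Rightarrow> complex" where
  "laplace_fun u z = (LINT t|lborel. indicator {0..} t *\<^sub>R (u t * exp (- (z * complex_of_real t))))"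

lemma integrable_laplace_fun:
  assumes u: "integrable lborel u" and z: "Re z \<ge> 0"
  shows "integrable lborel (\<lambda>t. indicator {0..} t *\<^sub>R (u t * exp (- (z * complex_of_real t))))"
proof (rule Bochner_Integration.integrable_bound[OF u])
  have [measurable]: "u \<in> borel_measurable borel" using borel_measurable_integrable[OF u] by simp
  show "(\<lambda>t. indicator {0..} t *\<^sub>R (u t * exp (- (z * complex_of_real t)))) \<in> borel_measurable lborel"
    by measurable
  show "AE t in lborel. cmod (indicator {0..} t *\<^sub>R (u t * exp (- (z * complex_of_real t)))) \<le> cmod (u t)"
    using z by (auto simp: indicator_def norm_mult norm_exp_eq_Re intro!: mult_left_le)
qed

lemma norm_laplace_fun_le:
  assumes u: "integrable lborel u" and z: "Re z \<ge> 0"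
  shows "cmod (laplace_fun u z) \<le> (LINT t|lborel. cmod (u t))"
  unfolding laplace_fun_def
proof (rule norm_integral_le_AE[OF integrable_laplace_fun[OF assms]])
  show "AE t in lborel. cmod (indicator {0..} t *\<^sub>R (u t * exp (- (z * complex_of_real t)))) \<le> cmod (u t)"
    using z by (auto simp: indicator_def norm_mult norm_exp_eq_Re intro!: mult_left_le)
qed (use u in auto)

lemma laplace_fun_add:
  assumes "integrable lborel u" "integrable lborel v" "Re z \<ge> 0"
  shows "laplace_fun (\<lambda>t. u t + v t) z = laplace_fun u z + laplace_fun v z"
  unfolding laplace_fun_def using assms
  by (simp add: distrib_right scaleR_add_right integrable_laplace_fun Bochner_Integration.integral_add)

lemma laplace_fun_diff:
  assumes "integrable lborel u" "integrable lborel v" "Re z \<ge> 0"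
  shows "laplace_fun (\<lambda>t. u t - v t) z = laplace_fun u z - laplace_fun v z"
  unfolding laplace_fun_def using assms
  by (simp add: left_diff_distrib scaleR_diff_right integrable_laplace_fun Bochner_Integration.integral_diff)

lemma laplace_fun_mult_right:
  "laplace_fun (\<lambda>t. u t * c) z = laplace_fun u z * c"
  unfolding laplace_fun_def by (subst integral_mult_left_zero[symmetric]) (simp add: mult_ac)

text \<open>Dominated convergence gives convergence in \<open>L\<^sup>1\<close>, hence uniform
  convergence of the transforms on the half-plane, and decay at infinity survives uniform limits.
  This is the closure step of both inductions that follow.\<close>

lemma laplace_fun_tendsto_limit:
  assumes s: "\<And>i. integrable lborel (s i)" and f: "f \<in> borel_measurable lborel" and w: "integrable lborel w"
    and lim: "\<And>x. (\<lambda>i. s i x) \<longlonglongrightarrow> f x" and bd: "\<And>i x. cmod (s i x) \<le> w x"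
    and tends: "\<And>i. (laplace_fun (s i) \<longlongrightarrow> 0) at_inf_Cplus"
  shows "(laplace_fun f \<longlongrightarrow> 0) at_inf_Cplus"
proof (rule tendstoI)
  fix e :: real assume e: "e > 0"
  have fw: "cmod (f x) \<le> w x" for x
    using tendsto_norm[OF lim[of x]] bd by (intro tendsto_upperbound) auto
  have fi: "integrable lborel f"
  proof (rule Bochner_Integration.integrable_bound[OF w f])
    show "AE x in lborel. norm (f x) \<le> norm (w x)" using fw abs_ge_self order_trans by fastforce
  qed
  have "(\<lambda>i. LINT x|lborel. cmod (f x - s i x)) \<longlonglongrightarrow> (LINT x|(lborel :: real measure). 0 :: real)"
  proof (rule integral_dominated_convergence[where w = "\<lambda>x. 2 * w x"])
    show "AE x in lborel. (\<lambda>i. cmod (f x - s i x)) \<longlonglongrightarrow> 0"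
      using tendsto_norm_zero[OF Lim_null[THEN iffD1, OF lim]] by (simp add: norm_minus_commute)
    show "AE x in lborel. norm (cmod (f x - s i x)) \<le> 2 * w x" for i
    proof (rule AE_I2)
      fix x show "norm (cmod (f x - s i x)) \<le> 2 * w x"
        using norm_triangle_ineq4[of "f x" "s i x"] fw[of x] bd[of i x] by simp
    qed
  qed (use w f s in \<open>auto intro: borel_measurable_integrable\<close>)
  then have "eventually (\<lambda>i. (LINT x|lborel. cmod (f x - s i x)) < e / 2) sequentially"
    using e by (intro order_tendstoD(2)) auto
  then obtain i where i: "(LINT x|lborel. cmod (f x - s i x)) < e / 2"
    by (auto dest: eventually_happens)
  have C: "eventually (\<lambda>z. z \<in> Cplus) at_inf_Cplus" by (simp add: eventually_inf_principal)
  have "eventually (\<lambda>z. dist (laplace_fun (s i) z) 0 < e / 2) at_inf_Cplus"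
    using tends[of i] e by (intro tendstoD) auto
  with C show "eventually (\<lambda>z. dist (laplace_fun f z) 0 < e) at_inf_Cplus"
  proof eventually_elim
    case (elim z)
    then have z: "Re z \<ge> 0" by (simp add: Cplus_def)
    have "cmod (laplace_fun f z - laplace_fun (s i) z) < e / 2"
      using norm_laplace_fun_le[of "\<lambda>t. f t - s i t" z] laplace_fun_diff[OF fi s z] i z fi s
      by (simp add: Bochner_Integration.integrable_diff)
    then show ?case using elim(2) norm_triangle_sub[of "laplace_fun f z" "laplace_fun (s i) z"] by (simp add: dist_norm)
  qed
qed

lemma laplace_fun_interval:
  assumes "z \<noteq> 0" "m \<ge> 0"
  shows "laplace_fun (indicator {0..m}) z = (1 - exp (- (z * of_real m))) / z"
proof -
  have "(LINT t|lborel. indicator {0..m} t *\<^sub>R exp (- (z * complex_of_real t)))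
      = - (exp (- (z * of_real m)) / z) - (- (exp (- (z * of_real 0)) / z))"
  proof (rule integral_FTC_Icc)
    show "((\<lambda>t. - (exp (- (z * complex_of_real t)) / z)) has_vector_derivative exp (- (z * of_real t))) (at t within {0..m})" for t
    proof -
      have "((\<lambda>w. - (exp (- (z * w)) / z)) has_field_derivative exp (- (z * of_real t))) (at (of_real t))"
        using assms by (auto intro!: derivative_eq_intros)
      then show ?thesis by (rule has_vector_derivative_real_field[THEN has_vector_derivative_at_within])
    qed
  qed (use assms in \<open>auto intro!: continuous_intros\<close>)
  moreover have "laplace_fun (indicator {0..m}) z = (LINT t|lborel. indicator {0..m} t *\<^sub>R exp (- (z * complex_of_real t)))"
    unfolding laplace_fun_def by (intro Bochner_Integration.integral_cong) (auto simp: indicator_def)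
  ultimately show ?thesis by (simp add: diff_divide_distrib)
qed

lemma laplace_fun_interval_tendsto:
  "(laplace_fun (indicator {0..m}) \<longlongrightarrow> 0) at_inf_Cplus"
proof (cases "m \<ge> 0")
  case True
  show ?thesis
  proof (rule Lim_null_comparison)
    show "((\<lambda>z. 2 / cmod z) \<longlongrightarrow> 0) at_inf_Cplus"
    proof (rule tendsto_mono[OF inf_le1])
      show "((\<lambda>z::complex. 2 / cmod z) \<longlongrightarrow> 0) at_infinity"
        by (intro tendsto_divide_0[OF tendsto_const] filterlim_at_top_imp_at_infinity filterlim_norm_at_top)
    qed
    show "eventually (\<lambda>z. cmod (laplace_fun (indicator {0..m}) z) \<le> 2 / cmod z) at_inf_Cplus"
      unfolding eventually_inf_principal
    proof (rule always_eventually, intro allI impI)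
      fix z assume z: "z \<in> Cplus"
      then have z0: "z \<noteq> 0" by (auto simp: Cplus_def)
      have "cmod (1 - exp (- (z * of_real m))) \<le> 1 + exp (- (Re z * m))"
        using norm_triangle_ineq4[of 1 "exp (- (z * of_real m))"] by (simp add: norm_exp_kernel)
      also have "\<dots> \<le> 2" using z True by (simp add: Cplus_def)
      finally show "cmod (laplace_fun (indicator {0..m}) z) \<le> 2 / cmod z"
        using z0 True by (simp add: laplace_fun_interval norm_divide divide_right_mono)
    qed
  qed
next
  case False
  then have "laplace_fun (indicator {0..m}) = (\<lambda>z. 0)" by (simp add: laplace_fun_def fun_eq_iff)
  then show ?thesis by simp
qed

text \<open>A Dynkin-class argument over the rays \<open>{..a}\<close>, which meet the window
  \<open>{0..K}\<close> in intervals. The window is fixed throughout since complements of sets of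
  finite measure are not integrable; inside it, complements become differences and disjoint unions
  become dominated limits of finite sums.\<close>

lemma laplace_fun_bounded_set_tendsto:
  fixes K :: real
  assumes "A \<in> sets borel"
  shows "(laplace_fun (indicator (A \<inter> {0..K})) \<longlongrightarrow> 0) at_inf_Cplus"
proof -
  have int: "integrable lborel (indicator (A \<inter> {0..K}) :: real \<Rightarrow> complex)" if "A \<in> sets borel" for A
  proof (rule Bochner_Integration.integrable_bound[of _ "indicator {0..K} :: real \<Rightarrow> real"])
    show "integrable lborel (indicator {0..K} :: real \<Rightarrow> real)"
      by (simp add: integrable_indicator_iff emeasure_lborel_Icc_eq)
    show "(indicator (A \<inter> {0..K}) :: real \<Rightarrow> complex) \<in> borel_measurable lborel" using that by measurable
  qed (auto simp: indicator_def)
  have sb: "(sets borel :: real set set) = sigma_sets UNIV (range (\<lambda>a. {..a}))"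
    by (subst borel_eq_atMost) simp
  have Is: "Int_stable (range (\<lambda>a::real. {..a}))"
    by (auto simp: Int_stable_def intro!: image_eqI[of _ _ "min _ _"])
  have sub: "range (\<lambda>a::real. {..a}) \<subseteq> Pow UNIV" by simp
  have "A \<in> sigma_sets UNIV (range (\<lambda>a. {..a}))" using assms sb by simp
  with Is sub show ?thesis
  proof (induction rule: sigma_sets_induct_disjoint)
    case (basic A)
    then obtain a where "A = {..a}" by auto
    then have "A \<inter> {0..K} = {0..min a K}" by auto
    then show ?case using laplace_fun_interval_tendsto by simp
  next
    case (compl A)
    then have A: "A \<in> sets borel" using sb by simp
    have "((\<lambda>z. laplace_fun (indicator {0..K}) z - laplace_fun (indicator (A \<inter> {0..K})) z) \<longlongrightarrow> 0 - 0) at_inf_Cplus"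
      by (intro tendsto_diff laplace_fun_interval_tendsto compl)
    moreover have "eventually (\<lambda>z. laplace_fun (indicator {0..K}) z - laplace_fun (indicator (A \<inter> {0..K})) z
        = laplace_fun (indicator ((UNIV - A) \<inter> {0..K})) z) at_inf_Cplus"
      unfolding eventually_inf_principal
    proof (rule always_eventually, intro allI impI)
      fix z assume "z \<in> Cplus"
      then have z: "Re z \<ge> 0" by (simp add: Cplus_def)
      have "(indicator ((UNIV - A) \<inter> {0..K}) :: real \<Rightarrow> complex) = (\<lambda>t. indicator {0..K} t - indicator (A \<inter> {0..K}) t)"
        by (auto simp: indicator_def fun_eq_iff)
      then show "laplace_fun (indicator {0..K}) z - laplace_fun (indicator (A \<inter> {0..K})) z
        = laplace_fun (indicator ((UNIV - A) \<inter> {0..K})) z"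
        using laplace_fun_diff[OF int[of UNIV] int[OF A] z] by simp
    qed
    ultimately show ?case by (simp add: filterlim_cong[OF refl refl])
  next
    case (union A)
    then have A: "A i \<in> sets borel" for i using sb by auto
    have step: "laplace_fun (indicator ((\<Union>i<n. A i) \<inter> {0..K})) z = (\<Sum>i<n. laplace_fun (indicator (A i \<inter> {0..K})) z)"
      if z: "Re z \<ge> 0" for n z
    proof (induction n)
      case 0
      then show ?case by (simp add: laplace_fun_def)
    next
      case (Suc n)
      have "A i \<inter> A n = {}" if "i < n" for i
        using disjoint_family_onD[OF \<open>disjoint_family A\<close>, of i n] that by auto
      then have dj: "(\<Union>i<n. A i) \<inter> A n = {}" by blast
      have "(indicator ((\<Union>i<Suc n. A i) \<inter> {0..K}) :: real \<Rightarrow> complex)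
         = (\<lambda>t. indicator ((\<Union>i<n. A i) \<inter> {0..K}) t + indicator (A n \<inter> {0..K}) t)"
        using dj by (auto simp: indicator_def fun_eq_iff lessThan_Suc)
      moreover have "(\<Union>i<n. A i) \<in> sets borel" using A by auto
      ultimately show ?case using laplace_fun_add[OF int int[OF A] z] Suc by simp
    qed
    show ?case
    proof (rule laplace_fun_tendsto_limit[where s = "\<lambda>n. indicator ((\<Union>i<n. A i) \<inter> {0..K})" and w = "indicator {0..K}"])
      show "integrable lborel (indicator ((\<Union>i<n. A i) \<inter> {0..K}) :: real \<Rightarrow> complex)" for n
        using A by (intro int) auto
      show "(indicator ((\<Union>i. A i) \<inter> {0..K}) :: real \<Rightarrow> complex) \<in> borel_measurable lborel"
        using A by (intro borel_measurable_indicator) auto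
      show "integrable lborel (indicator {0..K} :: real \<Rightarrow> real)"
        by (simp add: integrable_indicator_iff emeasure_lborel_Icc_eq)
      show "(\<lambda>n. indicator ((\<Union>i<n. A i) \<inter> {0..K}) x :: complex) \<longlonglongrightarrow> indicator ((\<Union>i. A i) \<inter> {0..K}) x" for x
      proof -
        have "(\<lambda>n. indicator (\<Union>i<n. A i) x :: complex) \<longlonglongrightarrow> indicator (\<Union>i. A i) x"
          by (rule LIMSEQ_indicator_UN)
        from tendsto_mult[OF this tendsto_const[of "indicator {0..K} x"]] show ?thesis by (simp add: indicator_inter_arith)
      qed
      show "cmod (indicator ((\<Union>i<n. A i) \<inter> {0..K}) x) \<le> indicator {0..K} x" for n x
        by (auto simp: indicator_def)
      have "((\<lambda>z. \<Sum>i<n. laplace_fun (indicator (A i \<inter> {0..K})) z) \<longlongrightarrow> (\<Sum>i<n. 0)) at_inf_Cplus" for n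
        by (intro tendsto_sum union)
      moreover have "eventually (\<lambda>z. (\<Sum>i<n. laplace_fun (indicator (A i \<inter> {0..K})) z) =
          laplace_fun (indicator ((\<Union>i<n. A i) \<inter> {0..K})) z) at_inf_Cplus" for n
        unfolding eventually_inf_principal by (rule always_eventually) (auto simp: step Cplus_def)
      ultimately show "(laplace_fun (indicator ((\<Union>i<n. A i) \<inter> {0..K})) \<longlongrightarrow> 0) at_inf_Cplus" for n
        by (auto intro: Lim_transform_eventually)
    qed
  qed (auto simp: laplace_fun_def)
qed

text \<open>Induction over integrable functions. For an indicator of finite measure the windows
  \<open>{0..n}\<close> exhaust the half-line, which reduces it to the bounded case.\<close>

lemma laplace_fun_Riemann_Lebesgue:
  assumes "integrable lborel u"
  shows "(laplace_fun u \<longlongrightarrow> 0) at_inf_Cplus"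
  using assms
proof induction
  case (base A c)
  have A: "A \<in> sets borel" using base by simp
  have "(laplace_fun (indicator (A \<inter> {0..})) \<longlongrightarrow> 0) at_inf_Cplus"
  proof (rule laplace_fun_tendsto_limit[where s = "\<lambda>n. indicator (A \<inter> {0..real n})" and w = "indicator A"])
    show "integrable lborel (indicator (A \<inter> {0..real n}) :: real \<Rightarrow> complex)" for n
    proof (rule Bochner_Integration.integrable_bound[of _ "indicator A :: real \<Rightarrow> real"])
      show "integrable lborel (indicator A :: real \<Rightarrow> real)"
        using base by (simp add: integrable_indicator_iff)
      show "(indicator (A \<inter> {0..real n}) :: real \<Rightarrow> complex) \<in> borel_measurable lborel" using A by measurable
    qed (auto simp: indicator_def)
    show "(indicator (A \<inter> {0..}) :: real \<Rightarrow> complex) \<in> borel_measurable lborel" using A by measurable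
    show "integrable lborel (indicator A :: real \<Rightarrow> real)"
      using base by (simp add: integrable_indicator_iff)
    show "(\<lambda>n. indicator (A \<inter> {0..real n}) x :: complex) \<longlonglongrightarrow> indicator (A \<inter> {0..}) x" for x
    proof (rule tendsto_eventually)
      show "eventually (\<lambda>n. (indicator (A \<inter> {0..real n}) x :: complex) = indicator (A \<inter> {0..}) x) sequentially"
        using eventually_ge_at_top[of "nat \<lceil>x\<rceil>"] by eventually_elim (auto simp: indicator_def)
    qed
    show "(laplace_fun (indicator (A \<inter> {0..real n})) \<longlongrightarrow> 0) at_inf_Cplus" for n
      using A by (rule laplace_fun_bounded_set_tendsto)
  qed (auto simp: indicator_def)
  then have "((\<lambda>z. laplace_fun (indicator (A \<inter> {0..})) z * c) \<longlongrightarrow> 0 * c) at_inf_Cplus"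
    by (intro tendsto_intros)
  moreover have "laplace_fun (\<lambda>t. indicator A t *\<^sub>R c) z = laplace_fun (indicator (A \<inter> {0..})) z * c" for z
    unfolding laplace_fun_mult_right[symmetric] unfolding laplace_fun_def
    by (intro Bochner_Integration.integral_cong) (auto simp: indicator_def)
  ultimately show ?case by simp
next
  case (add f g)
  have "((\<lambda>z. laplace_fun f z + laplace_fun g z) \<longlongrightarrow> 0 + 0) at_inf_Cplus"
    by (intro tendsto_add add)
  moreover have "eventually (\<lambda>z. laplace_fun f z + laplace_fun g z = laplace_fun (\<lambda>t. f t + g t) z) at_inf_Cplus"
    unfolding eventually_inf_principal by (rule always_eventually) (auto simp: laplace_fun_add add Cplus_def)
  ultimately show ?case by (simp add: filterlim_cong[OF refl refl])
next
  case (lim f s)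
  show ?case
    by (rule laplace_fun_tendsto_limit[where s = s and w = "\<lambda>x. 2 * cmod (f x)"])
      (use lim in \<open>auto intro: borel_measurable_integrable\<close>)
qed

section \<open>Absolutely continuous measures and their densities\<close>

lemma laplace_pos_density:
  assumes [measurable]: "u \<in> borel_measurable borel" and nn: "\<And>t. u t \<ge> 0" and neg: "\<And>t. t < 0 \<Longrightarrow> u t = 0"
  shows "laplace_pos (density lborel (\<lambda>t. ennreal (u t))) z = laplace_fun (\<lambda>t. of_real (u t)) z"
proof -
  have "laplace_pos (density lborel (\<lambda>t. ennreal (u t))) z = (LINT t|lborel. u t *\<^sub>R exp (- (z * complex_of_real t)))"
    unfolding laplace_pos_def using nn by (intro integral_density) auto
  also have "\<dots> = laplace_fun (\<lambda>t. of_real (u t)) z"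
    unfolding laplace_fun_def using neg
    by (intro Bochner_Integration.integral_cong) (auto simp: indicator_def scaleR_conv_of_real)
  finally show ?thesis .
qed

lemma pos_meas_density:
  assumes u: "integrable lborel u" and nn: "\<And>t. u t \<ge> 0" and neg: "\<And>t. t < 0 \<Longrightarrow> u t = (0 :: real)"
  shows "pos_meas_Rplus (density lborel (\<lambda>t. ennreal (u t)))"
proof -
  have [measurable]: "u \<in> borel_measurable borel" using borel_measurable_integrable[OF u] by simp
  have "emeasure (density lborel (\<lambda>t. ennreal (u t))) UNIV = ennreal (LINT t|lborel. u t)"
    using nn u by (simp add: emeasure_density nn_integral_eq_integral)
  then have "finite_measure (density lborel (\<lambda>t. ennreal (u t)))" by (intro finite_measureI) simp
  moreover have "emeasure (density lborel (\<lambda>t. ennreal (u t))) {..<0} = (\<integral>\<^sup>+ t. 0 \<partial>(lborel :: real measure))"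
  proof (subst emeasure_density)
    show "(\<integral>\<^sup>+ t. ennreal (u t) * indicator {..<0} t \<partial>lborel) = (\<integral>\<^sup>+ t. 0 \<partial>(lborel :: real measure))"
      using neg by (intro nn_integral_cong) (auto simp: indicator_def)
  qed auto
  ultimately show ?thesis by (simp add: pos_meas_Rplus_def)
qed

text \<open>Radon-Nikodym turns the measure into a density, to which the Riemann-Lebesgue lemma
  applies.\<close>

lemma laplace_pos_abs_cont_tendsto:
  assumes M: "pos_meas_Rplus M" and ac: "absolutely_continuous lborel M"
  shows "(laplace_pos M \<longlongrightarrow> 0) at_inf_Cplus"
proof -
  interpret finite_measure M using M by (simp add: pos_meas_Rplus_def)
  have sM: "sets M = sets borel" using M by (simp add: pos_meas_Rplus_def)
  have sp: "space M = UNIV" using sets_eq_imp_space_eq[OF sM] by simp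
  obtain f where f[measurable]: "f \<in> borel_measurable lborel" and d: "density lborel f = M"
    using sigma_finite_measure.Radon_Nikodym[OF lborel.sigma_finite_measure_axioms ac] sM by auto
  have "(\<integral>\<^sup>+ t. f t \<partial>lborel) = emeasure M UNIV" by (simp add: emeasure_density flip: d)
  then have fin: "(\<integral>\<^sup>+ t. f t \<partial>lborel) \<noteq> \<infinity>" using emeasure_finite by simp
  then have "AE t in lborel. f t \<noteq> \<infinity>" by (intro nn_integral_PInf_AE) auto
  moreover have "AE t in lborel. t < 0 \<longrightarrow> f t = 0"
  proof -
    have "(\<integral>\<^sup>+ t. f t * indicator {..<0} t \<partial>lborel) = 0"
      using M d by (subst emeasure_density[symmetric]) (auto simp: pos_meas_Rplus_def)
    then have "AE t in lborel. f t * indicator {..<0} t = 0" by (subst (asm) nn_integral_0_iff_AE) auto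
    then show ?thesis by eventually_elim (auto simp: indicator_def)
  qed
  \<comment> \<open>Finite total mass excludes the value \<infinity>, and absence of mass on the
    negative axis forces the density to vanish there, so a real density supported on the half-line
    represents \<open>M\<close>.\<close>
  ultimately have ae: "AE t in lborel. f t = ennreal (indicator {0..} t * enn2real (f t))"
    by eventually_elim (auto simp: indicator_def less_top)
  let ?u = "\<lambda>t. indicator {0..} t * enn2real (f t)"
  have Mu: "M = density lborel (\<lambda>t. ennreal (?u t))"
    unfolding d[symmetric] by (intro density_cong ae) auto
  have ui: "integrable lborel ?u"
  proof (rule integrableI_nonneg)
    have "(\<integral>\<^sup>+ t. ennreal (?u t) \<partial>lborel) = (\<integral>\<^sup>+ t. f t \<partial>lborel)"
      using ae by (intro nn_integral_cong_AE) auto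
    then show "(\<integral>\<^sup>+ t. ennreal (?u t) \<partial>lborel) < \<infinity>" using fin by (simp add: less_top)
  qed auto
  have "laplace_pos M = laplace_fun (\<lambda>t. of_real (?u t))"
    unfolding Mu by (intro ext laplace_pos_density) auto
  then show ?thesis using laplace_fun_Riemann_Lebesgue[OF integrable_of_real[OF ui]] by simp
qed

lemma LL1_tendsto:
  assumes "h \<in> LL1"
  shows "(h \<longlongrightarrow> 0) at_inf_Cplus"
proof -
  obtain M1 M2 M3 M4 where 
    h: "h = (\<lambda>z. laplace_pos M1 z - laplace_pos M2 z + \<i> * (laplace_pos M3 z - laplace_pos M4 z))"
    and M: "pos_meas_Rplus M1" "pos_meas_Rplus M2" "pos_meas_Rplus M3" "pos_meas_Rplus M4"
     "absolutely_continuous lborel M1" "absolutely_continuous lborel M2"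
     "absolutely_continuous lborel M3" "absolutely_continuous lborel M4"
    using laplace_classE[OF assms[unfolded LL1_def]] .
  have "((\<lambda>z. laplace_pos M1 z - laplace_pos M2 z + \<i> * (laplace_pos M3 z - laplace_pos M4 z)) \<longlongrightarrow> 0 - 0 + \<i> * (0 - 0)) at_inf_Cplus"
    by (intro tendsto_intros laplace_pos_abs_cont_tendsto M)
  then show ?thesis by (simp add: h)
qed

text \<open>The four measures of the encoding are the positive parts of \<open>Re u\<close>,
  \<open>- Re u\<close>, \<open>Im u\<close> and \<open>- Im u\<close> on the half-line; recombining
  them gives back \<open>u\<close> there.\<close>

lemma laplace_fun_in_LL1:
  assumes u: "integrable lborel u"
  obtains h where "h \<in> LL1" "\<And>z. z \<in> Cplus \<Longrightarrow> h z = laplace_fun u z"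
proof -
  have [measurable]: "u \<in> borel_measurable borel" using borel_measurable_integrable[OF u] by simp
  define pp where "pp v t = indicator {0..} t * max 0 (v t)" for v :: "real \<Rightarrow> real" and t
  have pi: "integrable lborel (pp v)" if "integrable lborel v" for v
  proof (rule Bochner_Integration.integrable_bound[OF that])
    have [measurable]: "v \<in> borel_measurable borel" using borel_measurable_integrable[OF that] by simp
    show "pp v \<in> borel_measurable lborel" unfolding pp_def[abs_def] by measurable
  qed (auto simp: pp_def indicator_def)
  define M where "M v = density lborel (\<lambda>t. ennreal (pp v t))" for v
  have M: "pos_meas_Rplus (M v) \<and> absolutely_continuous lborel (M v)" "laplace_pos (M v) z = laplace_fun (\<lambda>t. of_real (pp v t)) z"
    if "integrable lborel v" for v z
  proof -
    have [measurable]: "pp v \<in> borel_measurable borel" using borel_measurable_integrable[OF pi[OF that]] by simp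
    show "pos_meas_Rplus (M v) \<and> absolutely_continuous lborel (M v)" unfolding M_def
    proof (intro conjI pos_meas_density absolutely_continuousI_density)
      show "integrable lborel (pp v)" using that by (rule pi)
      show "pp v t \<ge> 0" for t by (simp add: pp_def)
      show "pp v t = 0" if "t < 0" for t using that by (simp add: pp_def)
    qed measurable
    show "laplace_pos (M v) z = laplace_fun (\<lambda>t. of_real (pp v t)) z" unfolding M_def
    proof (rule laplace_pos_density)
      show "pp v t \<ge> 0" for t by (simp add: pp_def)
      show "pp v t = 0" if "t < 0" for t using that by (simp add: pp_def)
    qed measurable
  qed
  let ?v1 = "\<lambda>t. Re (u t)" and ?v2 = "\<lambda>t. - Re (u t)" and ?v3 = "\<lambda>t. Im (u t)" and ?v4 = "\<lambda>t. - Im (u t)"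
  have i: "integrable lborel ?v1" "integrable lborel ?v2" "integrable lborel ?v3" "integrable lborel ?v4"
    using u by auto
  define h where "h z = laplace_pos (M ?v1) z - laplace_pos (M ?v2) z + \<i> * (laplace_pos (M ?v3) z - laplace_pos (M ?v4) z)" for z
  show ?thesis
  proof (rule that[of h])
    show "h \<in> LL1" unfolding h_def[abs_def] LL1_def using M(1) i by (intro laplace_classI) blast
    fix z assume "z \<in> Cplus"
    then have z: "Re z \<ge> 0" by (simp add: Cplus_def)
    have j: "integrable lborel (\<lambda>t. complex_of_real (pp v t))" if "integrable lborel v" for v
      using pi[OF that] by (rule integrable_of_real)
    have "h z = laplace_fun (\<lambda>t. of_real (pp ?v1 t) - of_real (pp ?v2 t)) z
        + laplace_fun (\<lambda>t. of_real (pp ?v3 t) - of_real (pp ?v4 t)) z * \<i>"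
      using z by (simp add: h_def M i j laplace_fun_diff mult.commute)
    also have "\<dots> = laplace_fun (\<lambda>t. of_real (pp ?v1 t) - of_real (pp ?v2 t) + (of_real (pp ?v3 t) - of_real (pp ?v4 t)) * \<i>) z"
      unfolding laplace_fun_mult_right[symmetric]
      using z by (intro laplace_fun_add[symmetric]) (auto intro!: j i)
    also have "\<dots> = laplace_fun u z"
      unfolding laplace_fun_def
      by (intro Bochner_Integration.integral_cong) (auto simp: pp_def indicator_def complex_eq_iff max_def)
    finally show "h z = laplace_fun u z" .
  qed
qed

section \<open>Polynomials in the resolvent and rational functions\<close>

text \<open>A single term of the exponential series at \<open>t / 2\<close> is at most the whole
  sum.\<close>

lemma power_times_exp_le:
  fixes t :: real
  assumes "t \<ge> 0"
  shows "t ^ k * exp (- t) \<le> fact k * 2 ^ k * exp (- (t / 2))"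
proof -
  have "(\<lambda>n. (t / 2) ^ n /\<^sub>R fact n) sums exp (t / 2)" by (rule exp_converges)
  then have "(t / 2) ^ k / fact k \<le> exp (t / 2)"
    using sum_le_suminf[of "\<lambda>n. (t / 2) ^ n /\<^sub>R fact n" "{k}"] assms
    by (auto simp: sums_iff field_simps)
  then have "t ^ k \<le> fact k * 2 ^ k * exp (t / 2)" by (simp add: field_simps)
  then have "t ^ k * exp (- t) \<le> fact k * 2 ^ k * exp (t / 2) * exp (- t)" by (intro mult_right_mono) auto
  also have "\<dots> = fact k * 2 ^ k * exp (- (t / 2))" by (simp flip: exp_add)
  finally show ?thesis .
qed

text \<open>The density of a gamma distribution without its normalisation; its transform is a power
  of the resolvent \<open>1 / (1 + z)\<close>.\<close>

definition gamma_weight :: "nat \<Rightarrow> real \<Rightarrow> real" where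
  "gamma_weight k t = indicator {0..} t * (t ^ k * exp (- t))"

lemma integrable_gamma_weight: "integrable lborel (gamma_weight k)"
proof -
  have "(\<integral>\<^sup>+ t. ennreal (exp (- (t / 2))) * indicator {0..} t \<partial>lborel) = ennreal (0 - (- 2 * exp (- (0 / 2))))"
  proof (rule nn_integral_FTC_atLeast)
    show "((\<lambda>t. - 2 * exp (- (t / 2))) has_real_derivative exp (- (x / 2))) (at x)" for x :: real
      by (auto intro!: derivative_eq_intros)
    have "((\<lambda>t::real. exp (- (t / 2))) \<longlongrightarrow> 0) at_top"
      by (intro filterlim_compose[OF exp_at_bot] filterlim_compose[OF filterlim_uminus_at_bot_at_top])
        (use filterlim_tendsto_pos_mult_at_top[OF tendsto_const[of "1/2::real"] _ filterlim_ident] in simp)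
    from tendsto_mult[OF tendsto_const[of "-2"] this]
    show "((\<lambda>t::real. - 2 * exp (- (t / 2))) \<longlongrightarrow> 0) at_top" by simp
  qed auto
  then have "integrable lborel (\<lambda>t::real. indicator {0..} t * exp (- (t / 2)))"
    by (intro integrableI_nonneg) (auto simp: ennreal_mult' ennreal_indicator mult.commute)
  then have "integrable lborel (\<lambda>t::real. fact k * 2 ^ k * (indicator {0..} t * exp (- (t / 2))))"
    by (rule integrable_mult_right)
  then show ?thesis
  proof (rule Bochner_Integration.integrable_bound)
    show "gamma_weight k \<in> borel_measurable lborel" unfolding gamma_weight_def[abs_def] by measurable
    show "AE t in lborel. norm (gamma_weight k t) \<le> norm (fact k * 2 ^ k * (indicator {0..} t * exp (- (t / 2))))"
      using power_times_exp_le[of _ k] by (auto simp: gamma_weight_def indicator_def)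
  qed
qed

text \<open>Dominated convergence along \<open>{0..n}\<close>, with the modulus of the integrand
  itself as majorant, carries the fundamental theorem to the half-line.\<close>

lemma improper_integral_FTC:
  fixes G G' :: "real \<Rightarrow> complex"
  assumes d: "\<And>t. t \<ge> 0 \<Longrightarrow> (G has_vector_derivative G' t) (at t)"
    and c: "continuous_on {0..} G'" and i: "integrable lborel (\<lambda>t. indicator {0..} t *\<^sub>R G' t)"
    and l: "(G \<longlongrightarrow> 0) at_top"
  shows "(LINT t|lborel. indicator {0..} t *\<^sub>R G' t) = - G 0"
proof -
  have "(\<lambda>n::nat. LINT t|lborel. indicator {0..real n} t *\<^sub>R G' t) \<longlonglongrightarrow> (LINT t|lborel. indicator {0..} t *\<^sub>R G' t)"
  proof (rule integral_dominated_convergence[where w = "\<lambda>t. cmod (indicator {0..} t *\<^sub>R G' t)"])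
    show "AE t in lborel. (\<lambda>n. indicator {0..real n} t *\<^sub>R G' t) \<longlonglongrightarrow> indicator {0..} t *\<^sub>R G' t"
    proof (rule AE_I2, rule tendsto_eventually)
      fix t show "eventually (\<lambda>n. indicator {0..real n} t *\<^sub>R G' t = indicator {0..} t *\<^sub>R G' t) sequentially"
        using eventually_ge_at_top[of "nat \<lceil>t\<rceil>"] by eventually_elim (auto simp: indicator_def)
    qed
    show "(\<lambda>t. indicator {0..real n} t *\<^sub>R G' t) \<in> borel_measurable lborel" for n
    proof -
      have "(\<lambda>t. indicator {0..real n} t *\<^sub>R (indicator {0..} t *\<^sub>R G' t)) \<in> borel_measurable lborel"
        using borel_measurable_integrable[OF i] by measurable
      moreover have "(\<lambda>t. indicator {0..real n} t *\<^sub>R (indicator {0..} t *\<^sub>R G' t)) = (\<lambda>t. indicator {0..real n} t *\<^sub>R G' t)"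
        by (auto simp: indicator_def fun_eq_iff)
      ultimately show ?thesis by simp
    qed
  qed (use i integrable_norm[OF i] in \<open>auto simp: indicator_def\<close>)
  moreover have "(LINT t|lborel. indicator {0..real n} t *\<^sub>R G' t) = G (real n) - G 0" for n
    using d c by (intro integral_FTC_Icc) (auto intro: has_vector_derivative_at_within continuous_on_subset)
  moreover have "(\<lambda>n. G (real n) - G 0) \<longlonglongrightarrow> 0 - G 0"
    by (intro tendsto_diff tendsto_const filterlim_compose[OF l filterlim_real_sequentially])
  ultimately show ?thesis using LIMSEQ_unique by fastforce
qed

text \<open>Integration by parts as a recursion: with \<open>s = 1 + z\<close>, the derivative of
  \<open>t ^ (k + 1) * exp (- s * t)\<close> integrates to 0 over the half-line, which ties the
  transform for \<open>k + 1\<close> to the one for \<open>k\<close>.\<close>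

lemma laplace_fun_gamma_weight:
  assumes z: "Re z \<ge> 0"
  shows "laplace_fun (\<lambda>t. of_real (gamma_weight k t)) z = fact k / (1 + z) ^ Suc k"
proof (induction k)
  let ?p = "\<lambda>k t. complex_of_real t ^ k * exp (- ((1 + z) * of_real t))"
  have s: "1 + z \<noteq> 0" using z by (auto simp: complex_eq_iff)
  have eq: "indicator {0..} t *\<^sub>R (of_real (gamma_weight k t) * exp (- (z * complex_of_real t))) = indicator {0..} t *\<^sub>R ?p k t" for k t
    by (auto simp: gamma_weight_def indicator_def exp_of_real[symmetric] algebra_simps exp_add[symmetric])
  have i: "integrable lborel (\<lambda>t. indicator {0..} t *\<^sub>R ?p k t)" for k
    using integrable_laplace_fun[OF integrable_of_real[OF integrable_gamma_weight[of k]] z] unfolding eq .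
  have L: "laplace_fun (\<lambda>t. of_real (gamma_weight k t)) z = (LINT t|lborel. indicator {0..} t *\<^sub>R ?p k t)" for k
    unfolding laplace_fun_def eq ..
  have lim: "(?p k \<longlongrightarrow> 0) at_top" for k
  proof (rule Lim_null_comparison[OF _ tendsto_power_div_exp_0[of k]])
    show "eventually (\<lambda>t. cmod (?p k t) \<le> t ^ k / exp t) at_top"
      using eventually_ge_at_top[of 0]
    proof eventually_elim
      case (elim t)
      have "exp (- ((1 + Re z) * t)) \<le> exp (- t)" using elim z by (simp add: algebra_simps)
      then have "t ^ k * exp (- ((1 + Re z) * t)) \<le> t ^ k * exp (- t)" using elim by (intro mult_left_mono) auto
      then show ?case using elim by (simp add: norm_mult norm_power norm_exp_eq_Re exp_minus field_simps)
    qed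
  qed
  have e: "((\<lambda>t. exp (- ((1 + z) * complex_of_real t))) has_vector_derivative - ((1 + z) * ?p 0 t)) (at t)" for t
  proof -
    have "((\<lambda>w. exp (- ((1 + z) * w))) has_field_derivative - ((1 + z) * ?p 0 t)) (at (complex_of_real t))"
      by (rule derivative_eq_intros refl | simp add: algebra_simps)+
    then show ?thesis by (rule has_vector_derivative_real_field)
  qed
  {
    case 0
    have "(LINT t|lborel. indicator {0..} t *\<^sub>R - ((1 + z) * ?p 0 t)) = - exp (- ((1 + z) * complex_of_real 0))"
      using i[of 0] lim[of 0]
      by (intro improper_integral_FTC e) (auto intro!: continuous_intros simp: mult.left_commute simp flip: mult_scaleR_right)
    moreover have "(LINT t|lborel. indicator {0..} t *\<^sub>R - ((1 + z) * ?p 0 t)) = - (1 + z) * (LINT t|lborel. indicator {0..} t *\<^sub>R ?p 0 t)"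
      unfolding integral_mult_right_zero[symmetric]
      by (intro Bochner_Integration.integral_cong) (auto simp: indicator_def algebra_simps)
    ultimately show ?case using s unfolding L by (simp add: field_simps)
  next
    case (Suc k)
    let ?G' = "\<lambda>t. of_nat (Suc k) * ?p k t - (1 + z) * ?p (Suc k) t"
    have "(LINT t|lborel. indicator {0..} t *\<^sub>R ?G' t) = - ?p (Suc k) 0"
    proof (rule improper_integral_FTC)
      show "(?p (Suc k) has_vector_derivative ?G' t) (at t)" for t
      proof -
        have "((\<lambda>w. w ^ Suc k * exp (- ((1 + z) * w))) has_field_derivative ?G' t) (at (complex_of_real t))"
          by (rule derivative_eq_intros refl | simp add: algebra_simps)+
        then show ?thesis by (rule has_vector_derivative_real_field)
      qed
      show "continuous_on {0..} ?G'" by (intro continuous_intros)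
      show "integrable lborel (\<lambda>t. indicator {0..} t *\<^sub>R ?G' t)"
        using Bochner_Integration.integrable_diff[OF integrable_mult_right[OF i[of k], of "of_nat (Suc k)"] integrable_mult_right[OF i[of "Suc k"], of "1 + z"]]
        by (simp add: scaleR_diff_right del: of_nat_Suc power_Suc)
    qed (rule lim)
    moreover have "(LINT t|lborel. indicator {0..} t *\<^sub>R ?G' t) = 
       of_nat (Suc k) * (LINT t|lborel. indicator {0..} t *\<^sub>R ?p k t) - (1 + z) * (LINT t|lborel. indicator {0..} t *\<^sub>R ?p (Suc k) t)"
      unfolding integral_mult_right_zero[symmetric]
      using integrable_mult_right[OF i[of k], of "of_nat (Suc k)"] integrable_mult_right[OF i[of "Suc k"], of "1 + z"]
      by (subst Bochner_Integration.integral_diff[symmetric]) (auto simp: scaleR_diff_right simp del: of_nat_Suc power_Suc)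
    ultimately have "(1 + z) * laplace_fun (\<lambda>t. of_real (gamma_weight (Suc k) t)) z = of_nat (Suc k) * (fact k / (1 + z) ^ Suc k)"
      unfolding Suc[symmetric] unfolding L by simp
    from arg_cong[OF this, of "\<lambda>x. x / (1 + z)"] show ?case using s by (simp add: mult_ac)
  }
qed

lemma poly_in_LL1:
  obtains h where "h \<in> LL1" "\<And>z. z \<in> Cplus \<Longrightarrow> h z = poly (pCons 0 Q) (1 / (1 + z))"
proof -
  \<comment> \<open>The division by \<open>fact k\<close> cancels the factorial in the transform;
    the number of terms is left free for an induction.\<close>
  define u where "u n t = (\<Sum>k<n. of_real (gamma_weight k t) * (coeff Q k / fact k))" for n t
  have ui: "integrable lborel (u n)" for n
    unfolding u_def[abs_def] by (intro Bochner_Integration.integrable_sum integrable_mult_left integrable_of_real integrable_gamma_weight)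
  have L: "laplace_fun (u n) z = (\<Sum>k<n. coeff Q k / (1 + z) ^ Suc k)" if z: "Re z \<ge> 0" for z n
  proof (induction n)
    case 0
    then show ?case by (simp add: laplace_fun_def u_def)
  next
    case (Suc n)
    have "u (Suc n) = (\<lambda>t. u n t + of_real (gamma_weight n t) * (coeff Q n / fact n))"
      by (simp add: u_def fun_eq_iff)
    then have "laplace_fun (u (Suc n)) z = laplace_fun (u n) z + laplace_fun (\<lambda>t. of_real (gamma_weight n t)) z * (coeff Q n / fact n)"
      unfolding laplace_fun_mult_right[symmetric]
      by (simp only:) (intro laplace_fun_add ui z integrable_mult_left integrable_of_real integrable_gamma_weight)
    then show ?case by (simp add: Suc laplace_fun_gamma_weight z del: power_Suc)
  qed
  obtain h where h: "h \<in> LL1" "\<And>z. z \<in> Cplus \<Longrightarrow> h z = laplace_fun (u (Suc (degree Q))) z"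
    using laplace_fun_in_LL1[OF ui] by blast
  show ?thesis
  proof (rule that[OF h(1)])
    fix z assume z: "z \<in> Cplus"
    then have "h z = (\<Sum>k\<le>degree Q. coeff Q k / (1 + z) ^ Suc k)"
      by (simp add: h L Cplus_def lessThan_Suc_atMost del: power_Suc)
    also have "\<dots> = poly (pCons 0 Q) (1 / (1 + z))"
      by (simp only: poly_pCons) (simp add: poly_altdef sum_distrib_left power_divide divide_inverse power_inverse mult_ac)
    finally show "h z = poly (pCons 0 Q) (1 / (1 + z))" .
  qed
qed

section \<open>Rational functions vanishing at infinity\<close>

lemma R0I:
  assumes "degree p < degree q" "\<And>z. z \<in> Cplus_cl \<Longrightarrow> poly q z \<noteq> 0"
  shows "(\<lambda>z. poly p z / poly q z) \<in> R0"
  unfolding R0_def mem_Collect_eq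
  by (intro exI[of _ p] exI[of _ q] conjI refl ballI assms)

text \<open>Clearing denominators, \<open>(1 + z) ^ degree Q\<close> times
  \<open>poly Q (1 / (1 + z))\<close> is the reflected polynomial at \<open>1 + z\<close>. The
  missing constant term contributes one more factor to \<open>q\<close>, which makes the degree
  inequality strict.\<close>

lemma poly_in_R0:
  obtains h where "h \<in> R0" "\<And>z. z \<in> Cplus \<Longrightarrow> h z = poly (pCons 0 Q) (1 / (1 + z))"
proof -
  define p where "p = pcompose (reflect_poly Q) [:1, 1:]"
  define q where "q = ([:1, 1:] :: complex poly) ^ Suc (degree Q)"
  have dq: "degree q = Suc (degree Q)" unfolding q_def by (subst degree_power_eq) auto
  have dp: "degree p \<le> degree Q" unfolding p_def by (simp add: degree_pcompose degree_reflect_poly_le)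
  have nz: "1 + z \<noteq> 0" if "z \<in> Cplus_cl" for z using that by (auto simp: Cplus_cl_def complex_eq_iff)
  show ?thesis
  proof (rule that[of "\<lambda>z. poly p z / poly q z"])
    show "(\<lambda>z. poly p z / poly q z) \<in> R0"
    proof (rule R0I)
      show "degree p < degree q" using dp dq by simp
      show "poly q z \<noteq> 0" if "z \<in> Cplus_cl" for z using nz[OF that] by (simp add: q_def del: power_Suc)
    qed
    fix z assume "z \<in> Cplus"
    then have s: "1 + z \<noteq> 0" by (intro nz) (simp add: Cplus_def Cplus_cl_def)
    have "poly p z = (1 + z) ^ degree Q * poly Q (inverse (1 + z))"
      unfolding p_def poly_pcompose using poly_reflect_poly_nz[OF s, of Q] by simp
    moreover have "poly q z = (1 + z) ^ Suc (degree Q)" by (simp add: q_def del: power_Suc)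
    ultimately show "poly p z / poly q z = poly (pCons 0 Q) (1 / (1 + z))"
      using s by (simp add: divide_inverse)
  qed
qed

text \<open>Used with \<open>n = degree q\<close> for numerator and denominator of a member of
  \<open>R0\<close>: the limits are then 0 and the nonzero leading coefficient of
  \<open>q\<close>.\<close>

lemma poly_div_power_tendsto:
  assumes "degree p \<le> n"
  shows "((\<lambda>z::complex. poly p z / z ^ n) \<longlongrightarrow> coeff p n) at_infinity"
proof -
  have "((\<lambda>z::complex. \<Sum>i\<le>n. coeff p i * (z ^ i / z ^ n)) \<longlongrightarrow> (\<Sum>i\<le>n. coeff p i * (if i = n then 1 else 0))) at_infinity"
  proof (intro tendsto_sum tendsto_mult tendsto_const)
    fix i assume "i \<in> {..n}"
    have ev: "eventually (\<lambda>z::complex. z \<noteq> 0) at_infinity"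
      by (auto simp: eventually_at_infinity intro!: exI[of _ 1])
    show "((\<lambda>z::complex. z ^ i / z ^ n) \<longlongrightarrow> (if i = n then 1 else 0)) at_infinity"
    proof (cases "i = n")
      case True
      then show ?thesis by (intro tendsto_eventually) (use ev in \<open>eventually_elim, simp\<close>)
    next
      case False
      with \<open>i \<in> {..n}\<close> have "i < n" by simp
      have "((\<lambda>z::complex. inverse z ^ (n - i)) \<longlongrightarrow> 0 ^ (n - i)) at_infinity"
        by (intro tendsto_power tendsto_inverse_0)
      then have "((\<lambda>z::complex. inverse z ^ (n - i)) \<longlongrightarrow> 0) at_infinity" using \<open>i < n\<close> by (simp add: power_0_left)
      moreover have "eventually (\<lambda>z::complex. inverse z ^ (n - i) = z ^ i / z ^ n) at_infinity"
        using ev by eventually_elim (use \<open>i < n\<close> in \<open>simp add: power_diff field_simps\<close>)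
      ultimately show ?thesis using False by (auto intro: Lim_transform_eventually)
    qed
  qed
  moreover have "poly p z / z ^ n = (\<Sum>i\<le>n. coeff p i * (z ^ i / z ^ n))" for z
  proof -
    have "poly p z = (\<Sum>i\<le>n. coeff p i * z ^ i)"
      unfolding poly_altdef using assms by (intro sum.mono_neutral_left) (auto simp: coeff_eq_0)
    then show ?thesis by (simp add: sum_divide_distrib)
  qed
  ultimately show ?thesis by (simp add: if_distrib cong: if_cong)
qed

lemma R0_tendsto:
  assumes "h \<in> R0"
  shows "(h \<longlongrightarrow> 0) at_inf_Cplus"
proof -
  obtain p q where h: "h = (\<lambda>z. poly p z / poly q z)" and d: "degree p < degree q"
    using assms by (auto simp: R0_def)
  have "((\<lambda>z. (poly p z / z ^ degree q) / (poly q z / z ^ degree q)) \<longlongrightarrow> coeff p (degree q) / coeff q (degree q)) at_infinity"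
    using d by (intro tendsto_divide poly_div_power_tendsto) auto
  moreover have "eventually (\<lambda>z. (poly p z / z ^ degree q) / (poly q z / z ^ degree q) = h z) at_infinity"
    unfolding eventually_at_infinity by (intro exI[of _ 1]) (auto simp: h)
  ultimately have "(h \<longlongrightarrow> 0) at_infinity"
    using d by (auto intro: Lim_transform_eventually simp: coeff_eq_0)
  then show ?thesis by (rule tendsto_mono[OF inf_le1])
qed

lemma of_real_at_inf_Cplus: "filterlim complex_of_real at_inf_Cplus at_top"
proof -
  have "filterlim complex_of_real at_infinity at_top"
    by (intro filterlim_of_real_at_infinity)
  moreover have "eventually (\<lambda>x. complex_of_real x \<in> Cplus) at_top"
    using eventually_gt_at_top[of 0] by eventually_elim (simp add: Cplus_def)
  ultimately show ?thesis by (simp add: filterlim_inf filterlim_principal)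
qed

text \<open>For spaces whose members vanish at infinity the constant in the general criterion is
  0.\<close>

lemma closure_eq_of_shift_diff:
  assumes hol: "\<And>h. h \<in> Y \<Longrightarrow> h holomorphic_on Cplus" and tends: "\<And>h. h \<in> Y \<Longrightarrow> (h \<longlongrightarrow> 0) at_inf_Cplus"
    and shift: "\<And>h \<delta> n. h \<in> Y \<Longrightarrow> 0 < \<delta> \<Longrightarrow> \<delta> < n \<Longrightarrow>
      \<exists>h'\<in>Y. \<forall>z\<in>Cplus. h' z = h (z + of_real \<delta>) - h (z + of_real n)"
  shows "closure_B Y = closure_sup Y"
proof (rule closure_B_eq_closure_sup[OF hol])
  fix h \<delta> n assume h: "h \<in> Y" "0 < \<delta>" "\<delta> < (n :: real)"
  have "((\<lambda>x. h (of_real x)) \<longlongrightarrow> 0) at_top"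
    by (rule filterlim_compose[OF tends[OF h(1)] of_real_at_inf_Cplus])
  then show "\<exists>h'\<in>Y. \<exists>c. ((\<lambda>x. h (of_real x)) \<longlongrightarrow> c) at_top \<and>
        (\<forall>z\<in>Cplus. h' z = h (z + of_real \<delta>) - h (z + of_real n) + c)"
    using shift[OF h] by (metis add.right_neutral)
qed

lemma R0_closures: "closure_B R0 = closure_sup R0"
proof (rule closure_eq_of_shift_diff)
  fix h assume h: "h \<in> R0"
  then show "(h \<longlongrightarrow> 0) at_inf_Cplus" by (rule R0_tendsto)
  show "h holomorphic_on Cplus" using h
    by (auto simp: R0_def Cplus_cl_def Cplus_def intro!: holomorphic_intros)
next
  fix h \<delta> n assume "h \<in> R0" and d: "0 < \<delta>" "\<delta> < (n :: real)"
  then obtain p q where h: "h = (\<lambda>z. poly p z / poly q z)" "degree p < degree q" "\<And>z. z \<in> Cplus_cl \<Longrightarrow> poly q z \<noteq> 0"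
    by (auto simp: R0_def)
  define S where "S p a = pcompose p [:complex_of_real a, 1:]" for p a
  have S: "poly (S p a) z = poly p (z + of_real a)" "degree (S p a) = degree p" for p a z
    by (simp_all add: S_def poly_pcompose degree_pcompose add.commute)
  have q0: "S q a \<noteq> 0" for a using S(2)[of q a] h(2) by force
  \<comment> \<open>Common denominator of the two translates. Translation keeps degrees, so each
    product in \<open>?p\<close> has degree below \<open>2 * degree q\<close>.\<close>
  let ?p = "S p \<delta> * S q n - S p n * S q \<delta>" and ?q = "S q \<delta> * S q n"
  have "degree ?q = degree q + degree q" using q0 by (simp add: degree_mult_eq S)
  moreover have "degree ?p < degree q + degree q"
  proof (rule degree_diff_less)
    show "degree (S p \<delta> * S q n) < degree q + degree q"
      using degree_mult_le[of "S p \<delta>" "S q n"] h(2) by (simp add: S)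
    show "degree (S p n * S q \<delta>) < degree q + degree q"
      using degree_mult_le[of "S p n" "S q \<delta>"] h(2) by (simp add: S)
  qed
  moreover have nz: "poly (S q a) z \<noteq> 0" if "z \<in> Cplus_cl" "a \<ge> 0" for z a
    using that by (auto simp: S Cplus_cl_def intro!: h(3))
  ultimately have "(\<lambda>z. poly ?p z / poly ?q z) \<in> R0"
    using d by (intro R0I) auto
  moreover have "poly ?p z / poly ?q z = h (z + of_real \<delta>) - h (z + of_real n)" if "z \<in> Cplus" for z
  proof -
    have "poly (S q \<delta>) z \<noteq> 0" "poly (S q n) z \<noteq> 0" using that d nz by (auto simp: Cplus_def Cplus_cl_def)
    then have "poly ?p z / poly ?q z = poly (S p \<delta>) z / poly (S q \<delta>) z - poly (S p n) z / poly (S q n) z"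
      by (simp add: field_simps)
    then show ?thesis by (simp add: S h(1))
  qed
  ultimately show "\<exists>h'\<in>R0. \<forall>z\<in>Cplus. h' z = h (z + of_real \<delta>) - h (z + of_real n)"
    by (intro bexI[of _ "\<lambda>z. poly ?p z / poly ?q z"] ballI)
qed

section \<open>Entire functions of exponential type\<close>

lemma C0_cl_tendsto:
  assumes "C0_cl f"
  shows "(f \<longlongrightarrow> 0) at_inf_Cplus"
proof -
  obtain g where g: "\<And>z. z \<in> Cplus \<Longrightarrow> g z = f z" "(g \<longlongrightarrow> 0) (inf at_infinity (principal Cplus_cl))"
    using assms by (auto simp: C0_cl_def)
  have "Cplus \<subseteq> Cplus_cl" by (auto simp: Cplus_def Cplus_cl_def)
  then have "at_inf_Cplus \<le> inf at_infinity (principal Cplus_cl)" by (intro inf_mono) auto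
  with g(2) have "(g \<longlongrightarrow> 0) at_inf_Cplus" by (rule tendsto_mono[rotated])
  moreover have "eventually (\<lambda>z. g z = f z) at_inf_Cplus"
    by (simp add: eventually_inf_principal g(1))
  ultimately show ?thesis by (rule Lim_transform_eventually)
qed

lemma C0_cl_add:
  assumes "C0_cl f" "C0_cl g"
  shows "C0_cl (\<lambda>z. f z + g z)"
proof -
  obtain F where F: "continuous_on Cplus_cl F" "\<forall>z\<in>Cplus. F z = f z" "(F \<longlongrightarrow> 0) (inf at_infinity (principal Cplus_cl))"
    using assms(1) by (auto simp: C0_cl_def)
  obtain G where G: "continuous_on Cplus_cl G" "\<forall>z\<in>Cplus. G z = g z" "(G \<longlongrightarrow> 0) (inf at_infinity (principal Cplus_cl))"
    using assms(2) by (auto simp: C0_cl_def)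
  show ?thesis unfolding C0_cl_def
    using F G tendsto_add[OF F(3) G(3)] by (intro exI[of _ "\<lambda>z. F z + G z"]) (auto intro: continuous_on_add)
qed

lemma C0_cl_mult:
  assumes "C0_cl f" "C0_cl g"
  shows "C0_cl (\<lambda>z. f z * g z)"
proof -
  obtain F where F: "continuous_on Cplus_cl F" "\<forall>z\<in>Cplus. F z = f z" "(F \<longlongrightarrow> 0) (inf at_infinity (principal Cplus_cl))"
    using assms(1) by (auto simp: C0_cl_def)
  obtain G where G: "continuous_on Cplus_cl G" "\<forall>z\<in>Cplus. G z = g z" "(G \<longlongrightarrow> 0) (inf at_infinity (principal Cplus_cl))"
    using assms(2) by (auto simp: C0_cl_def)
  show ?thesis unfolding C0_cl_def
    using F G tendsto_mult[OF F(3) G(3)] by (intro exI[of _ "\<lambda>z. F z * G z"]) (auto intro: continuous_on_mult)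
qed

lemma C0_cl_cmult:
  assumes "C0_cl f"
  shows "C0_cl (\<lambda>z. c * f z)"
proof -
  obtain F where F: "continuous_on Cplus_cl F" "\<forall>z\<in>Cplus. F z = f z" "(F \<longlongrightarrow> 0) (inf at_infinity (principal Cplus_cl))"
    using assms(1) by (auto simp: C0_cl_def)
  show ?thesis unfolding C0_cl_def
    using F tendsto_mult_right_zero[OF F(3)] by (intro exI[of _ "\<lambda>z. c * F z"]) (auto intro: continuous_on_mult_left)
qed

lemma C0_cl_shift:
  assumes "C0_cl f" and a: "a \<ge> 0"
  shows "C0_cl (\<lambda>z. f (z + of_real a))"
proof -
  obtain F where F: "continuous_on Cplus_cl F" "\<forall>z\<in>Cplus. F z = f z" "(F \<longlongrightarrow> 0) (inf at_infinity (principal Cplus_cl))"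
    using assms(1) by (auto simp: C0_cl_def)
  have "filterlim (\<lambda>z. z + complex_of_real a) at_infinity at_infinity"
    by (rule tendsto_add_filterlim_at_infinity'[OF filterlim_ident tendsto_const])
  then have "filterlim (\<lambda>z. z + complex_of_real a) (inf at_infinity (principal Cplus_cl)) (inf at_infinity (principal Cplus_cl))"
    unfolding filterlim_inf filterlim_principal
    using a by (auto intro: filterlim_mono simp: eventually_inf_principal Cplus_cl_def)
  from filterlim_compose[OF F(3) this] have "((\<lambda>z. F (z + of_real a)) \<longlongrightarrow> 0) (inf at_infinity (principal Cplus_cl))" .
  moreover have "continuous_on Cplus_cl (\<lambda>z. F (z + of_real a))"
    using a by (intro continuous_on_compose2[OF F(1)] continuous_intros) (auto simp: Cplus_cl_def)
  ultimately show ?thesis unfolding C0_cl_def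
    using F(2) a by (intro exI[of _ "\<lambda>z. F (z + of_real a)"]) (auto simp: Cplus_def)
qed

section \<open>The algebra of entire functions of exponential type vanishing at infinity\<close>

lemma J0I:
  assumes "f holomorphic_on UNIV" "\<And>z. cmod (f z) \<le> A * exp (B * cmod z)" "\<And>z. z \<in> Cplus \<Longrightarrow> cmod (f z) \<le> G" "C0_cl f"
  shows "f \<in> J0"
  unfolding J0_def using assms by (auto simp: bounded_iff)

text \<open>Passing to absolute values makes both constants nonnegative, as the monotonicity
  estimates for sums, products and translates require.\<close>

lemma J0E:
  assumes "f \<in> J0"
  obtains A B G where "f holomorphic_on UNIV" "A \<ge> 0" "B \<ge> 0" "\<And>z. cmod (f z) \<le> A * exp (B * cmod z)"
    "\<And>z. z \<in> Cplus \<Longrightarrow> cmod (f z) \<le> G" "C0_cl f"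
proof -
  obtain A B where f: "f holomorphic_on UNIV" "\<And>z. cmod (f z) \<le> A * exp (B * cmod z)" "C0_cl f"
    using assms unfolding J0_def by blast
  obtain G where G: "\<And>z. z \<in> Cplus \<Longrightarrow> cmod (f z) \<le> G"
    using assms unfolding J0_def bounded_iff by blast
  have "cmod (f z) \<le> \<bar>A\<bar> * exp (\<bar>B\<bar> * cmod z)" for z
    by (rule order_trans[OF f(2)], rule mult_mono) (auto intro!: mult_right_mono)
  then show ?thesis using f G by (intro that[of "\<bar>A\<bar>" "\<bar>B\<bar>" G]) auto
qed

lemma J0_add:
  assumes "f \<in> J0" "g \<in> J0"
  shows "(\<lambda>z. f z + g z) \<in> J0"
proof -
  obtain A B G where f: "f holomorphic_on UNIV" "A \<ge> 0" "B \<ge> 0" "\<And>z. cmod (f z) \<le> A * exp (B * cmod z)"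
    "\<And>z. z \<in> Cplus \<Longrightarrow> cmod (f z) \<le> G" "C0_cl f" using J0E[OF assms(1)] by blast
  obtain A' B' G' where g: "g holomorphic_on UNIV" "A' \<ge> 0" "B' \<ge> 0" "\<And>z. cmod (g z) \<le> A' * exp (B' * cmod z)"
    "\<And>z. z \<in> Cplus \<Longrightarrow> cmod (g z) \<le> G'" "C0_cl g" using J0E[OF assms(2)] by blast
  show ?thesis
  proof (rule J0I[where A = "A + A'" and B = "B + B'" and G = "G + G'"])
    fix z
    have "A * exp (B * cmod z) \<le> A * exp ((B + B') * cmod z)" "A' * exp (B' * cmod z) \<le> A' * exp ((B + B') * cmod z)"
      using f g by (auto intro!: mult_left_mono mult_right_mono)
    then show "cmod (f z + g z) \<le> (A + A') * exp ((B + B') * cmod z)"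
      using norm_triangle_ineq[of "f z" "g z"] f(4)[of z] g(4)[of z] by (simp add: distrib_right)
    show "cmod (f z + g z) \<le> G + G'" if "z \<in> Cplus"
      using norm_triangle_ineq[of "f z" "g z"] f(5)[OF that] g(5)[OF that] by simp
  qed (use f g in \<open>auto intro: holomorphic_intros C0_cl_add\<close>)
qed

lemma J0_mult:
  assumes "f \<in> J0" "g \<in> J0"
  shows "(\<lambda>z. f z * g z) \<in> J0"
proof -
  obtain A B G where f: "f holomorphic_on UNIV" "A \<ge> 0" "B \<ge> 0" "\<And>z. cmod (f z) \<le> A * exp (B * cmod z)"
    "\<And>z. z \<in> Cplus \<Longrightarrow> cmod (f z) \<le> G" "C0_cl f" using J0E[OF assms(1)] by blast
  obtain A' B' G' where g: "g holomorphic_on UNIV" "A' \<ge> 0" "B' \<ge> 0" "\<And>z. cmod (g z) \<le> A' * exp (B' * cmod z)"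
    "\<And>z. z \<in> Cplus \<Longrightarrow> cmod (g z) \<le> G'" "C0_cl g" using J0E[OF assms(2)] by blast
  show ?thesis
  proof (rule J0I[where A = "A * A'" and B = "B + B'" and G = "G * G'"])
    fix z
    have "cmod (f z * g z) \<le> (A * exp (B * cmod z)) * (A' * exp (B' * cmod z))"
      unfolding norm_mult using f(2) by (intro mult_mono f(4) g(4)) auto
    then show "cmod (f z * g z) \<le> (A * A') * exp ((B + B') * cmod z)"
      by (subst distrib_right, subst exp_add) (simp add: mult_ac)
    show "cmod (f z * g z) \<le> G * G'" if "z \<in> Cplus"
      unfolding norm_mult using order_trans[OF norm_ge_zero f(5)[OF that]] by (intro mult_mono f(5) g(5) that) auto
  qed (use f g in \<open>auto intro: holomorphic_intros C0_cl_mult\<close>)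
qed

lemma J0_cmult:
  assumes "f \<in> J0"
  shows "(\<lambda>z. c * f z) \<in> J0"
proof -
  obtain A B G where f: "f holomorphic_on UNIV" "A \<ge> 0" "B \<ge> 0" "\<And>z. cmod (f z) \<le> A * exp (B * cmod z)"
    "\<And>z. z \<in> Cplus \<Longrightarrow> cmod (f z) \<le> G" "C0_cl f" using J0E[OF assms(1)] by blast
  show ?thesis
    by (rule J0I[where A = "cmod c * A" and B = B and G = "cmod c * G"])
      (use f in \<open>auto intro!: holomorphic_intros C0_cl_cmult mult_left_mono simp: norm_mult mult.assoc\<close>)
qed

lemma J0_shift:
  assumes "f \<in> J0" and a: "a \<ge> 0"
  shows "(\<lambda>z. f (z + of_real a)) \<in> J0"
proof -
  obtain A B G where f: "f holomorphic_on UNIV" "A \<ge> 0" "B \<ge> 0" "\<And>z. cmod (f z) \<le> A * exp (B * cmod z)"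
    "\<And>z. z \<in> Cplus \<Longrightarrow> cmod (f z) \<le> G" "C0_cl f" using J0E[OF assms(1)] by blast
  show ?thesis
  proof (rule J0I[where A = "A * exp (B * a)" and B = B and G = G])
    have "(f \<circ> (\<lambda>z. z + of_real a)) holomorphic_on UNIV"
      by (intro holomorphic_on_compose_gen[OF _ f(1)] holomorphic_intros) auto
    then show "(\<lambda>z. f (z + of_real a)) holomorphic_on UNIV" by (simp add: o_def)
    fix z
    have "B * cmod (z + of_real a) \<le> B * (a + cmod z)"
      using norm_triangle_ineq[of z "of_real a"] a f(3) by (intro mult_left_mono) auto
    then have "A * exp (B * cmod (z + of_real a)) \<le> A * exp (B * (a + cmod z))" using f(2) by (intro mult_left_mono) auto
    then show "cmod (f (z + of_real a)) \<le> A * exp (B * a) * exp (B * cmod z)"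
      using f(4)[of "z + of_real a"] by (simp add: distrib_left exp_add)
    show "cmod (f (z + of_real a)) \<le> G" if "z \<in> Cplus" using that a by (intro f(5)) (simp add: Cplus_def)
  qed (use f a in \<open>auto intro: C0_cl_shift\<close>)
qed

lemma J0_closures: "closure_B J0 = closure_sup J0"
proof (rule closure_eq_of_shift_diff)
  fix h assume h: "h \<in> J0"
  show "h holomorphic_on Cplus" using h by (auto simp: J0_def intro: holomorphic_on_subset)
  show "(h \<longlongrightarrow> 0) at_inf_Cplus" using h by (intro C0_cl_tendsto) (auto simp: J0_def)
next
  fix h \<delta> n assume h: "h \<in> J0" and d: "0 < \<delta>" "\<delta> < (n :: real)"
  have "(\<lambda>z. h (z + of_real \<delta>) + (- 1) * h (z + of_real n)) \<in> J0"
    using h d by (intro J0_add J0_cmult J0_shift) auto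
  then show "\<exists>h'\<in>J0. \<forall>z\<in>Cplus. h' z = h (z + of_real \<delta>) - h (z + of_real n)"
    by (intro bexI) auto
qed

text \<open>The Laplace transform of \<open>e\<^sup>-\<^sup>t\<close> cut off at \<open>K\<close>: an entire substitute for \<open>1 / (1 + z)\<close>.\<close>

definition cutoff_resolvent :: "real \<Rightarrow> complex \<Rightarrow> complex" where
  "cutoff_resolvent K z = (if z = -1 then of_real K else (1 - exp (- (of_real K * (1 + z)))) / (1 + z))"

lemma one_plus_Cplus_cl:
  assumes "z \<in> Cplus_cl"
  shows "1 + z \<noteq> 0" "cmod (1 + z) \<ge> 1"
proof -
  show "cmod (1 + z) \<ge> 1" using assms abs_Re_le_cmod[of "1 + z"] by (simp add: Cplus_cl_def)
  then show "1 + z \<noteq> 0" by auto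
qed

lemma cutoff_resolvent_Cplus_cl:
  assumes "z \<in> Cplus_cl"
  shows "cutoff_resolvent K z = (1 - exp (- (of_real K * (1 + z)))) / (1 + z)"
  using one_plus_Cplus_cl[OF assms] by (auto simp: cutoff_resolvent_def)

lemma norm_cutoff_resolvent_le:
  assumes "z \<in> Cplus_cl" "K \<ge> 0"
  shows "cmod (cutoff_resolvent K z) \<le> 2 / cmod (1 + z)"
proof -
  have "cmod (1 - exp (- (of_real K * (1 + z)))) \<le> 1 + cmod (exp (- (of_real K * (1 + z))))"
    using norm_triangle_ineq4[of 1 "exp (- (of_real K * (1 + z)))"] by simp
  also have "\<dots> \<le> 2" using assms by (simp add: norm_exp_eq_Re Cplus_cl_def)
  finally show ?thesis unfolding cutoff_resolvent_Cplus_cl[OF assms(1)] norm_divide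
    by (rule divide_right_mono) simp
qed

text \<open>Up to sign the error is \<open>exp (- (K * (1 + z))) / (1 + z)\<close>, and
  \<open>Re (1 + z) \<ge> 1\<close> makes it uniformly exponentially small in
  \<open>K\<close>.\<close>

lemma cutoff_resolvent_close:
  assumes "z \<in> Cplus_cl" "K \<ge> 0"
  shows "cmod (cutoff_resolvent K z - 1 / (1 + z)) \<le> exp (- K)"
proof -
  have "cmod (cutoff_resolvent K z - 1 / (1 + z)) = exp (- (K * (1 + Re z))) / cmod (1 + z)"
    unfolding cutoff_resolvent_Cplus_cl[OF assms(1)]
    by (simp add: diff_divide_distrib norm_divide norm_exp_eq_Re)
  also have "\<dots> \<le> exp (- K) / 1"
    using one_plus_Cplus_cl[OF assms(1)] assms by (intro frac_le) (auto simp: Cplus_cl_def distrib_left)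
  finally show ?thesis by simp
qed

text \<open>The formula is the difference quotient at \<open>-1\<close> of an entire function whose
  derivative there is \<open>K\<close>, so the singularity is removable with that value.\<close>

lemma cutoff_resolvent_holomorphic: "cutoff_resolvent K holomorphic_on UNIV"
proof -
  let ?f = "\<lambda>z::complex. - exp (- (of_real K * (1 + z)))"
  have "(?f has_field_derivative of_real K) (at (-1))" by (auto intro!: derivative_eq_intros)
  then have "deriv ?f (-1) = of_real K" by (rule DERIV_imp_deriv)
  then have "cutoff_resolvent K = (\<lambda>z. if z = -1 then deriv ?f (-1) else (?f z - ?f (-1)) / (z - (-1)))"
    by (auto simp: cutoff_resolvent_def fun_eq_iff add.commute)
  moreover have "(\<lambda>z. if z = -1 then deriv ?f (-1) else (?f z - ?f (-1)) / (z - (-1))) holomorphic_on UNIV"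
    by (intro pole_lemma holomorphic_intros) auto
  ultimately show ?thesis by simp
qed

lemma cutoff_resolvent_in_J0:
  assumes K: "K \<ge> 0"
  shows "cutoff_resolvent K \<in> J0"
proof (rule J0I[where A = "K * exp K" and B = K and G = 2])
  show "cutoff_resolvent K holomorphic_on UNIV" by (rule cutoff_resolvent_holomorphic)
  fix z :: complex
  have "cmod (cutoff_resolvent K z) \<le> K * exp (K * cmod (1 + z))"
  proof (cases "z = -1")
    case False
    then have s: "1 + z \<noteq> 0" by (metis add.inverse_inverse add_eq_0_iff)
    \<comment> \<open>The Taylor remainder of order 0 carries a factor \<open>cmod (1 + z)\<close>,
      which cancels the denominator; the bound is therefore uniform near \<open>-1\<close>.\<close>
    have "cmod (exp (- (of_real K * (1 + z))) - 1) \<le> exp (K * cmod (1 + z)) * (K * cmod (1 + z))"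
      using Taylor_exp_field[of "- (of_real K * (1 + z))" 0] K by (simp add: norm_mult)
    then show ?thesis using s False by (simp add: cutoff_resolvent_def norm_divide norm_minus_commute field_simps)
  qed (use K in \<open>simp add: cutoff_resolvent_def\<close>)
  also have "\<dots> \<le> K * exp (K * (1 + cmod z))"
    using norm_triangle_ineq[of 1 z] K by (intro mult_left_mono) (auto intro!: mult_left_mono)
  finally show "cmod (cutoff_resolvent K z) \<le> K * exp K * exp (K * cmod z)"
    by (simp add: distrib_left exp_add)
  show "cmod (cutoff_resolvent K z) \<le> 2" if "z \<in> Cplus"
  proof -
    have z: "z \<in> Cplus_cl" using that by (simp add: Cplus_def Cplus_cl_def)
    have "2 / cmod (1 + z) \<le> 2" using one_plus_Cplus_cl[OF z] by (simp add: divide_le_eq)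
    then show ?thesis using norm_cutoff_resolvent_le[OF z K] by linarith
  qed
next
  have "filterlim (\<lambda>z::complex. 1 + z) at_infinity at_infinity"
    by (rule tendsto_add_filterlim_at_infinity[OF tendsto_const filterlim_ident])
  then have "((\<lambda>z::complex. 2 / cmod (1 + z)) \<longlongrightarrow> 0) at_infinity"
    by (intro tendsto_divide_0[OF tendsto_const] filterlim_at_top_imp_at_infinity filterlim_compose[OF filterlim_norm_at_top])
  then have "((\<lambda>z::complex. 2 / cmod (1 + z)) \<longlongrightarrow> 0) (inf at_infinity (principal Cplus_cl))"
    by (rule tendsto_mono[OF inf_le1])
  then have "(cutoff_resolvent K \<longlongrightarrow> 0) (inf at_infinity (principal Cplus_cl))"
    by (rule Lim_null_comparison[rotated]) (simp add: eventually_inf_principal norm_cutoff_resolvent_le K)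
  then show "C0_cl (cutoff_resolvent K)" unfolding C0_cl_def
    using holomorphic_on_imp_continuous_on[OF cutoff_resolvent_holomorphic]
    by (intro exI[of _ "cutoff_resolvent K"]) (auto intro: continuous_on_subset)
qed

text \<open>\<open>J0\<close> is an algebra without nonzero constants, so the constant term must be
  0; Horner's scheme then uses only sums, scalar multiples and products.\<close>

lemma J0_poly:
  assumes J: "J \<in> J0"
  shows "(\<lambda>z. poly (pCons 0 Q) (J z)) \<in> J0"
proof (induction Q)
  case 0
  show ?case using J0_cmult[OF J, of 0] by simp
next
  case (pCons a p)
  have "(\<lambda>z. a * J z + J z * poly (pCons 0 p) (J z)) \<in> J0"
    by (intro J0_add J0_cmult J0_mult J pCons)
  then show ?case by (simp add: algebra_simps)
qed

text \<open>Both \<open>1 / (1 + z)\<close> and its cutoff take values in the disc of radius 2,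
  where the polynomial is uniformly continuous, so closeness of the arguments suffices.\<close>

lemma poly_approx_J0:
  assumes e: "e > 0"
  obtains h where "h \<in> J0" "\<And>z. z \<in> Cplus \<Longrightarrow> cmod (h z - poly (pCons 0 Q) (1 / (1 + z))) < e"
proof -
  have "uniformly_continuous_on (cball 0 2) (poly (pCons 0 Q))"
    by (intro compact_uniformly_continuous continuous_on_poly continuous_on_id compact_cball)
  then obtain d where d: "d > 0" "\<And>v w. v \<in> cball 0 2 \<Longrightarrow> w \<in> cball 0 2 \<Longrightarrow> dist w v < d \<Longrightarrow>
      dist (poly (pCons 0 Q) w) (poly (pCons 0 Q) v) < e"
    using e unfolding uniformly_continuous_on_def by blast
  define K where "K = max 0 (- ln d) + 1"
  have K: "K \<ge> 0" "exp (- K) < d"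
  proof -
    show "K \<ge> 0" by (simp add: K_def)
    have "- K < ln d" by (simp add: K_def)
    then show "exp (- K) < d" using d(1) by (metis exp_less_cancel_iff exp_ln)
  qed
  show ?thesis
  proof (rule that[of "\<lambda>z. poly (pCons 0 Q) (cutoff_resolvent K z)"])
    show "(\<lambda>z. poly (pCons 0 Q) (cutoff_resolvent K z)) \<in> J0"
      by (intro J0_poly cutoff_resolvent_in_J0 K)
    fix z assume "z \<in> Cplus"
    then have z: "z \<in> Cplus_cl" by (simp add: Cplus_def Cplus_cl_def)
    note o = one_plus_Cplus_cl[OF z]
    have "2 / cmod (1 + z) \<le> 2" using o by (simp add: divide_le_eq)
    then have "cutoff_resolvent K z \<in> cball 0 2" using norm_cutoff_resolvent_le[OF z K(1)] by simp
    moreover have "1 / (1 + z) \<in> cball 0 2" using o by (simp add: norm_divide divide_le_eq)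
    moreover have "dist (cutoff_resolvent K z) (1 / (1 + z)) < d"
      using cutoff_resolvent_close[OF z K(1)] K(2) by (simp add: dist_norm)
    ultimately show "cmod (poly (pCons 0 Q) (cutoff_resolvent K z) - poly (pCons 0 Q) (1 / (1 + z))) < e"
      using d(2) unfolding dist_norm by blast
  qed
qed

section \<open>Density of polynomials in the resolvent\<close>

text \<open>The sign of the real part of the quotient is that of
  \<open>1 - (cmod w)\<^sup>2\<close>, found by multiplying with the conjugate of the
  denominator.\<close>

lemma Cayley_Re:
  assumes "w \<noteq> -1"
  shows "cmod w \<le> 1 \<Longrightarrow> (1 - w) / (1 + w) \<in> Cplus_cl" "cmod w < 1 \<Longrightarrow> (1 - w) / (1 + w) \<in> Cplus"
proof -
  have "Re ((1 - w) * cnj (1 + w)) = 1 - (cmod w)\<^sup>2"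
    by (simp add: cmod_power2) (simp add: algebra_simps power2_eq_square)
  moreover have "(cmod w)\<^sup>2 \<le> 1" if "cmod w \<le> 1" using that by (simp add: power_le_one)
  moreover have "(cmod w)\<^sup>2 < 1" if "cmod w < 1" using that by (simp add: power_less_one_iff abs_square_less_1)
  ultimately show "cmod w \<le> 1 \<Longrightarrow> (1 - w) / (1 + w) \<in> Cplus_cl" "cmod w < 1 \<Longrightarrow> (1 - w) / (1 + w) \<in> Cplus"
    unfolding Cplus_def Cplus_cl_def mem_Collect_eq Re_complex_div_ge_0 Re_complex_div_gt_0 by auto
qed

text \<open>Dilation: \<open>F (r * w)\<close> with \<open>r < 1\<close> is close to
  \<open>F w\<close> by uniform continuity, and its Taylor series converges uniformly on the closed
  disc.\<close>

lemma disc_algebra_poly_approx: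
  fixes F :: "complex \<Rightarrow> complex"
  assumes c: "continuous_on (cball 0 1) F" and hol: "F holomorphic_on ball 0 1" and e: "e > 0"
  obtains P where "\<And>w. cmod w \<le> 1 \<Longrightarrow> cmod (F w - poly P w) < e"
proof -
  have "uniformly_continuous_on (cball 0 1) F" using c by (intro compact_uniformly_continuous) auto
  then obtain d where d: "d > 0" "\<And>v w. v \<in> cball 0 1 \<Longrightarrow> w \<in> cball 0 1 \<Longrightarrow> dist w v < d \<Longrightarrow> dist (F w) (F v) < e / 2"
    using e unfolding uniformly_continuous_on_def by (meson half_gt_zero)
  \<comment> \<open>The second term gives \<open>1 - r < d\<close>; the first keeps \<open>r\<close>
    positive when \<open>d\<close> is large.\<close>
  define r where "r = max (1/2) (1 - d / 2)"
  have r: "0 < r" "r < 1" "1 - r < d" using d(1) by (auto simp: r_def)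
  define a where "a n = (deriv ^^ n) F 0 / fact n" for n
  have series: "(\<lambda>n. a n * w ^ n) sums F w" if "cmod w < 1" for w
    using holomorphic_power_series[OF hol, of w] that by (simp add: a_def)
  \<comment> \<open>Convergence at a point strictly between \<open>r\<close> and 1 yields absolute
    convergence at radius \<open>r\<close>.\<close>
  have "summable (\<lambda>n. a n * (of_real ((1 + r) / 2)) ^ n)"
    using series[of "of_real ((1 + r) / 2)"] r by (intro sums_summable) (simp add: norm_of_real del: of_real_divide of_real_add)
  then have sm: "summable (\<lambda>n. cmod (a n * of_real r ^ n))"
    by (rule powser_insidea) (use r in \<open>simp add: norm_of_real del: of_real_divide of_real_add\<close>)
  have "uniform_limit (cball 0 1) (\<lambda>n w. \<Sum>i<n. a i * (of_real r * w) ^ i) (\<lambda>w. suminf (\<lambda>i. a i * (of_real r * w) ^ i)) sequentially"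
  proof (rule Weierstrass_m_test[OF _ sm])
    fix n and w :: complex assume "w \<in> cball 0 1"
    then have "cmod w ^ n \<le> 1" by (simp add: power_le_one)
    then have "cmod (a n * of_real r ^ n) * cmod w ^ n \<le> cmod (a n * of_real r ^ n) * 1" by (intro mult_left_mono) auto
    then show "cmod (a n * (of_real r * w) ^ n) \<le> cmod (a n * of_real r ^ n)"
      by (simp add: norm_mult norm_power power_mult_distrib mult.assoc)
  qed
  from uniform_limitD[OF this, of "e / 2"] e
  obtain N where N: "\<And>w. w \<in> cball 0 1 \<Longrightarrow> dist (\<Sum>i<N. a i * (of_real r * w) ^ i) (\<Sum>i. a i * (of_real r * w) ^ i) < e / 2"
    unfolding eventually_sequentially by (metis half_gt_zero order_refl)
  show ?thesis
  proof (rule that[of "\<Sum>i<N. monom (a i * of_real r ^ i) i"])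
    fix w :: complex assume w: "cmod w \<le> 1"
    have rw: "cmod (of_real r * w) \<le> r" using w r by (simp add: norm_mult mult_left_le)
    have P: "poly (\<Sum>i<N. monom (a i * of_real r ^ i) i) w = (\<Sum>i<N. a i * (of_real r * w) ^ i)"
      by (simp add: poly_sum poly_monom power_mult_distrib mult.assoc)
    have "F (of_real r * w) = (\<Sum>i. a i * (of_real r * w) ^ i)"
      using series[of "of_real r * w"] rw r by (simp add: sums_iff)
    then have "dist (poly (\<Sum>i<N. monom (a i * of_real r ^ i) i) w) (F (of_real r * w)) < e / 2"
      using N[of w] w by (simp add: P)
    moreover have "dist (F w) (F (of_real r * w)) < e / 2"
    proof (rule d(2))
      have "w - of_real r * w = of_real (1 - r) * w" by (simp add: algebra_simps)
      then have "dist w (of_real r * w) = (1 - r) * cmod w" using r by (simp add: dist_norm norm_mult del: of_real_diff)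
      also have "\<dots> \<le> 1 - r" using w r by (simp add: mult_left_le)
      finally show "dist w (of_real r * w) < d" using r by simp
    qed (use w rw r in auto)
    ultimately have "dist (F w) (poly (\<Sum>i<N. monom (a i * of_real r ^ i) i) w) < e"
      using dist_triangle_half_l by blast
    then show "cmod (F w - poly (\<Sum>i<N. monom (a i * of_real r ^ i) i) w) < e"
      by (simp only: dist_norm)
  qed
qed

text \<open>The Cayley map \<open>w = (1 - z) / (1 + z)\<close> sends infinity to \<open>-1\<close>,
  and decay at infinity becomes continuity of the extension by 0 there. As
  \<open>1 + w = 2 / (1 + z)\<close>, polynomials in \<open>w\<close> are polynomials in the
  resolvent.\<close>

lemma C0_poly_approx:
  assumes hol: "f holomorphic_on Cplus" and C0: "C0_cl f" and e: "e > 0"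
  obtains Q where "\<And>z. z \<in> Cplus \<Longrightarrow> cmod (f z - poly (pCons 0 Q) (1 / (1 + z))) < e"
proof -
  obtain g where g: "continuous_on Cplus_cl g" "\<And>z. z \<in> Cplus \<Longrightarrow> g z = f z" "(g \<longlongrightarrow> 0) (inf at_infinity (principal Cplus_cl))"
    using C0 by (auto simp: C0_cl_def)
  define m where "m w = (1 - w) / (1 + w)" for w :: complex
  define F where "F w = (if w = -1 then 0 else g (m w))" for w
  have nz: "1 + w \<noteq> 0" if "w \<noteq> -1" for w :: complex using that by (metis add.inverse_inverse add_eq_0_iff)
  have cm: "continuous_on (- {-1}) m" unfolding m_def by (intro continuous_intros) (auto simp: nz)
  have "continuous (at w within cball 0 1) F" if w: "w \<in> cball 0 1" for w
  proof (cases "w = -1")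
    case False
    have "continuous_on (cball 0 1 - {-1}) (\<lambda>w. g (m w))"
    proof (rule continuous_on_compose2[OF g(1)])
      show "continuous_on (cball 0 1 - {-1}) m" by (rule continuous_on_subset[OF cm]) auto
      show "m ` (cball 0 1 - {-1}) \<subseteq> Cplus_cl" unfolding m_def by (auto intro!: Cayley_Re(1))
    qed
    then have "continuous_on (cball 0 1 - {-1}) F"
      by (rule continuous_on_eq) (auto simp: F_def)
    then have "continuous (at w within (cball 0 1 - {-1})) F"
      using w False by (simp add: continuous_on_eq_continuous_within)
    moreover have "at w within (cball 0 1 - {-1}) = at w within cball 0 1"
      by (rule at_within_nhd[of _ "- {-1}"]) (use False in auto)
    ultimately show ?thesis by (simp add: continuous_within)
  next
    case True
    let ?A = "at (-1) within cball (0::complex) 1"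
    have "filterlim (\<lambda>w. 1 + w) (nhds (1 + (-1 :: complex))) ?A" by (intro tendsto_intros)
    then have "filterlim (\<lambda>w::complex. 1 + w) (at 0) ?A"
      by (auto simp: filterlim_at eventually_at_filter nz)
    then have "filterlim m at_infinity ?A"
      unfolding m_def by (intro filterlim_divide_at_infinity[of _ "1 - (-1)"] tendsto_intros) auto
    moreover have "eventually (\<lambda>w. m w \<in> Cplus_cl) ?A"
      unfolding m_def eventually_at_filter by (auto intro!: always_eventually Cayley_Re(1))
    ultimately have "filterlim m (inf at_infinity (principal Cplus_cl)) ?A"
      by (simp add: filterlim_inf filterlim_principal)
    from filterlim_compose[OF g(3) this] have "((\<lambda>w. g (m w)) \<longlongrightarrow> 0) ?A" .
    moreover have "eventually (\<lambda>w. g (m w) = F w) ?A" by (auto simp: eventually_at_filter F_def)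
    ultimately have "(F \<longlongrightarrow> 0) ?A" by (rule Lim_transform_eventually)
    then show ?thesis using True by (simp add: continuous_within F_def)
  qed
  then have Fc: "continuous_on (cball 0 1) F" by (simp add: continuous_on_eq_continuous_within)
  have Fh: "F holomorphic_on ball 0 1"
  proof -
    have n1: "w \<noteq> -1" if "w \<in> ball 0 1" for w :: complex using that by auto
    have "(f \<circ> m) holomorphic_on ball 0 1"
    proof (rule holomorphic_on_compose_gen[OF _ hol])
      show "m holomorphic_on ball 0 1" unfolding m_def by (intro holomorphic_intros) (use nz n1 in blast)
      show "m ` ball 0 1 \<subseteq> Cplus" using n1 by (auto simp: m_def intro!: Cayley_Re)
    qed
    then show ?thesis
    proof (rule holomorphic_transform)
      show "(f \<circ> m) w = F w" if "w \<in> ball 0 1" for w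
        using that n1[OF that] g(2)[of "m w"] Cayley_Re(2)[of w] by (simp add: F_def m_def)
    qed
  qed
  obtain P where P: "\<And>w. cmod w \<le> 1 \<Longrightarrow> cmod (F w - poly P w) < e / 2"
    using disc_algebra_poly_approx[OF Fc Fh, of "e / 2"] e by auto
  \<comment> \<open>Substitution of \<open>w = 2 * v - 1\<close> with
    \<open>v = 1 / (1 + z)\<close>. Subtracting the value at \<open>v = 0\<close> removes the
    constant term and costs only another \<open>e / 2\<close>, because \<open>F\<close> vanishes at
    \<open>-1\<close>.\<close>
  define R where "R = pcompose P [:-1, 2:] - [:poly P (-1):]"
  have R: "poly R v = poly P (2 * v - 1) - poly P (-1)" for v by (simp add: R_def poly_pcompose mult.commute)
  obtain a Q where Q: "R = pCons a Q" by (metis pCons_cases)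
  have "a = 0" using R[of 0] Q by simp
  show ?thesis
  proof (rule that[of Q])
    fix z assume z: "z \<in> Cplus"
    then have s: "1 + z \<noteq> 0" by (intro one_plus_Cplus_cl) (simp add: Cplus_def Cplus_cl_def)
    \<comment> \<open>The preimage of \<open>z\<close> under \<open>m\<close>, in resolvent form;
      the Cayley map is its own inverse.\<close>
    define w where "w = 2 * (1 / (1 + z)) - 1"
    have w: "w = (1 - z) / (1 + z)" using s by (simp add: w_def field_simps)
    have w1: "1 + w = 2 / (1 + z)" by (simp add: w_def)
    have "w \<noteq> -1" using w1 s by auto
    have "m w = (1 - w) / (1 + w)" by (simp add: m_def)
    also have "1 - w = 2 * z / (1 + z)" using s by (simp add: w field_simps)
    also have "(2 * z / (1 + z)) / (1 + w) = z" unfolding w1 using s by simp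
    finally have "F w = f z" using \<open>w \<noteq> -1\<close> g(2)[OF z] by (simp add: F_def)
    moreover have "cmod w \<le> 1"
    proof -
      have "(cmod (1 - z))\<^sup>2 \<le> (cmod (1 + z))\<^sup>2"
        unfolding cmod_power2 using z by (simp add: Cplus_def power2_eq_square algebra_simps)
      then have "cmod (1 - z) \<le> cmod (1 + z)" by (rule power2_le_imp_le) simp
      then show ?thesis using s by (simp add: w norm_divide)
    qed
    ultimately have "cmod (f z - poly P w) < e / 2" using P[of w] by simp
    moreover have "cmod (poly P (-1)) < e / 2" using P[of "-1"] by (simp add: F_def)
    moreover have eq: "f z - poly (pCons 0 Q) (1 / (1 + z)) = (f z - poly P w) + poly P (-1)"
      using R[of "1 / (1 + z)"] Q \<open>a = 0\<close> by (simp add: w_def)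
    ultimately show "cmod (f z - poly (pCons 0 Q) (1 / (1 + z))) < e"
      unfolding eq using norm_triangle_ineq[of "f z - poly P w" "poly P (-1)"] by linarith
  qed
qed

text \<open>\<open>g\<close> is uniformly close to a translate \<open>g (z + \<delta>)\<close>, and
  that translate is Lipschitz since \<open>deriv g\<close> is bounded to the right of
  \<open>\<delta>\<close>.\<close>

lemma B_space_uniformly_continuous:
  assumes g: "g \<in> B_space"
  shows "uniformly_continuous_on Cplus g"
  unfolding uniformly_continuous_on_def
proof (intro allI impI)
  fix e :: real assume e: "e > 0"
  have gh: "g holomorphic_on Cplus" using g by (simp add: B_space_def)
  obtain \<delta> where \<delta>: "0 < \<delta>" "B_norm (\<lambda>z. g z - g (z + of_real \<delta>)) \<le> ennreal (e / 4)"
    using shift_approx[OF g, of "e / 4"] e by auto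
  have sh: "cmod (g z - g (z + of_real \<delta>)) \<le> e / 4" if "z \<in> Cplus" for z
  proof -
    have "ennreal (cmod (g z - g (z + of_real \<delta>))) \<le> ennreal (e / 4)"
      using norm_le_sup_norm[OF that, of "\<lambda>z. g z - g (z + of_real \<delta>)"] sup_norm_le_B_norm \<delta>(2) by (meson order_trans)
    then show ?thesis using e by simp
  qed
  obtain G where G: "G \<ge> 0" "\<And>z. z \<in> Cplus \<Longrightarrow> cmod (g z) \<le> G" using B_space_bounded[OF g] by blast
  define L where "L = 2 * G / \<delta>"
  have L: "L \<ge> 0" using G \<delta> by (simp add: L_def)
  let ?S = "{w. Re w \<ge> \<delta>}"
  have sub: "w \<in> Cplus" if "w \<in> ?S" for w using that \<delta> by (simp add: Cplus_def)
  have lip: "cmod (g v - g w) \<le> L * cmod (v - w)" if "v \<in> ?S" "w \<in> ?S" for v w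
  proof (rule field_differentiable_bound[OF convex_halfspace_Re_ge])
    show "(g has_field_derivative deriv g w) (at w within ?S)" if "w \<in> ?S" for w
      by (rule holomorphic_derivI[OF gh open_Cplus sub[OF that]])
    show "cmod (deriv g w) \<le> L" if w: "w \<in> ?S" for w
    proof -
      have "cmod (deriv g w) \<le> 2 * G / Re w"
        using deriv_bound_Cplus[OF gh G(2) sub[OF w], of 1] by (simp add: mult.commute)
      also have "\<dots> \<le> 2 * G / \<delta>" using w \<delta> G by (intro divide_left_mono mult_pos_pos) auto
      finally show ?thesis by (simp add: L_def)
    qed
  qed (use that in auto)
  show "\<exists>d>0. \<forall>x\<in>Cplus. \<forall>x'\<in>Cplus. dist x' x < d \<longrightarrow> dist (g x') (g x) < e"
  proof (intro exI[of _ "e / 4 / (L + 1)"] conjI ballI impI)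
    show "e / 4 / (L + 1) > 0" using e L by simp
    fix x x' assume x: "x \<in> Cplus" "x' \<in> Cplus" "dist x' x < e / 4 / (L + 1)"
    have "cmod (g (x' + of_real \<delta>) - g (x + of_real \<delta>)) \<le> L * cmod (x' + of_real \<delta> - (x + of_real \<delta>))"
      using x by (intro lip) (auto simp: Cplus_def)
    also have "\<dots> \<le> (L + 1) * cmod (x' - x)" by (simp add: mult_right_mono)
    also have "\<dots> \<le> e / 4" using x(3) L by (simp add: dist_norm pos_less_divide_eq algebra_simps)
    finally have "cmod (g (x' + of_real \<delta>) - g (x + of_real \<delta>)) \<le> e / 4" .
    moreover have eq: "g x' - g x = (g x' - g (x' + of_real \<delta>)) + (g (x' + of_real \<delta>) - g (x + of_real \<delta>)) - (g x - g (x + of_real \<delta>))"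
      by simp
    have "cmod (g x' - g x) \<le> cmod (g x' - g (x' + of_real \<delta>)) + cmod (g (x' + of_real \<delta>) - g (x + of_real \<delta>)) + cmod (g x - g (x + of_real \<delta>))"
      unfolding eq using norm_triangle_ineq[of "g x' - g (x' + of_real \<delta>)" "g (x' + of_real \<delta>) - g (x + of_real \<delta>)"]
        norm_triangle_ineq4[of "(g x' - g (x' + of_real \<delta>)) + (g (x' + of_real \<delta>) - g (x + of_real \<delta>))" "g x - g (x + of_real \<delta>)"]
      by linarith
    ultimately show "dist (g x') (g x) < e" using sh[OF x(1)] sh[OF x(2)] e by (simp add: dist_norm)
  qed
qed

text \<open>Uniform continuity extends \<open>g\<close> to the boundary, and the decay is carried
  over by approaching boundary points from the right.\<close>

lemma C0_cl_B_spaceI: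
  assumes g: "g \<in> B_space" and lim: "(g \<longlongrightarrow> 0) at_inf_Cplus"
  shows "C0_cl g"
proof -
  have app: "(\<lambda>n. z + of_real (1 / real (Suc n))) \<longlonglongrightarrow> z" for z :: complex
  proof -
    have "(\<lambda>n. z + of_real (1 / real (Suc n))) \<longlonglongrightarrow> z + of_real 0"
      by (intro tendsto_intros LIMSEQ_Suc[OF lim_1_over_n])
    then show ?thesis by simp
  qed
  have inC: "z + of_real (1 / real (Suc n)) \<in> Cplus" if "z \<in> Cplus_cl" for z n
    using that by (simp add: Cplus_def Cplus_cl_def add_nonneg_pos)
  have cl: "Cplus_cl \<subseteq> closure Cplus"
  proof
    fix z assume "z \<in> Cplus_cl"
    then show "z \<in> closure Cplus" unfolding closure_sequential
      using app[of z] inC[of z] by (intro exI[of _ "\<lambda>n. z + of_real (1 / real (Suc n))"]) auto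
  qed
  obtain G where G: "uniformly_continuous_on (closure Cplus) G" "\<And>z. z \<in> Cplus \<Longrightarrow> g z = G z"
    by (rule uniformly_continuous_on_extension_on_closure[OF B_space_uniformly_continuous[OF g]], rule that)
  have Gc: "continuous_on Cplus_cl G"
    using uniformly_continuous_imp_continuous[OF G(1)] cl by (rule continuous_on_subset)
  have "(G \<longlongrightarrow> 0) (inf at_infinity (principal Cplus_cl))"
  proof (rule tendstoI)
    fix e :: real assume e: "e > 0"
    from tendstoD[OF lim, of "e / 2"] e obtain R where R: "\<And>z. z \<in> Cplus \<Longrightarrow> cmod z \<ge> R \<Longrightarrow> cmod (g z) < e / 2"
      by (auto simp: eventually_at_inf_Cplus)
    have "cmod (G z) < e" if z: "z \<in> Cplus_cl" "cmod z \<ge> R" for z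
    proof -
      have "(\<lambda>n. G (z + of_real (1 / real (Suc n)))) \<longlonglongrightarrow> G z"
        by (rule continuous_on_tendsto_compose[OF Gc app z(1)])
          (use inC[OF z(1)] in \<open>auto simp: Cplus_def Cplus_cl_def intro!: always_eventually less_imp_le\<close>)
      from tendsto_norm[OF this] have "cmod (G z) \<le> e / 2"
      proof (rule tendsto_upperbound)
        show "eventually (\<lambda>n. cmod (G (z + of_real (1 / real (Suc n)))) \<le> e / 2) sequentially"
        proof (rule always_eventually, rule allI)
          fix n
          \<comment> \<open>Moving right in the closed half-plane does not decrease the modulus, so
            the same radius \<open>R\<close> serves all approximating points.\<close>
          have "cmod z \<le> cmod (z + of_real (1 / real (Suc n)))"
            using z(1) unfolding cmod_def Cplus_cl_def
            by (auto intro!: real_sqrt_le_mono add_mono power_mono)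
          then show "cmod (G (z + of_real (1 / real (Suc n)))) \<le> e / 2"
            using R[OF inC[OF z(1), of n]] z(2) G(2)[OF inC[OF z(1), of n]] by simp
        qed
      qed simp
      then show ?thesis using e by simp
    qed
    then show "eventually (\<lambda>z. dist (G z) 0 < e) (inf at_infinity (principal Cplus_cl))"
      by (auto simp: eventually_inf_principal eventually_at_infinity intro!: exI[of _ R])
  qed
  then show ?thesis unfolding C0_cl_def using Gc G(2) by (intro exI[of _ G]) auto
qed

text \<open>Approximate rather than exact membership is asked for because a nonzero polynomial in
  \<open>1 / (1 + z)\<close> without constant term has a pole at \<open>-1\<close> and so agrees on
  \<open>Cplus\<close> with no member of \<open>J0\<close>.\<close>

lemma closure_sup_eq_C0:
  assumes tends: "\<And>h. h \<in> Y \<Longrightarrow> (h \<longlongrightarrow> 0) at_inf_Cplus"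
    and approx: "\<And>Q e. e > 0 \<Longrightarrow> \<exists>h\<in>Y. \<forall>z\<in>Cplus. cmod (h z - poly (pCons 0 Q) (1 / (1 + z))) < e"
  shows "closure_sup Y = {f \<in> B_space. C0_cl f}"
proof (intro equalityI subsetI CollectI conjI)
  fix g assume gY: "g \<in> closure_sup Y"
  then show g: "g \<in> B_space" by (simp add: closure_sup_def)
  show "C0_cl g"
  proof (rule C0_cl_B_spaceI[OF g], rule tendstoI)
    fix e :: real assume e: "e > 0"
    obtain h where h: "h \<in> Y" "sup_norm (\<lambda>z. g z - h z) < ennreal (e / 2)"
      using gY e unfolding closure_sup_def by (auto dest: spec[of _ "e / 2"])
    have C: "eventually (\<lambda>z. z \<in> Cplus) at_inf_Cplus" by (simp add: eventually_inf_principal)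
    from tendstoD[OF tends[OF h(1)], of "e / 2"] e have "eventually (\<lambda>z. dist (h z) 0 < e / 2) at_inf_Cplus" by simp
    with C show "eventually (\<lambda>z. dist (g z) 0 < e) at_inf_Cplus"
    proof eventually_elim
      case (elim z)
      have "ennreal (cmod (g z - h z)) < ennreal (e / 2)"
        using norm_le_sup_norm[OF elim(1), of "\<lambda>z. g z - h z"] h(2) by (rule le_less_trans)
      then have "cmod (g z - h z) < e / 2" by (simp add: ennreal_less_iff)
      then show ?case using elim(2) norm_triangle_sub[of "g z" "h z"] by (simp add: dist_norm)
    qed
  qed
next
  fix g assume "g \<in> {f \<in> B_space. C0_cl f}"
  then have g: "g \<in> B_space" "g holomorphic_on Cplus" "C0_cl g" by (auto simp: B_space_def)
  have "\<exists>h\<in>Y. sup_norm (\<lambda>z. g z - h z) < ennreal e" if e: "e > 0" for e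
  proof -
    obtain Q where Q: "\<And>z. z \<in> Cplus \<Longrightarrow> cmod (g z - poly (pCons 0 Q) (1 / (1 + z))) < e / 4"
      using C0_poly_approx[OF g(2,3), of "e / 4"] e by auto
    obtain h where h: "h \<in> Y" "\<And>z. z \<in> Cplus \<Longrightarrow> cmod (h z - poly (pCons 0 Q) (1 / (1 + z))) < e / 4"
      using approx[of "e / 4" Q] e by auto
    have "sup_norm (\<lambda>z. g z - h z) \<le> ennreal (e / 2)"
    proof (rule sup_norm_le, rule ennreal_leI)
      fix z assume z: "z \<in> Cplus"
      show "cmod (g z - h z) \<le> e / 2"
        using norm_triangle_ineq4[of "g z - poly (pCons 0 Q) (1 / (1 + z))" "h z - poly (pCons 0 Q) (1 / (1 + z))"] Q[OF z] h(2)[OF z]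
        by simp
    qed
    also have "\<dots> < ennreal e" using e by (intro ennreal_lessI) auto
    finally show ?thesis using h(1) by blast
  qed
  then show "g \<in> closure_sup Y" using g by (simp add: closure_sup_def)
qed

theorem mainTheorem7:
  shows "(\<forall>Y\<in>{LM, LL1, LMd, LMs, R0, J0}. closure_B Y = closure_sup Y) \<and>
         (\<forall>Y\<in>{LL1, R0, J0}. closure_B Y = {f \<in> B_space. C0_cl f})"
proof -
  have "closure_sup LL1 = {f \<in> B_space. C0_cl f}"
  proof (rule closure_sup_eq_C0[OF LL1_tendsto])
    fix Q and e :: real assume "e > 0"
    then show "\<exists>h\<in>LL1. \<forall>z\<in>Cplus. cmod (h z - poly (pCons 0 Q) (1 / (1 + z))) < e"
      using poly_in_LL1[of Q] by (metis cancel_comm_monoid_add_class.diff_cancel norm_zero)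
  qed
  moreover have "closure_sup R0 = {f \<in> B_space. C0_cl f}"
  proof (rule closure_sup_eq_C0[OF R0_tendsto])
    fix Q and e :: real assume "e > 0"
    then show "\<exists>h\<in>R0. \<forall>z\<in>Cplus. cmod (h z - poly (pCons 0 Q) (1 / (1 + z))) < e"
      using poly_in_R0[of Q] by (metis cancel_comm_monoid_add_class.diff_cancel norm_zero)
  qed
  moreover have "closure_sup J0 = {f \<in> B_space. C0_cl f}"
  proof (rule closure_sup_eq_C0)
    show "(h \<longlongrightarrow> 0) at_inf_Cplus" if "h \<in> J0" for h
      using that by (intro C0_cl_tendsto) (simp add: J0_def)
    fix Q and e :: real assume "e > 0"
    then show "\<exists>h\<in>J0. \<forall>z\<in>Cplus. cmod (h z - poly (pCons 0 Q) (1 / (1 + z))) < e"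
      using poly_approx_J0[of e Q] by metis
  qed
  ultimately show ?thesis
    using laplace_spaces_closures R0_closures J0_closures by auto
qed

end
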